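(* Let $0<p<1$. For any sequence $\mathcal{M}=\{M_n\}_{n\ge 0}$ of positive numbers there is an isomorphism of topological vector spaces $$\mathscr{W}^p_{\mathcal{M}}\cong L^p\oplus \mathscr{W}^p_{\mathcal{M}_1},$$ where $\mathcal{M}_1=\{M_{n+1}\}_{n\ge 0}$ is the shifted sequence.
   Context: $L^p=L^p(\mathbb{R})$ is the space of (classes of) Lebesgue measurable functions with $\|u\|_p=\left(\int_{\mathbb{R}}|u|^p\,dx\right)^{1/p}<\infty$, a complete quasi-normed space; direct sums carry the product topology. For a sequence $\mathcal{M}$ of positive numbers and $u\in C^\infty(\mathbb{R})$ put $\|u\|_{\mathcal{M}}=\sup_{n\ge 0}\frac{\|u^{(n)}\|_p}{M_n}$. The space $\mathscr{W}^p_{\mathcal{M}}$ is the abstract completion, with respect to the quasi-norm $\|\cdot\|_{\mathcal{M}}$, of the test class $\mathcal{C}=\{u\in C^\infty(\mathbb{R}):\|u\|_{\mathcal{M}}<\infty\}$ (no supremum-norm control on the derivatives is imposed); $\mathscr{W}^p_{\mathcal{M}_1}$ is defined in the same way from the sequence $\mathcal{M}_1$. *)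

theory Defs
  imports "HOL-Analysis.Analysis"
begin

section \<open>Quasi-normed spaces and topological vector spaces with explicit carriers\<close>

text \<open>
  The exponent \<open>p\<close> and the sequence \<open>M\<close> are term-level parameters, so the spaces depending on
  them cannot be types; they are records with an explicit carrier and explicit operations.
\<close>

record ('k, 'v) qnspace =
  vecs :: "'v set"
  vadd :: "'v \<Rightarrow> 'v \<Rightarrow> 'v"
  vscale :: "'k \<Rightarrow> 'v \<Rightarrow> 'v"
  qnorm :: "'v \<Rightarrow> real"

definition vdiff :: "('k::real_normed_field, 'v) qnspace \<Rightarrow> 'v \<Rightarrow> 'v \<Rightarrow> 'v" where
  "vdiff X x y = vadd X x (vscale X (- 1) y)"

definition qn_open :: "('k::real_normed_field, 'v) qnspace \<Rightarrow> 'v set \<Rightarrow> bool" where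
  "qn_open X U \<longleftrightarrow> U \<subseteq> vecs X \<and>
     (\<forall>x\<in>U. \<exists>e>0. \<forall>y\<in>vecs X. qnorm X (vdiff X y x) < e \<longrightarrow> y \<in> U)"

definition qn_topology :: "('k::real_normed_field, 'v) qnspace \<Rightarrow> 'v topology" where
  "qn_topology X = topology (qn_open X)"

lemma istopology_qn_open: "istopology (qn_open X)"
  unfolding istopology_def
proof (intro conjI allI impI)
  fix S T assume S: "qn_open X S" and T: "qn_open X T"
  show "qn_open X (S \<inter> T)"
    unfolding qn_open_def
  proof (intro conjI ballI)
    show "S \<inter> T \<subseteq> vecs X" using S by (auto simp: qn_open_def)
    fix x assume x: "x \<in> S \<inter> T"
    obtain d where d: "d > 0" "\<forall>y\<in>vecs X. qnorm X (vdiff X y x) < d \<longrightarrow> y \<in> S"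
      using S x unfolding qn_open_def by blast
    obtain e where e: "e > 0" "\<forall>y\<in>vecs X. qnorm X (vdiff X y x) < e \<longrightarrow> y \<in> T"
      using T x unfolding qn_open_def by blast
    show "\<exists>e>0. \<forall>y\<in>vecs X. qnorm X (vdiff X y x) < e \<longrightarrow> y \<in> S \<inter> T"
      using d e by (intro exI[of _ "min d e"]) auto
  qed
next
  fix K assume K: "\<forall>S\<in>K. qn_open X S"
  show "qn_open X (\<Union>K)"
    unfolding qn_open_def
  proof (intro conjI ballI)
    show "\<Union>K \<subseteq> vecs X" using K by (auto simp: qn_open_def)
    fix x assume "x \<in> \<Union>K"
    then obtain S where S: "S \<in> K" "x \<in> S" by blast
    then obtain e where "e > 0" "\<forall>y\<in>vecs X. qnorm X (vdiff X y x) < e \<longrightarrow> y \<in> S"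
      using K unfolding qn_open_def by blast
    then show "\<exists>e>0. \<forall>y\<in>vecs X. qnorm X (vdiff X y x) < e \<longrightarrow> y \<in> \<Union>K"
      using S(1) by blast
  qed
qed

lemma openin_qn_topology: "openin (qn_topology X) = qn_open X"
  unfolding qn_topology_def by (rule topology_inverse'[OF istopology_qn_open])

lemma topspace_qn_topology [simp]: "topspace (qn_topology X) = vecs X"
proof
  show "topspace (qn_topology X) \<subseteq> vecs X"
    by (auto simp: topspace_def openin_qn_topology qn_open_def)
  have "qn_open X (vecs X)"
    by (auto simp: qn_open_def intro: zero_less_one)
  then show "vecs X \<subseteq> topspace (qn_topology X)"
    by (auto simp: topspace_def openin_qn_topology)
qed

text \<open>The underlying vectors of a \<open>tvs\<close> are the points of \<open>topspace\<close> of its topology.\<close>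

record ('k, 'v) tvs =
  ttop :: "'v topology"
  tadd :: "'v \<Rightarrow> 'v \<Rightarrow> 'v"
  tscale :: "'k \<Rightarrow> 'v \<Rightarrow> 'v"

definition tvs_of :: "('k::real_normed_field, 'v) qnspace \<Rightarrow> ('k, 'v) tvs" where
  "tvs_of X = \<lparr>ttop = qn_topology X, tadd = vadd X, tscale = vscale X\<rparr>"

definition direct_sum :: "('k, 'v) tvs \<Rightarrow> ('k, 'w) tvs \<Rightarrow> ('k, 'v \<times> 'w) tvs" where
  "direct_sum X Y = \<lparr>ttop = prod_topology (ttop X) (ttop Y),
     tadd = (\<lambda>(x, y) (x', y'). (tadd X x x', tadd Y y y')),
     tscale = (\<lambda>c (x, y). (tscale X c x, tscale Y c y))\<rparr>"

definition tvs_iso :: "('k, 'v) tvs \<Rightarrow> ('k, 'w) tvs \<Rightarrow> ('v \<Rightarrow> 'w) \<Rightarrow> bool" where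
  "tvs_iso X Y f \<longleftrightarrow> homeomorphic_map (ttop X) (ttop Y) f \<and>
     (\<forall>x\<in>topspace (ttop X). \<forall>y\<in>topspace (ttop X). f (tadd X x y) = tadd Y (f x) (f y)) \<and>
     (\<forall>c. \<forall>x\<in>topspace (ttop X). f (tscale X c x) = tscale Y c (f x))"

definition tvs_isomorphic :: "('k, 'v) tvs \<Rightarrow> ('k, 'w) tvs \<Rightarrow> bool" where
  "tvs_isomorphic X Y \<longleftrightarrow> (\<exists>f. tvs_iso X Y f)"


section \<open>Quotients and completions\<close>

text \<open>
  Quotient by an equivalence relation compatible with the operations and with \<open>qnorm\<close>, so
  that the unions below are single classes and the image of a class under \<open>qnorm\<close> is a singleton.
\<close>

definition qn_quotient ::
    "('k, 'v) qnspace \<Rightarrow> ('v \<times> 'v) set \<Rightarrow> ('k, 'v set) qnspace" where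
  "qn_quotient X R = \<lparr>vecs = vecs X // R,
     vadd = (\<lambda>A B. \<Union>a\<in>A. \<Union>b\<in>B. R `` {vadd X a b}),
     vscale = (\<lambda>c A. \<Union>a\<in>A. R `` {vscale X c a}),
     qnorm = (\<lambda>A. the_elem (qnorm X ` A))\<rparr>"

definition cauchy_seqs :: "('k::real_normed_field, 'v) qnspace \<Rightarrow> (nat \<Rightarrow> 'v) set" where
  "cauchy_seqs X = {s. (\<forall>n. s n \<in> vecs X) \<and>
     (\<forall>e>0. \<exists>N. \<forall>m\<ge>N. \<forall>n\<ge>N. qnorm X (vdiff X (s m) (s n)) < e)}"

text \<open>
  For a general quasi-norm \<open>lim (\<lambda>n. qnorm X (s n))\<close> need not exist along a Cauchy sequence. It
  does when some power \<open>(qnorm X) powr p\<close> with \<open>p > 0\<close> satisfies the triangle inequality, as is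
  the case for the spaces below.
\<close>

definition cauchy_space ::
    "('k::real_normed_field, 'v) qnspace \<Rightarrow> ('k, nat \<Rightarrow> 'v) qnspace" where
  "cauchy_space X = \<lparr>vecs = cauchy_seqs X,
     vadd = (\<lambda>s t n. vadd X (s n) (t n)),
     vscale = (\<lambda>c s n. vscale X c (s n)),
     qnorm = (\<lambda>s. lim (\<lambda>n. qnorm X (s n)))\<rparr>"

definition null_diff_rel ::
    "('k::real_normed_field, 'v) qnspace \<Rightarrow> ((nat \<Rightarrow> 'v) \<times> (nat \<Rightarrow> 'v)) set" where
  "null_diff_rel X = {(s, t). s \<in> cauchy_seqs X \<and> t \<in> cauchy_seqs X \<and>
     (\<lambda>n. qnorm X (vdiff X (s n) (t n))) \<longlonglongrightarrow> 0}"

definition qn_completion ::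
    "('k::real_normed_field, 'v) qnspace \<Rightarrow> ('k, (nat \<Rightarrow> 'v) set) qnspace" where
  "qn_completion X = qn_quotient (cauchy_space X) (null_diff_rel X)"


section \<open>The spaces \<open>L\<^sup>p\<close> on the real line\<close>

text \<open>
  Functions take values in a type of sort \<open>{real_normed_field, euclidean_space}\<close>, a
  finite-dimensional normed field extension of the reals; both \<open>real\<close> and \<open>complex\<close> are
  instances. The scalars are taken from the same field.
\<close>

definition Lp_enorm :: "real \<Rightarrow> (real \<Rightarrow> 'k::real_normed_vector) \<Rightarrow> ennreal" where
  "Lp_enorm p u = (let I = \<integral>\<^sup>+x. ennreal (norm (u x) powr p) \<partial>lebesgue
     in if I = \<infinity> then \<infinity> else ennreal (enn2real I powr (1 / p)))"

definition Lp_functions ::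
    "real \<Rightarrow> ('k::{real_normed_field, euclidean_space}, real \<Rightarrow> 'k) qnspace" where
  "Lp_functions p = \<lparr>vecs = {u. u \<in> borel_measurable lebesgue \<and> Lp_enorm p u < \<infinity>},
     vadd = (\<lambda>u v x. u x + v x),
     vscale = (\<lambda>c u x. c * u x),
     qnorm = (\<lambda>u. enn2real (Lp_enorm p u))\<rparr>"

definition ae_rel ::
    "real \<Rightarrow> ((real \<Rightarrow> 'k::{real_normed_field, euclidean_space}) \<times> (real \<Rightarrow> 'k)) set" where
  "ae_rel p = {(u, v). u \<in> vecs (Lp_functions p) \<and> v \<in> vecs (Lp_functions p) \<and>
     (AE x in lebesgue. u x = v x)}"

definition Lp_space ::
    "real \<Rightarrow> ('k::{real_normed_field, euclidean_space}, (real \<Rightarrow> 'k) set) qnspace" where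
  "Lp_space p = qn_quotient (Lp_functions p) (ae_rel p)"


section \<open>The spaces \<open>W\<close> of Carleman--Sobolev type\<close>

definition nth_derivative :: "nat \<Rightarrow> (real \<Rightarrow> 'k::real_normed_vector) \<Rightarrow> real \<Rightarrow> 'k" where
  "nth_derivative n u = ((\<lambda>f x. vector_derivative f (at x)) ^^ n) u"

definition smooth_real :: "(real \<Rightarrow> 'k::real_normed_vector) \<Rightarrow> bool" where
  "smooth_real u \<longleftrightarrow> (\<forall>n x. nth_derivative n u differentiable (at x))"

definition carleman_enorm ::
    "real \<Rightarrow> (nat \<Rightarrow> real) \<Rightarrow> (real \<Rightarrow> 'k::real_normed_vector) \<Rightarrow> ennreal" where
  "carleman_enorm p M u = (SUP n. Lp_enorm p (nth_derivative n u) / ennreal (M n))"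

definition test_class ::
    "real \<Rightarrow> (nat \<Rightarrow> real) \<Rightarrow> ('k::{real_normed_field, euclidean_space}, real \<Rightarrow> 'k) qnspace" where
  "test_class p M = \<lparr>vecs = {u. smooth_real u \<and> carleman_enorm p M u < \<infinity>},
     vadd = (\<lambda>u v x. u x + v x),
     vscale = (\<lambda>c u x. c * u x),
     qnorm = (\<lambda>u. enn2real (carleman_enorm p M u))\<rparr>"

definition W_space ::
    "real \<Rightarrow> (nat \<Rightarrow> real) \<Rightarrow>
      ('k::{real_normed_field, euclidean_space}, (nat \<Rightarrow> real \<Rightarrow> 'k) set) qnspace" where
  "W_space p M = qn_completion (test_class p M)"

end

theory Submission
  imports Defs
begin

text \<open>
  The isomorphism is induced by \<open>u \<mapsto> (u, u')\<close>, which embeds the test class of \<open>M\<close>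
  homeomorphically into \<open>L\<^sup>p\<close> times the test class of the shifted sequence; since \<open>L\<^sup>p\<close> is
  complete, it remains to see that the image is dense. For \<open>p < 1\<close> a smooth step from \<open>0\<close> to \<open>1\<close>
  can have all its derivatives arbitrarily small in \<open>L\<^sup>p\<close>: take an infinite convolution of uniform
  distributions on \<open>[0, a n]\<close>, with widths decreasing fast enough. Staircases built from such steps
  approximate every continuous function in \<open>L\<^sup>p\<close>. Given \<open>u\<close> in \<open>L\<^sup>p\<close> and \<open>g\<close> in the second test
  class, let \<open>G\<close> be a primitive of \<open>g\<close>, approximate \<open>u\<close> by a continuous \<open>v\<close>, and follow \<open>G - v\<close> by a
  staircase \<open>S\<close>; then \<open>G - S\<close> is close to \<open>u\<close> and its derivative \<open>g - S'\<close> is close to \<open>g\<close>.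
\<close>

section \<open>Infinite averages\<close>

text \<open>A transition from 0 to 1 over a width \<open>a\<close> has slope about
  \<open>1 / a\<close> on a set of length about \<open>a\<close>, so its derivative has mass about
  \<open>a powr (1 - p)\<close>, which tends to 0 with \<open>a\<close>. A small derivative in L^p
  therefore says nothing about the function, and the two components of the pair become independent.
  The obstacle is the supremum over all orders: rescaling one fixed profile multiplies the mass of
  the n-th derivative by \<open>a powr (1 - n * p)\<close>, which controls only the orders
  \<open>n < 1 / p\<close>. Hence every order gets a width of its own, chosen after the earlier
  ones, and this is how an arbitrary positive \<open>M\<close> can be served. All estimates are made
  for p-th powers: \<open>Lp_mass\<close> and \<open>pdist\<close> obey the ordinary triangle
  inequality, and the bounds \<open>r * M n powr p\<close> for all \<open>n\<close> replace the
  supremum. Elements of the completion are classes of Cauchy sequences, so the component maps are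
  defined on sequences and their identities are shown up to distance zero.\<close>

lemma powr_add_subadd:
  fixes a b p :: real
  assumes "0 \<le> a" "0 \<le> b" "0 < p" "p \<le> 1"
  shows "(a + b) powr p \<le> a powr p + b powr p"
proof (cases "a + b = 0")
  case True
  then show ?thesis using assms by simp
next
  case False
  then have s: "a + b > 0" using assms by linarith
  have *: "t \<le> t powr p" if "0 \<le> t" "t \<le> 1" for t :: real
    using powr_mono'[of p 1 t] that assms by (cases "t = 0") auto
  have "1 = a / (a + b) + b / (a + b)" using s by (simp flip: add_divide_distrib)
  also have "\<dots> \<le> (a / (a + b)) powr p + (b / (a + b)) powr p"
    using s assms by (intro add_mono *) auto
  also have "\<dots> = (a powr p + b powr p) / (a + b) powr p"
    using s assms by (simp add: powr_divide add_divide_distrib)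
  finally show ?thesis using s by (simp add: field_simps)
qed

text \<open>Convolution with the uniform density on \<open>[0, a]\<close>, written over
  \<open>[0, 1]\<close> so that the domain of integration does not depend on
  \<open>a\<close>.\<close>

definition average :: "real \<Rightarrow> (real \<Rightarrow> real) \<Rightarrow> real \<Rightarrow> real" where
  "average a f x = integral {0..1} (\<lambda>t. f (x - a * t))"

text \<open>The properties that \<open>average\<close> preserves. It looks only to the left, so the
  value \<open>0\<close> on the negative half-line survives, whereas the point from which the value
  is \<open>1\<close> moves to the right and is tracked separately.\<close>

definition step_like :: "(real \<Rightarrow> real) \<Rightarrow> bool" where
  "step_like f \<longleftrightarrow> continuous_on UNIV f \<and> mono f \<and> (\<forall>x\<le>0. f x = 0) \<and> (\<forall>x. f x \<le> 1)"

lemma step_like_nonneg: "step_like f \<Longrightarrow> 0 \<le> f x"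
  unfolding step_like_def by (metis linorder_le_cases monoD order_refl)

lemma continuous_affine_integrable:
  fixes f :: "real \<Rightarrow> real"
  assumes "continuous_on UNIV f"
  shows "(\<lambda>t. f (x - a * t)) integrable_on {0..1::real}"
  by (intro integrable_continuous_real continuous_on_compose2[OF assms] continuous_intros) auto

text \<open>With an antiderivative \<open>F\<close> of \<open>f\<close>, substitution turns the
  average into \<open>(F x - F (x - a)) / a\<close>. Averaging a merely continuous function thus
  makes it differentiable.\<close>

lemma average_has_derivative:
  assumes "continuous_on UNIV f" "0 < a"
  shows "(average a f has_real_derivative (f x - f (x - a)) / a) (at x)"
proof -
  have "\<exists>F. \<forall>x. (F has_vector_derivative f x) (at x)"
    using einterval_antiderivative[of "-\<infinity>" "\<infinity>" f] assms(1)
    by (simp add: continuous_on_eq_continuous_at)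
  then obtain F where F: "\<And>x. (F has_real_derivative f x) (at x)"
    by (auto simp: has_real_derivative_iff_has_vector_derivative)
  have "average a f y = (F y - F (y - a)) / a" for y
  proof -
    have "((\<lambda>t. f (y - a * t)) has_integral
        (- F (y - a * 1) / a) - (- F (y - a * 0) / a)) {0..1}"
    proof (rule fundamental_theorem_of_calculus)
      fix t :: real assume "t \<in> {0..1}"
      have "((\<lambda>t. - F (y - a * t) / a) has_real_derivative f (y - a * t)) (at t)"
        using assms(2) by (auto intro!: derivative_eq_intros DERIV_chain2[OF F])
      then show "((\<lambda>t. - F (y - a * t) / a) has_vector_derivative f (y - a * t)) (at t within {0..1})"
        by (simp add: has_real_derivative_iff_has_vector_derivative has_vector_derivative_at_within)
    qed simp
    then show ?thesis unfolding average_def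
      by (simp add: integral_unique diff_divide_distrib)
  qed
  then have "average a f = (\<lambda>y. (F y - F (y - a)) / a)" by auto
  then show ?thesis using assms(2)
    by (auto intro!: derivative_eq_intros DERIV_chain2[OF F])
qed

lemma average_mono:
  assumes "continuous_on UNIV f" "continuous_on UNIV g" "\<And>t. 0 \<le> t \<Longrightarrow> f (x - a * t) \<le> g (y - a * t)"
  shows "average a f x \<le> average a g y"
  unfolding average_def
  by (intro integral_le continuous_affine_integrable assms) auto

lemma average_const: "average a (\<lambda>_. c) x = c"
  by (simp add: average_def)

lemma average_step_like:
  assumes f: "step_like f" and a: "0 < a"
  shows "step_like (average a f)"
  unfolding step_like_def
proof (intro conjI allI impI monoI)
  have c: "continuous_on UNIV f" using f by (simp add: step_like_def)
  show "continuous_on UNIV (average a f)"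
    using average_has_derivative[OF c a] DERIV_isCont continuous_at_imp_continuous_on by blast
  show "average a f x \<le> average a f y" if "x \<le> y" for x y
    using f that by (intro average_mono c) (auto simp: step_like_def monoD)
  show "average a f x \<le> 1" for x
    using average_mono[OF c continuous_on_const[of _ 1], of x a x] f
    by (simp add: average_const step_like_def)
  show "average a f x = 0" if "x \<le> 0" for x
  proof -
    have "x - a * t \<le> 0" if "t \<in> {0..1}" for t
    proof -
      have "0 \<le> a * t" using that a by simp
      with \<open>x \<le> 0\<close> show ?thesis by linarith
    qed
    then have "average a f x = integral {0..1::real} (\<lambda>t. 0)"
      unfolding average_def using f by (intro integral_cong) (auto simp: step_like_def)
    then show ?thesis by simp
  qed
qed

definition ramp :: "real \<Rightarrow> real \<Rightarrow> real" where
  "ramp a x = max 0 (min 1 (x / a))"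

lemma step_like_ramp: "0 < a \<Longrightarrow> step_like (ramp a)"
  unfolding step_like_def ramp_def
proof (intro conjI allI impI monoI)
  show "continuous_on UNIV (\<lambda>x. max 0 (min 1 (x / a)))"
    if "0 < a" using that by (intro continuous_intros) auto
next
  fix x y :: real assume "0 < a" "x \<le> y"
  then have "x / a \<le> y / a" by (simp add: divide_right_mono)
  then show "max 0 (min 1 (x / a)) \<le> max 0 (min 1 (y / a))" by linarith
qed (auto simp: divide_nonpos_pos)

text \<open>A step-like function lies below the indicator of the positive half-line, whose average
  is the ramp. This is the base case for the decrease of the iterated averages.\<close>

lemma average_le_ramp:
  assumes f: "step_like f" and a: "0 < a"
  shows "average a f x \<le> ramp a x"
proof -
  have c: "continuous_on UNIV f" using f by (simp add: step_like_def)
  consider "x \<le> 0" | "x \<ge> a" | "0 < x" "x < a" by linarith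
  then show ?thesis
  proof cases
    case 1
    then show ?thesis using average_step_like[OF f a] by (simp add: step_like_def ramp_def)
  next
    case 2
    then have "1 \<le> x / a" using a by simp
    then show ?thesis using average_step_like[OF f a] by (simp add: step_like_def ramp_def)
  next
    case 3
    have i: "((\<lambda>t. if t \<in> {0..x/a} then 1 else 0 :: real) has_integral x / a) {0..1}"
      using has_integral_restrict_closed_subintervals_eq[of 0 "x/a" 0 1 "\<lambda>_. 1::real" "x/a"]
        has_integral_const_real[of "1::real" 0 "x/a"] 3 a by (simp del: has_integral_const_real)
    have "average a f x \<le> x / a"
      unfolding average_def
    proof (rule has_integral_le[OF integrable_integral[OF continuous_affine_integrable[OF c]] i])
      fix t :: real assume t: "t \<in> {0..1}"
      show "f (x - a * t) \<le> (if t \<in> {0..x/a} then 1 else 0)"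
        using f a t by (auto simp: step_like_def field_simps)
    qed
    then show ?thesis using 3 a by (simp add: ramp_def)
  qed
qed

lemma step_like_diff_bounds:
  "step_like f \<Longrightarrow> 0 \<le> a \<Longrightarrow> 0 \<le> f x - f (x - a) \<and> f x - f (x - a) \<le> 1"
  using step_like_nonneg[of f "x - a"] unfolding step_like_def
  by (smt (verit) monoD)

lemma average_lipschitz:
  assumes f: "step_like f" and a: "0 < a"
  shows "\<bar>average a f x - average a f y\<bar> \<le> \<bar>x - y\<bar> / a"
proof -
  have c: "continuous_on UNIV f" using f by (simp add: step_like_def)
  have "norm (average a f x - average a f y) \<le> (1 / a) * norm (x - y)"
  proof (rule field_differentiable_bound[of UNIV "average a f" "\<lambda>x. (f x - f (x - a)) / a"])
    show "norm ((f z - f (z - a)) / a) \<le> 1 / a" for z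
      using step_like_diff_bounds[OF f, of a z] a
      by (simp add: abs_of_nonneg divide_right_mono)
  qed (use average_has_derivative[OF c a] in auto)
  then show ?thesis by simp
qed

text \<open>From the outside in, the averages have the widths \<open>a n\<close>, ...,
  \<open>a (n + m - 1)\<close>, and they act on a ramp of width \<open>a (n + m)\<close>.
  Differentiation removes the outermost average and leaves a difference quotient of the profile that
  begins at \<open>n + 1\<close>.\<close>

primrec iter_average :: "(nat \<Rightarrow> real) \<Rightarrow> nat \<Rightarrow> nat \<Rightarrow> real \<Rightarrow> real" where
  "iter_average a 0 n = ramp (a n)"
| "iter_average a (Suc m) n = average (a n) (iter_average a m (Suc n))"

text \<open>Every averaging of a step-like function decreases it, so the iterated averages decrease
  pointwise and have a limit.\<close>

lemma infinite_average_exists: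
  fixes a :: "nat \<Rightarrow> real"
  assumes a: "\<And>n. 0 < a n" "\<And>n. 2 * a (Suc n) \<le> a n"
  shows "\<exists>\<Psi>. \<forall>n. step_like (\<Psi> n) \<and> (\<forall>x\<ge>2 * a n. \<Psi> n x = 1) \<and>
    (\<forall>x. (\<Psi> n has_real_derivative (\<Psi> (Suc n) x - \<Psi> (Suc n) (x - a n)) / a n) (at x))"
proof -
  define psi where "psi = iter_average a"
  have psi_simps: "psi 0 n = ramp (a n)" "psi (Suc m) n = average (a n) (psi m (Suc n))" for m n
    by (auto simp: psi_def)
  have st: "step_like (psi m n)" for m n
    by (induction m arbitrary: n) (auto simp: psi_simps intro: average_step_like step_like_ramp a)
  have cont: "continuous_on UNIV (psi m n)" for m n
    using st by (simp add: step_like_def)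
  \<comment> \<open>The additional average is the innermost one: it lowers the ramp, and the
    averages around it are monotone.\<close>
  have dec: "psi (Suc m) n x \<le> psi m n x" for m n x
  proof (induction m arbitrary: n x)
    case 0
    then show ?case using average_le_ramp[OF st[of 0 "Suc n"] a(1)] by (simp add: psi_simps)
  next
    case (Suc m)
    show ?case unfolding psi_simps(2)[of "Suc m" n] psi_simps(2)[of m n]
      by (intro average_mono cont Suc)
  qed
  \<comment> \<open>The transition ends no later than the sum of the widths from \<open>a n\<close>
    on, which is at most \<open>2 * a n\<close> because each width is at most half of its
    predecessor.\<close>
  have one: "psi m n x = 1" if "x \<ge> 2 * a n" for m n x
    using that
  proof (induction m arbitrary: n x)
    case 0
    then have "1 \<le> x / a n" using a(1)[of n] by (simp add: field_simps)
    then show ?case by (simp add: psi_simps ramp_def)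
  next
    case (Suc m)
    have "average (a n) (psi m (Suc n)) x = integral {0..1::real} (\<lambda>t. 1)"
      unfolding average_def
    proof (intro integral_cong Suc.IH)
      fix t :: real assume "t \<in> {0..1}"
      then have "a n * t \<le> a n" using a(1)[of n] by (simp add: mult_left_le)
      then show "2 * a (Suc n) \<le> x - a n * t" using a(2)[of n] Suc.prems by linarith
    qed
    then show ?case by (simp add: psi_simps)
  qed
  have lip: "\<bar>psi (Suc m) n x - psi (Suc m) n y\<bar> \<le> \<bar>x - y\<bar> / a n" for m n x y
    unfolding psi_simps by (rule average_lipschitz[OF st a(1)])
  define \<Psi> where "\<Psi> n x = lim (\<lambda>m. psi m n x)" for n x
  have lim: "(\<lambda>m. psi m n x) \<longlonglongrightarrow> \<Psi> n x" for n x
  proof -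
    have "decseq (\<lambda>m. psi m n x)" using dec by (rule decseq_SucI)
    moreover have "\<And>m. 0 \<le> psi m n x" using st step_like_nonneg by blast
    ultimately have "convergent (\<lambda>m. psi m n x)"
      by (metis decseq_convergent convergent_def)
    then show ?thesis unfolding \<Psi>_def by (simp add: convergent_LIMSEQ_iff)
  qed
  \<comment> \<open>The constant \<open>1 / a n\<close> depends on the outermost width alone and not
    on \<open>m\<close>, so it passes to the pointwise limit and makes that limit
    continuous.\<close>
  have lipP: "\<bar>\<Psi> n x - \<Psi> n y\<bar> \<le> \<bar>x - y\<bar> / a n" for n x y
  proof (rule LIMSEQ_le_const2)
    show "(\<lambda>m. \<bar>psi (Suc m) n x - psi (Suc m) n y\<bar>) \<longlonglongrightarrow> \<bar>\<Psi> n x - \<Psi> n y\<bar>"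
      by (intro tendsto_intros LIMSEQ_Suc lim)
  qed (use lip in blast)
  have stP: "step_like (\<Psi> n)" for n
    unfolding step_like_def
  proof (intro conjI allI impI monoI)
    have "(1 / a n)-lipschitz_on UNIV (\<Psi> n)"
      using lipP a(1)[of n] by (intro lipschitz_onI) (auto simp: dist_real_def)
    then show "continuous_on UNIV (\<Psi> n)" by (rule lipschitz_on_continuous_on)
    show "\<Psi> n x \<le> \<Psi> n y" if "x \<le> y" for x y
      by (rule LIMSEQ_le[OF lim lim]) (use st that in \<open>auto simp: step_like_def monoD\<close>)
    show "\<Psi> n x = 0" if "x \<le> 0" for x
      using lim[of n x] st that by (simp add: step_like_def LIMSEQ_const_iff)
    show "\<Psi> n x \<le> 1" for x
      by (rule LIMSEQ_le_const2[OF lim]) (use st in \<open>auto simp: step_like_def\<close>)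
  qed
  \<comment> \<open>The recursion survives in the limit by dominated convergence under the average.
    The derivative formula is then \<open>average_has_derivative\<close> applied to the continuous
    function \<open>\<Psi> (Suc n)\<close>.\<close>
  have avg: "\<Psi> n x = average (a n) (\<Psi> (Suc n)) x" for n x
  proof -
    have "(\<lambda>m. average (a n) (psi m (Suc n)) x) \<longlonglongrightarrow> average (a n) (\<Psi> (Suc n)) x"
      unfolding average_def
    proof (rule dominated_convergence(2))
      show "(\<lambda>t. 1::real) integrable_on {0..1::real}" by (rule integrable_const_ivl)
      show "norm (psi m (Suc n) (x - a n * t)) \<le> 1" if "t \<in> {0..1}" for m t
        using st[of m "Suc n"] step_like_nonneg[OF st[of m "Suc n"]] by (simp add: step_like_def)
    qed (intro continuous_affine_integrable cont lim)+
    moreover have "(\<lambda>m. average (a n) (psi m (Suc n)) x) \<longlonglongrightarrow> \<Psi> n x"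
      using LIMSEQ_Suc[OF lim] by (simp add: psi_simps)
    ultimately show ?thesis using LIMSEQ_unique by blast
  qed
  have "step_like (\<Psi> n) \<and> (\<forall>x\<ge>2 * a n. \<Psi> n x = 1) \<and>
    (\<forall>x. (\<Psi> n has_real_derivative (\<Psi> (Suc n) x - \<Psi> (Suc n) (x - a n)) / a n) (at x))" for n
  proof (intro conjI allI impI stP)
    show "\<Psi> n x = 1" if "x \<ge> 2 * a n" for x
      using lim[of n x] that by (simp add: one LIMSEQ_const_iff)
    have "\<Psi> n = average (a n) (\<Psi> (Suc n))" using avg by auto
    then show "(\<Psi> n has_real_derivative (\<Psi> (Suc n) x - \<Psi> (Suc n) (x - a n)) / a n) (at x)" for x
      using average_has_derivative[OF _ a(1), of "\<Psi> (Suc n)" n x] stP[of "Suc n"]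
      by (simp add: step_like_def)
  qed
  then show ?thesis by blast
qed

section \<open>Smooth steps with small derivatives\<close>

text \<open>The p-th power of the quasi-norm, with values in \<open>ennreal\<close>. For
  \<open>p \<le> 1\<close> it is subadditive, so that estimates add up without the constants of a
  quasi-triangle inequality.\<close>

definition Lp_mass :: "real \<Rightarrow> (real \<Rightarrow> 'a::real_normed_vector) \<Rightarrow> ennreal" where
  "Lp_mass p u = (\<integral>\<^sup>+x. ennreal (norm (u x) powr p) \<partial>lebesgue)"

lemma Lp_mass_mono:
  "0 \<le> p \<Longrightarrow> (\<And>x. norm (u x) \<le> norm (v x)) \<Longrightarrow> Lp_mass p u \<le> Lp_mass p v"
  unfolding Lp_mass_def by (intro nn_integral_mono ennreal_leI powr_mono2) auto

lemma Lp_mass_cong_norm: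
  "(\<And>x. norm (u x) = norm (v x)) \<Longrightarrow> Lp_mass p u = Lp_mass p v"
  by (simp add: Lp_mass_def)

lemma Lp_mass_add:
  fixes u v :: "real \<Rightarrow> 'a::{real_normed_vector, second_countable_topology}"
  assumes "0 < p" "p \<le> 1"
    and [measurable]: "u \<in> borel_measurable lebesgue" "v \<in> borel_measurable lebesgue"
  shows "Lp_mass p (\<lambda>x. u x + v x) \<le> Lp_mass p u + Lp_mass p v"
proof -
  have "norm (u x + v x) powr p \<le> norm (u x) powr p + norm (v x) powr p" for x
    using powr_add_subadd[of "norm (u x)" "norm (v x)" p] assms(1,2)
      powr_mono2[of p "norm (u x + v x)" "norm (u x) + norm (v x)"] norm_triangle_ineq[of "u x" "v x"]
    by simp
  then have "Lp_mass p (\<lambda>x. u x + v x) \<le>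
      (\<integral>\<^sup>+x. ennreal (norm (u x) powr p) + ennreal (norm (v x) powr p) \<partial>lebesgue)"
    unfolding Lp_mass_def by (intro nn_integral_mono) (simp flip: ennreal_plus)
  also have "\<dots> = Lp_mass p u + Lp_mass p v"
    unfolding Lp_mass_def by (rule nn_integral_add) auto
  finally show ?thesis .
qed

lemma Lp_mass_diff:
  fixes u v :: "real \<Rightarrow> 'a::{real_normed_vector, second_countable_topology}"
  assumes "0 < p" "p \<le> 1" "u \<in> borel_measurable lebesgue" "v \<in> borel_measurable lebesgue"
  shows "Lp_mass p (\<lambda>x. u x - v x) \<le> Lp_mass p u + Lp_mass p v"
  using Lp_mass_add[of p u "\<lambda>x. - v x"] assms Lp_mass_cong_norm[of "\<lambda>x. - v x" v p] by simp

lemma Lp_mass_cmult: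
  fixes u :: "real \<Rightarrow> 'a::{real_normed_vector, second_countable_topology}"
  assumes [measurable]: "u \<in> borel_measurable lebesgue"
    and "0 \<le> C" "\<And>x. norm (v x) = C * norm (u x)"
  shows "Lp_mass p v = ennreal (C powr p) * Lp_mass p u"
  unfolding Lp_mass_def using assms(2)
  by (subst nn_integral_cmult[symmetric]) (auto simp: assms(3) powr_mult ennreal_mult)

lemma Lp_mass_shift:
  fixes u :: "real \<Rightarrow> 'a::{real_normed_vector, second_countable_topology}"
  assumes [measurable]: "u \<in> borel_measurable lebesgue"
  shows "Lp_mass p (\<lambda>x. u (x - c)) = Lp_mass p u"
  unfolding Lp_mass_def
  by (subst (2) nn_integral_real_affine_lebesgue[of _ 1 "- c"]) auto

lemma Lp_mass_le_interval:
  fixes u :: "real \<Rightarrow> 'a::real_normed_vector"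
  assumes "0 \<le> p" "0 \<le> C" "a \<le> b" "\<And>x. norm (u x) \<le> C * indicator {a..b} x"
  shows "Lp_mass p u \<le> ennreal (C powr p * (b - a))"
proof -
  have "Lp_mass p u \<le> (\<integral>\<^sup>+x. ennreal (C powr p) * indicator {a..b} x \<partial>lebesgue)"
    unfolding Lp_mass_def
  proof (intro nn_integral_mono)
    fix x
    have "norm (u x) powr p \<le> (C * indicator {a..b} x) powr p"
      using assms by (intro powr_mono2) auto
    then show "ennreal (norm (u x) powr p) \<le> ennreal (C powr p) * indicator {a..b} x"
      by (auto simp: indicator_def intro!: ennreal_leI split: if_splits)
  qed
  also have "\<dots> = ennreal (C powr p * (b - a))"
    using assms by (simp add: nn_integral_cmult_indicator ennreal_mult)
  finally show ?thesis .
qed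

lemma continuous_borel_measurable_lebesgue:
  "continuous_on UNIV f \<Longrightarrow> f \<in> borel_measurable lebesgue"
  by (intro measurable_completion) (simp add: borel_measurable_continuous_onI)

section \<open>Difference quotients and their L^p mass\<close>

definition diff_quot :: "real \<Rightarrow> (real \<Rightarrow> real) \<Rightarrow> real \<Rightarrow> real" where
  "diff_quot a f x = (f x - f (x - a)) / a"

text \<open>The newest quotient, of width \<open>a n\<close>, acts first. If \<open>\<Psi> n\<close>
  has derivative \<open>diff_quot (a n) (\<Psi> (Suc n))\<close>, then differentiating
  \<open>iter_diff_quot a n (\<Psi> n)\<close> yields, by definition, the next member of the same
  family.\<close>

primrec iter_diff_quot :: "(nat \<Rightarrow> real) \<Rightarrow> nat \<Rightarrow> (real \<Rightarrow> real) \<Rightarrow> real \<Rightarrow> real" where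
  "iter_diff_quot a 0 f = f"
| "iter_diff_quot a (Suc n) f = iter_diff_quot a n (diff_quot (a n) f)"

lemma continuous_diff_quot:
  assumes "continuous_on UNIV f" shows "continuous_on UNIV (diff_quot a f)"
  unfolding diff_quot_def divide_inverse
  by (intro continuous_intros continuous_on_compose2[OF assms]) auto

lemma iter_diff_quot_has_derivative:
  assumes "\<And>x. (f has_real_derivative g x) (at x)" "\<And>n. a n \<noteq> 0"
  shows "(iter_diff_quot a n f has_real_derivative iter_diff_quot a n g x) (at x)"
  using assms(1)
proof (induction n arbitrary: f g)
  case (Suc n)
  have "(diff_quot (a n) f has_real_derivative diff_quot (a n) g x) (at x)" for x
    unfolding diff_quot_def[abs_def] using assms(2)[of n]
    by (auto intro!: derivative_eq_intros Suc.prems DERIV_chain2[OF Suc.prems])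
  then show ?case using Suc.IH by simp
qed simp

lemma Lp_mass_diff_quot:
  assumes "0 < p" "p \<le> 1" "0 < a" "continuous_on UNIV f"
  shows "Lp_mass p (diff_quot a f) \<le> ennreal (2 * a powr (- p)) * Lp_mass p f"
proof -
  have m: "f \<in> borel_measurable lebesgue" "(\<lambda>x. f (x - a)) \<in> borel_measurable lebesgue"
    using assms(4)
    by (auto intro!: continuous_borel_measurable_lebesgue continuous_on_compose2[OF assms(4)] continuous_intros)
  have "Lp_mass p (diff_quot a f) = ennreal ((1/a) powr p) * Lp_mass p (\<lambda>x. f x - f (x - a))"
    using m assms(3) by (intro Lp_mass_cmult) (auto simp: diff_quot_def)
  also have "\<dots> \<le> ennreal ((1/a) powr p) * (Lp_mass p f + Lp_mass p f)"
    using Lp_mass_diff[OF assms(1,2) m] Lp_mass_shift[OF m(1)] by (intro mult_left_mono) auto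
  also have "\<dots> = ennreal (2 * a powr (- p)) * Lp_mass p f"
    using assms(3) by (simp add: powr_divide powr_minus_divide ennreal_mult'[of 2 "1 / a powr p", simplified] mult_2[symmetric] ac_simps)
  finally show ?thesis .
qed

text \<open>Each quotient costs the mass of two translates, divided by \<open>a j powr p\<close>.
  Only widths with \<open>j < n\<close> enter the product, so it is already fixed when
  \<open>a n\<close> is chosen.\<close>

lemma Lp_mass_iter_diff_quot:
  assumes "0 < p" "p \<le> 1" "\<And>n. 0 < a n" "continuous_on UNIV f"
  shows "Lp_mass p (iter_diff_quot a n f) \<le> ennreal (\<Prod>j<n. 2 * a j powr (- p)) * Lp_mass p f"
  using assms(4)
proof (induction n arbitrary: f)
  case (Suc n)
  have "Lp_mass p (iter_diff_quot a (Suc n) f)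
      \<le> ennreal (\<Prod>j<n. 2 * a j powr (- p)) * Lp_mass p (diff_quot (a n) f)"
    using Suc continuous_diff_quot by simp
  also have "\<dots> \<le> ennreal (\<Prod>j<n. 2 * a j powr (- p)) * (ennreal (2 * a n powr (- p)) * Lp_mass p f)"
    by (intro mult_left_mono Lp_mass_diff_quot assms Suc.prems) auto
  also have "\<dots> = ennreal (\<Prod>j<Suc n. 2 * a j powr (- p)) * Lp_mass p f"
    by (simp add: ennreal_mult prod_nonneg mult.assoc)
  finally show ?case .
qed simp

text \<open>All derivatives are carried along as data, so that sums, differences and shifts act
  order by order. \<open>nth_derivative_tower\<close> and \<open>smooth_real_imp_tower\<close>
  translate to and from \<open>nth_derivative\<close>.\<close>

definition derivative_tower :: "(nat \<Rightarrow> real \<Rightarrow> 'a::real_normed_vector) \<Rightarrow> bool" where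
  "derivative_tower F \<longleftrightarrow> (\<forall>n x. (F n has_vector_derivative F (Suc n) x) (at x))"

lemma exists_pos_powr_le:
  fixes C \<delta> w s :: real
  assumes "0 < s" "0 < \<delta>" "0 < w" "0 \<le> C"
  shows "\<exists>a>0. a \<le> w \<and> C * a powr s \<le> \<delta>"
proof -
  \<comment> \<open>The second argument solves \<open>(C + 1) * a powr s = \<delta>\<close>; the
    added \<open>1\<close> keeps the quotient meaningful for \<open>C = 0\<close>.\<close>
  define a where "a = min w ((\<delta> / (C + 1)) powr (1 / s))"
  have a: "0 < a" using assms by (auto simp: a_def)
  have "a powr s \<le> ((\<delta> / (C + 1)) powr (1 / s)) powr s"
    using assms a by (intro powr_mono2) (auto simp: a_def)
  also have "\<dots> = \<delta> / (C + 1)" using assms by (simp add: powr_powr)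
  finally have "C * a powr s \<le> C * (\<delta> / (C + 1))" using assms by (intro mult_left_mono) auto
  also have "\<dots> \<le> \<delta>" using assms by (simp add: field_simps)
  finally show ?thesis using a by (intro exI[of _ a]) (auto simp: a_def)
qed

text \<open>The derivative of order \<open>n + 1\<close> has \<open>L\<^sup>p\<close> mass at most a constant times \<open>a n powr (1 - p)\<close>, so each
  derivative in turn can be made as small as desired by the choice of the next width \<open>a n\<close>.
  The constant is the second component of the pairs constructed in the proof.\<close>

lemma cheap_step_exists:
  fixes p w :: real and \<delta> :: "nat \<Rightarrow> real"
  assumes p: "0 < p" "p < 1" and \<delta>: "\<And>n. 0 < \<delta> n" and w: "0 < w"
  shows "\<exists>\<Phi> :: nat \<Rightarrow> real \<Rightarrow> real. derivative_tower \<Phi> \<and> step_like (\<Phi> 0) \<and> (\<forall>x\<ge>w. \<Phi> 0 x = 1) \<and>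
    (\<forall>n. Lp_mass p (\<Phi> (Suc n)) \<le> ennreal (\<delta> n))"
proof -
  \<comment> \<open>The first component is the width \<open>a n\<close>, the second the constant
    \<open>\<Prod>j<n. 2 * a j powr (- p)\<close> left over by the earlier quotients. The bound
    \<open>w / 2\<close> makes the transition, which ends by \<open>2 * a 0\<close>, fit into
    \<open>[0, w]\<close>.\<close>
  define P where "P n x \<longleftrightarrow> 0 < fst x \<and> fst x \<le> w / 2 \<and> 0 < snd x \<and>
    snd x * (2 * fst x powr (1 - p)) \<le> \<delta> n \<and> (n = 0 \<longrightarrow> snd x = 1)" for n :: nat and x :: "real \<times> real"
  define Q where "Q x y \<longleftrightarrow> 2 * fst y \<le> fst x \<and> snd y = snd x * (2 * fst x powr (- p))"
    for x y :: "real \<times> real"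
  have "\<exists>f. \<forall>n. P n (f n) \<and> Q (f n) (f (Suc n))"
  proof (rule dependent_nat_choice)
    obtain a where "a > 0" "a \<le> w / 2" "2 * a powr (1 - p) \<le> \<delta> 0"
      using exists_pos_powr_le[of "1 - p" "\<delta> 0" "w / 2" 2] p \<delta> w by auto
    then have "P 0 (a, 1)" by (simp add: P_def)
    then show "\<exists>x. P 0 x" ..
  next
    fix x n assume x: "P n x"
    define C where "C = snd x * (2 * fst x powr (- p))"
    have "C > 0" using x by (simp add: C_def P_def)
    moreover obtain a where "a > 0" "a \<le> fst x / 2" "2 * C * a powr (1 - p) \<le> \<delta> (Suc n)"
      using exists_pos_powr_le[of "1 - p" "\<delta> (Suc n)" "fst x / 2" "2 * C"] p \<delta> x \<open>C > 0\<close>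
      by (auto simp: P_def)
    ultimately have "P (Suc n) (a, C)" "Q x (a, C)"
      using x by (auto simp: P_def Q_def C_def ac_simps)
    then show "\<exists>y. P (Suc n) y \<and> Q x y" by blast
  qed
  then obtain f where f: "\<And>n. P n (f n)" "\<And>n. Q (f n) (f (Suc n))" by blast
  define a C where "a n = fst (f n)" and "C n = snd (f n)" for n
  have a: "0 < a n" "a n \<le> w / 2" "C n * (2 * a n powr (1 - p)) \<le> \<delta> n" "2 * a (Suc n) \<le> a n"
    "C (Suc n) = C n * (2 * a n powr (- p))" "C 0 = 1" "0 < C n" for n
    using f(1)[of n] f(1)[of 0] f(2)[of n] by (simp_all add: a_def C_def P_def Q_def)
  have C: "C n = (\<Prod>j<n. 2 * a j powr (- p))" for n
    by (induction n) (auto simp: a(5,6))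
  obtain \<Psi> where \<Psi>: "\<And>n. step_like (\<Psi> n)" "\<And>n x. x \<ge> 2 * a n \<Longrightarrow> \<Psi> n x = 1"
    "\<And>n x. (\<Psi> n has_real_derivative diff_quot (a n) (\<Psi> (Suc n)) x) (at x)"
    using infinite_average_exists[of a, OF a(1) a(4)] unfolding diff_quot_def by blast
  have cont: "continuous_on UNIV (\<Psi> n)" for n using \<Psi>(1) by (simp add: step_like_def)
  define \<Phi> where "\<Phi> n = iter_diff_quot a n (\<Psi> n)" for n
  have "Lp_mass p (\<Phi> (Suc n)) \<le> ennreal (\<delta> n)" for n
  proof -
    \<comment> \<open>\<open>\<Psi> (Suc n)\<close> is constant outside
      \<open>[0, 2 * a (Suc n)]\<close>, hence outside \<open>[0, a n]\<close>, so its difference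
      with the shift by \<open>a n\<close> lives on \<open>[0, 2 * a n]\<close>. With height at most
      \<open>1 / a n\<close> the mass is at most \<open>2 * a n powr (1 - p)\<close>, whose exponent
      is positive because \<open>p < 1\<close>.\<close>
    have "Lp_mass p (diff_quot (a n) (\<Psi> (Suc n))) \<le> ennreal ((1 / a n) powr p * (2 * a n - 0))"
    proof (rule Lp_mass_le_interval)
      fix x
      have "\<Psi> (Suc n) x - \<Psi> (Suc n) (x - a n) = 0" if "x < 0 \<or> x > 2 * a n"
        using that a(1)[of n] a(4)[of n] \<Psi>(2)[of "Suc n" x] \<Psi>(2)[of "Suc n" "x - a n"]
          \<Psi>(1)[of "Suc n"] by (auto simp: step_like_def)
      then show "norm (diff_quot (a n) (\<Psi> (Suc n)) x) \<le> 1 / a n * indicator {0..2 * a n} x"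
        using step_like_diff_bounds[OF \<Psi>(1), of "a n" "Suc n" x] a(1)[of n]
        by (auto simp: diff_quot_def indicator_def abs_of_nonneg divide_right_mono not_le)
    qed (use p a(1)[of n] in auto)
    also have "(1 / a n) powr p * (2 * a n - 0) = 2 * a n powr (1 - p)"
      using a(1)[of n] by (simp add: powr_divide powr_diff)
    finally have "ennreal (C n) * Lp_mass p (diff_quot (a n) (\<Psi> (Suc n))) \<le>
        ennreal (C n) * ennreal (2 * a n powr (1 - p))"
      by (intro mult_left_mono) auto
    also have "\<dots> \<le> ennreal (\<delta> n)"
      using a(3)[of n] a(7)[of n] by (subst ennreal_mult[symmetric]) (auto intro: ennreal_leI)
    finally show ?thesis
      using Lp_mass_iter_diff_quot[of p a "diff_quot (a n) (\<Psi> (Suc n))" n] p a(1)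
        continuous_diff_quot[OF cont]
      unfolding \<Phi>_def C by (auto intro: order_trans)
  qed
  moreover have "derivative_tower \<Phi>"
    unfolding derivative_tower_def \<Phi>_def
    using iter_diff_quot_has_derivative[OF \<Psi>(3), of a] a(1)
    by (simp add: has_real_derivative_iff_has_vector_derivative less_imp_neq[symmetric])
  moreover have "\<Phi> 0 x = 1" if "x \<ge> w" for x
    using \<Psi>(2)[of 0 x] a(2)[of 0] that by (simp add: \<Phi>_def)
  ultimately show ?thesis using \<Psi>(1)[of 0] by (intro exI[of _ \<Phi>]) (auto simp: \<Phi>_def)
qed

section \<open>Smooth approximation with small derivatives\<close>

lemma nth_derivative_tower:
  assumes "derivative_tower F"
  shows "nth_derivative n (F 0) = F n"
proof (induction n)
  case (Suc n)
  then show ?case using assms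
    unfolding nth_derivative_def derivative_tower_def by (auto intro!: ext vector_derivative_at)
qed (simp add: nth_derivative_def)

lemma smooth_real_tower: "derivative_tower F \<Longrightarrow> smooth_real (F 0)"
  unfolding smooth_real_def nth_derivative_tower
  by (auto simp: derivative_tower_def intro: differentiableI_vector)

lemma smooth_real_imp_tower:
  "smooth_real u \<Longrightarrow> derivative_tower (\<lambda>n. nth_derivative n u)"
  unfolding smooth_real_def derivative_tower_def
  by (auto simp: nth_derivative_def simp flip: vector_derivative_works)

lemma derivative_tower_continuous: "derivative_tower F \<Longrightarrow> continuous_on UNIV (F n)"
  unfolding derivative_tower_def
  by (meson continuous_at_imp_continuous_on has_vector_derivative_continuous)

lemma derivative_tower_measurable:
  "derivative_tower F \<Longrightarrow> F n \<in> borel_measurable lebesgue"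
  by (intro continuous_borel_measurable_lebesgue derivative_tower_continuous)

lemma derivative_tower_const:
  "derivative_tower (\<lambda>n x. if n = 0 then c else 0)"
  unfolding derivative_tower_def by (auto intro!: derivative_eq_intros)

lemma derivative_tower_add:
  "derivative_tower F \<Longrightarrow> derivative_tower G \<Longrightarrow> derivative_tower (\<lambda>n x. F n x + G n x)"
  unfolding derivative_tower_def by (auto intro!: derivative_eq_intros)

lemma derivative_tower_diff:
  "derivative_tower F \<Longrightarrow> derivative_tower G \<Longrightarrow> derivative_tower (\<lambda>n x. F n x - G n x)"
  unfolding derivative_tower_def by (auto intro!: derivative_eq_intros)

lemma derivative_tower_scaleR_shift:
  fixes F :: "nat \<Rightarrow> real \<Rightarrow> real"
  assumes "derivative_tower F"
  shows "derivative_tower (\<lambda>n x. F n (x - a) *\<^sub>R c)"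
  unfolding derivative_tower_def
proof (intro allI)
  fix n x
  have "(F n has_real_derivative F (Suc n) (x - a)) (at (x - a))"
    using assms by (simp add: derivative_tower_def has_real_derivative_iff_has_vector_derivative)
  then have "((\<lambda>x. F n (x - a)) has_real_derivative F (Suc n) (x - a)) (at x)"
    using DERIV_shift[of "F n" "F (Suc n) (x - a)" x "- a"] by simp
  then show "((\<lambda>x. F n (x - a) *\<^sub>R c) has_vector_derivative F (Suc n) (x - a) *\<^sub>R c) (at x)"
    by (auto simp: has_real_derivative_iff_has_vector_derivative intro!: derivative_eq_intros)
qed

text \<open>A derivative is already determined by its restriction to a nondegenerate closed
  interval. This includes the end point of the half-line, where neighbouring pieces will be
  glued.\<close>

lemma derivative_tower_eq_0:
  assumes F: "derivative_tower F" and S: "S = {..a} \<or> S = {a..}"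
    and c: "\<And>x. x \<in> S \<Longrightarrow> F 0 x = c"
  shows "x \<in> S \<Longrightarrow> F (Suc n) x = 0"
proof (induction n arbitrary: x)
  have step: "F (Suc n) x = 0" if x: "x \<in> S" and k: "\<And>x. x \<in> S \<Longrightarrow> F n x = k" for n x k
  proof -
    obtain l r where lr: "l < r" "x \<in> {l..r}" "{l..r} \<subseteq> S"
      using S x that[of "x - 1" x] that[of x "x + 1"] by force
    have "(F n has_vector_derivative F (Suc n) x) (at x within {l..r})"
      using F unfolding derivative_tower_def by (auto intro: has_vector_derivative_at_within)
    moreover have "(F n has_vector_derivative 0) (at x within {l..r})"
      by (rule has_vector_derivative_transform[OF lr(2) _ has_vector_derivative_const[of k]])
         (use k lr in auto)
    ultimately show ?thesis
      using vector_derivative_unique_within_closed_interval[OF lr(1), of x] lr by auto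
  qed
  { case 0 then show ?case using step[of x 0 c] c by blast }
  { case (Suc n) then show ?case using step[of x "Suc n" 0] by blast }
qed

text \<open>A smooth staircase following \<open>h\<close> over \<open>[a, b]\<close>. It takes the
  exact values \<open>h a\<close> and \<open>h b\<close> and stays constant beyond the ends, so that
  consecutive paths fit together; \<open>\<eta>\<close> is a budget for the derivatives, measured
  against the weights \<open>m n\<close>.\<close>

definition cheap_path ::
    "real \<Rightarrow> (nat \<Rightarrow> real) \<Rightarrow> (real \<Rightarrow> 'a) \<Rightarrow> real \<Rightarrow> real \<Rightarrow> real \<Rightarrow> real \<Rightarrow>
      (nat \<Rightarrow> real \<Rightarrow> 'a::real_normed_vector) \<Rightarrow> bool" where
  "cheap_path p m h e \<eta> a b S \<longleftrightarrow> derivative_tower S \<and>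
     (\<forall>x\<le>a. S 0 x = h a) \<and> (\<forall>x\<ge>b. S 0 x = h b) \<and>
     (\<forall>x\<in>{a..b}. norm (h x - S 0 x) \<le> e) \<and>
     (\<forall>n. Lp_mass p (S (Suc n)) \<le> ennreal (\<eta> * m n))"

text \<open>Bisection (\<open>Bolzano\<close>) reduces the claim to short intervals, on which
  \<open>h\<close> varies little and a single step from \<open>h a\<close> to \<open>h b\<close>
  suffices. The number of steps need not be known in advance.\<close>

lemma cheap_path_exists:
  fixes h :: "real \<Rightarrow> 'a::{real_normed_vector, second_countable_topology}"
  assumes p: "0 < p" "p < 1" and m: "\<And>n. 0 < m n" and h: "continuous_on UNIV h"
    and e: "0 < e" and \<eta>: "0 < \<eta>" and ab: "a \<le> b"
  shows "\<exists>S. cheap_path p m h e \<eta> a b S"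
proof -
  \<comment> \<open>The induction runs over all budgets at once: gluing adds the masses of two
    paths, so each of them receives half of the budget. The tolerance \<open>e\<close> is not
    consumed.\<close>
  have "\<forall>\<eta>>0. \<exists>S. cheap_path p m h e \<eta> a b S"
    using ab
  proof (induction rule: Bolzano)
    case (trans a b c)
    show ?case
    proof (intro allI impI)
      fix \<eta> :: real assume "\<eta> > 0"
      then have \<eta>2: "\<eta> / 2 > 0" by simp
      obtain S T where S: "cheap_path p m h e (\<eta>/2) a b S" and T: "cheap_path p m h e (\<eta>/2) b c T"
        using trans(1,2) \<eta>2 by blast
      \<comment> \<open>On either side of \<open>b\<close> one of the two paths is constantly
        \<open>h b\<close>; subtracting this value leaves the other path.\<close>
      define U where "U n x = S n x + T n x - (if n = 0 then h b else 0)" for n x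
      have "Lp_mass p (U (Suc n)) \<le> ennreal (\<eta> * m n)" for n
      proof -
        have "Lp_mass p (U (Suc n)) \<le> Lp_mass p (S (Suc n)) + Lp_mass p (T (Suc n))"
          unfolding U_def using S T p
          by (simp, intro Lp_mass_add) (auto simp: cheap_path_def intro: derivative_tower_measurable)
        also have "\<dots> \<le> ennreal (\<eta> / 2 * m n) + ennreal (\<eta> / 2 * m n)"
          using S T by (intro add_mono) (auto simp: cheap_path_def)
        also have "\<dots> = ennreal (\<eta> * m n)"
          using \<open>\<eta> > 0\<close> m[of n] by (subst ennreal_plus[symmetric]) auto
        finally show ?thesis .
      qed
      moreover have "derivative_tower U"
        unfolding U_def using S T
        by (intro derivative_tower_diff derivative_tower_add derivative_tower_const)
           (auto simp: cheap_path_def)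
      moreover have "norm (h x - U 0 x) \<le> e" if "x \<in> {a..c}" for x
        using S T that by (cases "x \<le> b") (auto simp: cheap_path_def U_def)
      ultimately have "cheap_path p m h e \<eta> a c U"
        using S T trans(3,4) by (auto simp: cheap_path_def U_def)
      then show "\<exists>S. cheap_path p m h e \<eta> a c S" by blast
    qed
  next
    case (local x)
    have "isCont h x" using h by (simp add: continuous_on_eq_continuous_at)
    \<comment> \<open>With every value within \<open>e / 4\<close> of \<open>h x\<close>, both the
      height of the step and the distance from \<open>h a\<close> stay below \<open>e / 2\<close>,
      and together they stay within \<open>e\<close>.\<close>
    then obtain d where d: "d > 0" "\<And>y. dist y x < d \<Longrightarrow> dist (h y) (h x) < e / 4"
      unfolding continuous_at_eps_delta using e by (metis zero_less_divide_iff zero_less_numeral)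
    have "\<exists>S. cheap_path p m h e \<eta> a b S" if x: "a \<le> x" "x \<le> b" "b - a < d" and "\<eta> > 0" for a b \<eta>
    proof (cases "a = b")
      case True
      then show ?thesis using e \<open>\<eta> > 0\<close> m
        by (intro exI[of _ "\<lambda>n x. if n = 0 then h a else 0"])
           (auto simp: cheap_path_def derivative_tower_const Lp_mass_def)
    next
      case False
      then have ab: "a < b" using x by linarith
      define c where "c = h b - h a"
      define D where "D = norm c powr p"
      have D: "D \<ge> 0" by (simp add: D_def)
      \<comment> \<open>Scaling the step by \<open>c\<close> multiplies masses by \<open>D\<close>;
        dividing by \<open>D + 1\<close> compensates for this and also covers
        \<open>c = 0\<close>.\<close>
      define \<delta> where "\<delta> n = \<eta> * m n / (D + 1)" for n
      have "\<delta> n > 0" for n using \<open>\<eta> > 0\<close> m[of n] D by (simp add: \<delta>_def)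
      then obtain \<Phi> :: "nat \<Rightarrow> real \<Rightarrow> real" where \<Phi>: "derivative_tower \<Phi>" "step_like (\<Phi> 0)"
        "\<And>x. x \<ge> b - a \<Longrightarrow> \<Phi> 0 x = 1" "\<And>n. Lp_mass p (\<Phi> (Suc n)) \<le> ennreal (\<delta> n)"
        using cheap_step_exists[OF p, of \<delta> "b - a"] ab by auto
      define S where "S n x = \<Phi> n (x - a) *\<^sub>R c + (if n = 0 then h a else 0)" for n x
      have "derivative_tower S" unfolding S_def
        by (intro derivative_tower_add derivative_tower_const derivative_tower_scaleR_shift \<Phi>)
      moreover have "Lp_mass p (S (Suc n)) \<le> ennreal (\<eta> * m n)" for n
      proof -
        have "Lp_mass p (S (Suc n)) = ennreal (norm c powr p) * Lp_mass p (\<Phi> (Suc n))"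
          using Lp_mass_cmult[of "\<lambda>x. \<Phi> (Suc n) (x - a)" "norm c" "S (Suc n)" p]
            Lp_mass_shift[OF derivative_tower_measurable[OF \<Phi>(1)], of p "Suc n" a]
            derivative_tower_measurable[OF derivative_tower_scaleR_shift[OF \<Phi>(1)], of "Suc n" a "1::real"]
          by (simp add: S_def mult.commute)
        also have "\<dots> \<le> ennreal D * ennreal (\<delta> n)"
          unfolding D_def by (intro mult_left_mono \<Phi>) auto
        also have "\<dots> = ennreal (D * \<delta> n)" using D by (simp add: ennreal_mult')
        also have "\<dots> \<le> ennreal (\<eta> * m n)"
          using D \<open>\<eta> > 0\<close> m[of n] by (intro ennreal_leI) (simp add: \<delta>_def field_simps)
        finally show ?thesis .
      qed
      moreover have "norm (h y - S 0 y) \<le> e" if y: "y \<in> {a..b}" for y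
      proof -
        have near: "dist (h z) (h x) < e / 4" if "z \<in> {a..b}" for z
          using that x by (intro d) (auto simp: dist_real_def)
        have "norm c = dist (h b) (h a)" by (simp add: c_def dist_norm)
        also have "\<dots> < e / 4 + e / 4"
          using near[of a] near[of b] x dist_triangle2[of "h b" "h a" "h x"] by auto
        finally have c: "norm c < e / 2" by simp
        have "dist (h y) (h a) < e / 4 + e / 4"
          using near[of a] near[OF y] x dist_triangle2[of "h y" "h a" "h x"] by auto
        then have y': "norm (h y - h a) < e / 2" by (simp add: dist_norm)
        have "norm (\<Phi> 0 (y - a) *\<^sub>R c) \<le> norm c"
          using \<Phi>(2) step_like_nonneg[OF \<Phi>(2), of "y - a"]
          by (simp add: step_like_def mult_left_le_one_le)
        then have "norm (h y - h a - \<Phi> 0 (y - a) *\<^sub>R c) \<le> e / 2 + e / 2"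
          using norm_triangle_ineq4[of "h y - h a" "\<Phi> 0 (y - a) *\<^sub>R c"] c y' by linarith
        then show ?thesis by (simp add: S_def algebra_simps)
      qed
      ultimately have "cheap_path p m h e \<eta> a b S"
        using \<Phi>(2,3) by (auto simp: cheap_path_def S_def c_def step_like_def)
      then show ?thesis by blast
    qed
    with \<open>d > 0\<close> show ?case by blast
  qed
  then show ?thesis using \<eta> by blast
qed

text \<open>The unit intervals are enumerated by \<open>int_encode\<close> and receive the shares
  \<open>\<epsilon> / 2\<close>, \<open>\<epsilon> / 4\<close>, ... of the total. Their common end
  points are counted twice, which is harmless for an upper bound.\<close>

lemma Lp_mass_pieces:
  fixes u :: "real \<Rightarrow> 'a::{real_normed_vector, second_countable_topology}"
  assumes "\<And>x. u x = v \<lfloor>x\<rfloor> x" and [measurable]: "\<And>k. v k \<in> borel_measurable lebesgue"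
    and "0 \<le> \<epsilon>"
    and b: "\<And>k. Lp_mass p (\<lambda>x. indicator {of_int k..of_int k + 1} x *\<^sub>R v k x)
      \<le> ennreal (\<epsilon> * (1/2) ^ Suc (int_encode k))"
  shows "Lp_mass p u \<le> ennreal \<epsilon>"
proof -
  define g where "g i x = ennreal (norm (indicator {of_int (int_decode i)..of_int (int_decode i) + 1::real} x
      *\<^sub>R v (int_decode i) x) powr p)" for i x
  have [measurable]: "(\<lambda>x. indicator {of_int k..of_int k + 1::real} x *\<^sub>R v k x) \<in> borel_measurable lebesgue" for k
    by (intro borel_measurable_scaleR borel_measurable_indicator assms) simp
  have [measurable]: "g i \<in> borel_measurable lebesgue" for i
    unfolding g_def by measurable
  have "Lp_mass p u \<le> (\<integral>\<^sup>+x. (\<Sum>i. g i x) \<partial>lebesgue)"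
    unfolding Lp_mass_def
  proof (rule nn_integral_mono)
    fix x :: real
    have "ennreal (norm (u x) powr p) = g (int_encode \<lfloor>x\<rfloor>) x"
      using assms(1) floor_correct[of x] by (auto simp: g_def indicator_def)
    also have "\<dots> = (\<Sum>i\<in>{int_encode \<lfloor>x\<rfloor>}. g i x)" by simp
    also have "\<dots> \<le> (\<Sum>i. g i x)" by (intro sum_le_suminf) auto
    finally show "ennreal (norm (u x) powr p) \<le> (\<Sum>i. g i x)" .
  qed
  also have "\<dots> = (\<Sum>i. \<integral>\<^sup>+x. g i x \<partial>lebesgue)" by (intro nn_integral_suminf) measurable
  also have "\<dots> \<le> (\<Sum>i. ennreal (\<epsilon> * (1/2) ^ Suc i))"
    using b[of "int_decode i" for i] by (intro suminf_le) (auto simp: g_def Lp_mass_def)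
  also have "\<dots> = ennreal \<epsilon>"
    using sums_mult[OF power_half_series, of \<epsilon>] assms(3) by (intro suminf_ennreal_eq) auto
  finally show ?thesis .
qed

text \<open>The pieces on \<open>[k, k + 1]\<close> are constant beyond their end points, so near \<open>k\<close> the glued
  function is the sum of two neighbouring pieces minus \<open>h k\<close>, hence smooth.\<close>

lemma smooth_cheap_approximation:
  fixes h :: "real \<Rightarrow> 'a::{real_normed_vector, second_countable_topology}"
  assumes p: "0 < p" "p < 1" and m: "\<And>n. 0 < m n" and h: "continuous_on UNIV h" and \<epsilon>: "0 < \<epsilon>"
  shows "\<exists>S. derivative_tower S \<and> Lp_mass p (\<lambda>x. h x - S 0 x) \<le> ennreal \<epsilon> \<and>
    (\<forall>n. Lp_mass p (S (Suc n)) \<le> ennreal (\<epsilon> * m n))"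
proof -
  define \<eta> where "\<eta> k = \<epsilon> * (1/2) ^ Suc (int_encode k)" for k
  have \<eta>: "\<eta> k > 0" for k using \<epsilon> by (simp add: \<eta>_def)
  \<comment> \<open>A uniform error \<open>\<eta> k powr (1 / p)\<close> on an interval of length 1
    has mass at most \<open>\<eta> k\<close>.\<close>
  have "\<exists>S. cheap_path p m h (\<eta> k powr (1 / p)) (\<eta> k) (of_int k) (of_int k + 1) S" for k
    using \<eta>[of k] by (intro cheap_path_exists p m h) auto
  then obtain S where "\<And>k. cheap_path p m h (\<eta> k powr (1 / p)) (\<eta> k) (of_int k) (of_int k + 1) (S k)"
    by metis
  then have S: "derivative_tower (S k)" "\<And>x. x \<le> of_int k \<Longrightarrow> S k 0 x = h (of_int k)"
    "\<And>x. x \<ge> of_int k + 1 \<Longrightarrow> S k 0 x = h (of_int k + 1)"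
    "\<And>x. x \<in> {of_int k..of_int k + 1} \<Longrightarrow> norm (h x - S k 0 x) \<le> \<eta> k powr (1 / p)"
    "Lp_mass p (S k (Suc n)) \<le> ennreal (\<eta> k * m n)" for k n
    by (auto simp: cheap_path_def)
  have S0: "x \<le> of_int k \<Longrightarrow> S k (Suc n) x = 0" "x \<ge> of_int k + 1 \<Longrightarrow> S k (Suc n) x = 0" for k n x
    using derivative_tower_eq_0[OF S(1)[of k], of "{..of_int k}" "of_int k" "h (of_int k)"] S(2)
      derivative_tower_eq_0[OF S(1)[of k], of "{of_int k + 1..}" "of_int k + 1" "h (of_int k + 1)"] S(3)
    by auto
  define T where "T n x = S \<lfloor>x\<rfloor> n x" for n and x :: real
  have loc: "T n y = S (k - 1) n y + S k n y - (if n = 0 then h (of_int k) else 0)"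
    if "y \<in> {of_int k - 1<..<of_int k + 1}" for n k y
  proof -
    have "\<lfloor>y\<rfloor> = k - 1 \<and> y \<le> of_int k \<or> \<lfloor>y\<rfloor> = k \<and> y \<ge> of_int k"
      using that by (auto simp: floor_eq_iff)
    then show ?thesis
      using S(2)[of y k] S(3)[of "k - 1" y] S0(1)[of y k] S0(2)[of "k - 1" y]
      by (cases n) (auto simp: T_def)
  qed
  have "derivative_tower T"
    unfolding derivative_tower_def
  proof (intro allI)
    fix n :: nat and x :: real
    \<comment> \<open>For this \<open>k\<close> the open interval \<open>(k - 1, k + 1)\<close> is a
      neighbourhood of \<open>x\<close> even if \<open>x\<close> is the integer \<open>k\<close>, so
      \<open>loc\<close> also gives differentiability at the junctions.\<close>
    define k where "k = \<lfloor>x\<rfloor>"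
    have x: "x \<in> {of_int k - 1<..<of_int k + 1}"
      using of_int_floor_le[of x] floor_correct[of x] unfolding k_def greaterThanLessThan_iff
      by linarith
    have "derivative_tower (\<lambda>n y. S (k - 1) n y + S k n y - (if n = 0 then h (of_int k) else 0))"
      by (intro derivative_tower_diff derivative_tower_add derivative_tower_const S)
    then have "((\<lambda>y. S (k - 1) n y + S k n y - (if n = 0 then h (of_int k) else 0))
        has_vector_derivative T (Suc n) x) (at x)"
      unfolding derivative_tower_def loc[OF x] by blast
    then show "(T n has_vector_derivative T (Suc n) x) (at x)"
      by (rule has_vector_derivative_transform_within_open[OF _ _ x]) (auto simp: loc)
  qed
  moreover have "Lp_mass p (\<lambda>x. h x - T 0 x) \<le> ennreal \<epsilon>"
  proof (rule Lp_mass_pieces[where v = "\<lambda>k x. h x - S k 0 x"])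
    show "(\<lambda>x. h x - S k 0 x) \<in> borel_measurable lebesgue" for k
      by (intro continuous_borel_measurable_lebesgue continuous_intros h derivative_tower_continuous S)
    fix k
    have "Lp_mass p (\<lambda>x. indicator {of_int k..of_int k + 1} x *\<^sub>R (h x - S k 0 x))
        \<le> ennreal ((\<eta> k powr (1 / p)) powr p * (of_int k + 1 - of_int k))"
      using S(4) p by (intro Lp_mass_le_interval) (auto simp: indicator_def)
    then show "Lp_mass p (\<lambda>x. indicator {of_int k..of_int k + 1} x *\<^sub>R (h x - S k 0 x))
        \<le> ennreal (\<epsilon> * (1 / 2) ^ Suc (int_encode k))"
      using p \<eta>[of k] by (simp add: powr_powr \<eta>_def)
  qed (use \<epsilon> in \<open>auto simp: T_def\<close>)
  moreover have "Lp_mass p (T (Suc n)) \<le> ennreal (\<epsilon> * m n)" for n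
  proof (rule Lp_mass_pieces[where v = "\<lambda>k. S k (Suc n)"])
    fix k
    have "Lp_mass p (\<lambda>x. indicator {of_int k..of_int k + 1} x *\<^sub>R S k (Suc n) x) \<le> Lp_mass p (S k (Suc n))"
      using p by (intro Lp_mass_mono) (auto simp: indicator_def)
    also have "\<dots> \<le> ennreal (\<eta> k * m n)" by (rule S)
    finally show "Lp_mass p (\<lambda>x. indicator {of_int k..of_int k + 1} x *\<^sub>R S k (Suc n) x)
        \<le> ennreal (\<epsilon> * m n * (1 / 2) ^ Suc (int_encode k))"
      by (simp add: \<eta>_def ac_simps)
  qed (use \<epsilon> m[of n] S in \<open>auto simp: T_def intro: derivative_tower_measurable\<close>)
  ultimately show ?thesis by blast
qed

section \<open>Density and completeness\<close>

text \<open>A cutoff in \<open>x\<close>, equal to 1 on \<open>[-N, N]\<close> and vanishing outside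
  \<open>[-N-1, N+1]\<close>, times the radial retraction of \<open>y\<close> onto the ball of
  radius \<open>N\<close>. Both are continuous, so continuous functions stay continuous.\<close>

definition truncation :: "real \<Rightarrow> real \<Rightarrow> 'a::real_normed_vector \<Rightarrow> 'a" where
  "truncation N x y = (max 0 (min 1 (N + 1 - \<bar>x\<bar>)) * (N / max N (norm y))) *\<^sub>R y"

lemma truncation_eq: "\<bar>x\<bar> \<le> N \<Longrightarrow> norm y \<le> N \<Longrightarrow> 0 < N \<Longrightarrow> truncation N x y = y"
  by (simp add: truncation_def max_def min_def)

lemma norm_diff_truncation_le:
  assumes "0 < N" shows "norm (y - truncation N x y) \<le> norm y"
proof -
  define c where "c = max 0 (min 1 (N + 1 - \<bar>x\<bar>)) * (N / max N (norm y))"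
  have "0 \<le> c" using assms by (simp add: c_def)
  moreover have "c \<le> 1" unfolding c_def using assms by (intro mult_le_one) auto
  moreover have "y - truncation N x y = (1 - c) *\<^sub>R y"
    by (simp add: truncation_def c_def algebra_simps)
  ultimately show ?thesis by (simp add: mult_left_le_one_le)
qed

lemma norm_truncation_le:
  assumes "0 < N" shows "norm (truncation N x y) \<le> N * indicator {-N-1..N+1} x"
proof -
  have "N * norm y / max N (norm y) \<le> N"
    using assms by (simp add: divide_le_eq max_def)
  moreover have "0 \<le> N * norm y / max N (norm y)" using assms by simp
  moreover have "norm (truncation N x y) =
      max 0 (min 1 (N + 1 - \<bar>x\<bar>)) * (N * norm y / max N (norm y))"
    using assms by (simp add: truncation_def)
  ultimately show ?thesis
    using mult_mono[of "max 0 (min 1 (N + 1 - \<bar>x\<bar>))" "1::real" "N * norm y / max N (norm y)" N]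
    by (auto simp: indicator_def max_def split: if_splits)
qed

lemma continuous_truncation:
  assumes "0 < N" "continuous_on UNIV f"
  shows "continuous_on UNIV (\<lambda>x. truncation N x (f x))"
  unfolding truncation_def using assms by (intro continuous_intros) auto

lemma tendsto_truncation:
  assumes "0 < N" "f \<longlonglongrightarrow> l"
  shows "(\<lambda>n. truncation N x (f n)) \<longlonglongrightarrow> truncation N x l"
  unfolding truncation_def using assms by (intro tendsto_intros) auto

lemma measurable_truncation:
  fixes f :: "real \<Rightarrow> 'a::{real_normed_vector, second_countable_topology}"
  assumes [measurable]: "f \<in> borel_measurable lebesgue"
  shows "(\<lambda>x. truncation N x (f x)) \<in> borel_measurable lebesgue"
proof -
  have [measurable]: "(\<lambda>x::real. \<bar>x\<bar>) \<in> borel_measurable lebesgue"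
    by (intro continuous_borel_measurable_lebesgue continuous_intros)
  show ?thesis unfolding truncation_def by measurable
qed

lemma powr_norm_tendsto_0:
  assumes "f \<longlonglongrightarrow> l" "0 < p"
  shows "(\<lambda>n. ennreal (norm (l - f n) powr p)) \<longlonglongrightarrow> 0"
proof -
  have "(\<lambda>n. norm (l - f n)) \<longlonglongrightarrow> norm (l - l)" by (intro tendsto_intros assms)
  then have "(\<lambda>n. norm (l - f n) powr p) \<longlonglongrightarrow> 0 powr p"
    using assms by (intro tendsto_powr') auto
  then have "(\<lambda>n. ennreal (norm (l - f n) powr p)) \<longlonglongrightarrow> ennreal (0 powr p)"
    by (rule tendsto_ennrealI)
  then show ?thesis using assms by simp
qed

text \<open>Dominated convergence is used twice. Truncations of \<open>u\<close> converge to
  \<open>u\<close> under the bound by \<open>u\<close> itself; for a fixed level, truncations of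
  continuous functions tending to \<open>u\<close> almost everywhere converge under a bounded
  function of compact support.\<close>

lemma continuous_dense_Lp:
  fixes u :: "real \<Rightarrow> 'a::euclidean_space"
  assumes p: "0 < p" "p \<le> 1" and [measurable]: "u \<in> borel_measurable lebesgue"
    and fin: "Lp_mass p u < \<infinity>" and \<epsilon>: "0 < \<epsilon>"
  shows "\<exists>v. continuous_on UNIV v \<and> Lp_mass p (\<lambda>x. u x - v x) \<le> ennreal \<epsilon>"
proof -
  have [measurable]: "(\<lambda>x. truncation N x (f x)) \<in> borel_measurable lebesgue"
    if "f \<in> borel_measurable lebesgue" for f :: "real \<Rightarrow> 'a" and N
    by (rule measurable_truncation[OF that])
  have "(\<lambda>n. Lp_mass p (\<lambda>x. u x - truncation (real (Suc n)) x (u x))) \<longlonglongrightarrow> (\<integral>\<^sup>+(x::real). 0 \<partial>lebesgue)"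
    unfolding Lp_mass_def
  proof (rule nn_integral_dominated_convergence)
    show "(\<integral>\<^sup>+x. ennreal (norm (u x) powr p) \<partial>lebesgue) < \<infinity>" using fin by (simp add: Lp_mass_def)
    show "AE x in lebesgue. ennreal (norm (u x - truncation (real (Suc n)) x (u x)) powr p)
        \<le> ennreal (norm (u x) powr p)" for n
      using p by (intro AE_I2 ennreal_leI powr_mono2 norm_diff_truncation_le) auto
    show "AE x in lebesgue. (\<lambda>n. ennreal (norm (u x - truncation (real (Suc n)) x (u x)) powr p)) \<longlonglongrightarrow> 0"
    proof (intro AE_I2 tendsto_eventually)
      fix x
      show "\<forall>\<^sub>F n in sequentially. ennreal (norm (u x - truncation (real (Suc n)) x (u x)) powr p) = 0"
        using eventually_ge_at_top[of "nat \<lceil>max \<bar>x\<bar> (norm (u x))\<rceil>"]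
      proof eventually_elim
        case (elim n)
        then have "max \<bar>x\<bar> (norm (u x)) \<le> real (Suc n)" by linarith
        then show ?case using p by (simp add: truncation_eq)
      qed
    qed
  qed measurable
  then have "\<forall>\<^sub>F n in sequentially. Lp_mass p (\<lambda>x. u x - truncation (real (Suc n)) x (u x)) < ennreal (\<epsilon> / 2)"
    using \<epsilon> by (intro order_tendstoD(2)) auto
  then obtain n where n: "Lp_mass p (\<lambda>x. u x - truncation (real (Suc n)) x (u x)) < ennreal (\<epsilon> / 2)"
    by (auto dest: eventually_happens)
  define N where "N = real (Suc n)"
  have N: "N > 0" by (simp add: N_def)
  \<comment> \<open>By definition, \<open>measurable_on\<close> supplies continuous functions
    converging to \<open>u\<close> off a negligible set. Their size is uncontrolled, so they are
    truncated at the same level \<open>N\<close>.\<close>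
  have "u measurable_on UNIV" by (rule lebesgue_measurable_imp_measurable_on) auto
  then obtain Z g where Z: "negligible Z" "\<And>k. continuous_on UNIV (g k)"
    "\<And>x. x \<notin> Z \<Longrightarrow> (\<lambda>k. g k x) \<longlonglongrightarrow> u x"
    by (auto simp: measurable_on_def)
  have [measurable]: "g k \<in> borel_measurable lebesgue" for k
    by (rule continuous_borel_measurable_lebesgue[OF Z(2)])
  have "(\<lambda>k. Lp_mass p (\<lambda>x. truncation N x (u x) - truncation N x (g k x))) \<longlonglongrightarrow> (\<integral>\<^sup>+(x::real). 0 \<partial>lebesgue)"
    unfolding Lp_mass_def
  proof (rule nn_integral_dominated_convergence)
    show "(\<integral>\<^sup>+x. ennreal ((2 * N) powr p) * indicator {-N-1..N+1} x \<partial>lebesgue) < \<infinity>"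
      using N by (subst nn_integral_cmult_indicator) (auto simp: ennreal_mult_less_top)
    show "AE x in lebesgue. ennreal (norm (truncation N x (u x) - truncation N x (g k x)) powr p)
        \<le> ennreal ((2 * N) powr p) * indicator {-N-1..N+1} x" for k
    proof (intro AE_I2)
      fix x
      have "norm (truncation N x (u x) - truncation N x (g k x)) \<le> (2 * N) * indicator {-N-1..N+1} x"
        using norm_triangle_ineq4[of "truncation N x (u x)" "truncation N x (g k x)"]
          norm_truncation_le[OF N, of x "u x"] norm_truncation_le[OF N, of x "g k x"] by linarith
      then have "norm (truncation N x (u x) - truncation N x (g k x)) powr p
          \<le> ((2 * N) * indicator {-N-1..N+1} x) powr p"
        using p by (intro powr_mono2) auto
      then show "ennreal (norm (truncation N x (u x) - truncation N x (g k x)) powr p)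
          \<le> ennreal ((2 * N) powr p) * indicator {-N-1..N+1} x"
        by (auto simp: indicator_def intro!: ennreal_leI split: if_splits)
    qed
    have "AE x in lebesgue. x \<notin> Z"
      using Z(1) by (intro AE_not_in) (simp add: negligible_iff_null_sets)
    then show "AE x in lebesgue.
        (\<lambda>k. ennreal (norm (truncation N x (u x) - truncation N x (g k x)) powr p)) \<longlonglongrightarrow> 0"
    proof eventually_elim
      case (elim x)
      show ?case by (rule powr_norm_tendsto_0[OF tendsto_truncation[OF N Z(3)[OF elim]] p(1)])
    qed
    have "{-N-1..N+1} \<in> sets lebesgue" by simp
    then show "(\<lambda>x. ennreal ((2 * N) powr p) * indicator {-N-1..N+1} x) \<in> borel_measurable lebesgue"
      by (intro borel_measurable_times_ennreal borel_measurable_const borel_measurable_indicator)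
    show "(\<lambda>x. ennreal (norm (truncation N x (u x) - truncation N x (g k x)) powr p)) \<in> borel_measurable lebesgue" for k
      by measurable
  qed simp
  then have "\<forall>\<^sub>F k in sequentially.
      Lp_mass p (\<lambda>x. truncation N x (u x) - truncation N x (g k x)) < ennreal (\<epsilon> / 2)"
    using \<epsilon> by (intro order_tendstoD(2)) auto
  then obtain k where k: "Lp_mass p (\<lambda>x. truncation N x (u x) - truncation N x (g k x)) < ennreal (\<epsilon> / 2)"
    by (auto dest: eventually_happens)
  have "Lp_mass p (\<lambda>x. u x - truncation N x (g k x)) =
      Lp_mass p (\<lambda>x. (u x - truncation N x (u x)) + (truncation N x (u x) - truncation N x (g k x)))"
    by simp
  also have "\<dots> \<le> Lp_mass p (\<lambda>x. u x - truncation N x (u x)) +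
      Lp_mass p (\<lambda>x. truncation N x (u x) - truncation N x (g k x))"
    using p by (intro Lp_mass_add) measurable
  also have "\<dots> \<le> ennreal (\<epsilon> / 2) + ennreal (\<epsilon> / 2)"
    using n k by (intro add_mono) (auto simp: N_def)
  also have "\<dots> = ennreal \<epsilon>" using \<epsilon> by (subst ennreal_plus[symmetric]) auto
  finally show ?thesis using continuous_truncation[OF N Z(2)] by blast
qed

text \<open>The primitive of \<open>G 0\<close> may lie far outside L^p. Only its difference with
  the staircase has to be close to \<open>u\<close>, which is why staircases are made to follow
  arbitrary continuous functions on the whole line.\<close>

lemma derivative_pair_dense:
  fixes u :: "real \<Rightarrow> 'a::euclidean_space"
  assumes p: "0 < p" "p < 1" and m: "\<And>n. 0 < m n" and u: "u \<in> borel_measurable lebesgue"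
    and fin: "Lp_mass p u < \<infinity>" and G: "derivative_tower G" and \<epsilon>: "0 < \<epsilon>"
  shows "\<exists>W. derivative_tower W \<and> Lp_mass p (\<lambda>x. W 0 x - u x) \<le> ennreal \<epsilon> \<and>
    (\<forall>n. Lp_mass p (\<lambda>x. W (Suc n) x - G n x) \<le> ennreal (\<epsilon> * m n))"
proof -
  obtain v where v: "continuous_on UNIV v" "Lp_mass p (\<lambda>x. u x - v x) \<le> ennreal (\<epsilon> / 2)"
    using continuous_dense_Lp[OF _ _ u fin, of "\<epsilon> / 2"] p \<epsilon> by auto
  have "\<exists>A. \<forall>x. (A has_vector_derivative G 0 x) (at x)"
    using einterval_antiderivative[of "-\<infinity>" "\<infinity>" "G 0"] derivative_tower_continuous[OF G, of 0]
    by (simp add: continuous_on_eq_continuous_at)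
  then obtain A where A: "\<And>x. (A has_vector_derivative G 0 x) (at x)" by blast
  \<comment> \<open>The tower of the primitive: \<open>G\<close> moved up by one order, with
    \<open>A\<close> placed below it.\<close>
  define B where "B n = (case n of 0 \<Rightarrow> A | Suc n \<Rightarrow> G n)" for n
  have B: "derivative_tower B"
    using A G unfolding derivative_tower_def B_def by (auto split: nat.splits)
  have h: "continuous_on UNIV (\<lambda>x. A x - v x)"
    using derivative_tower_continuous[OF B, of 0] v by (auto simp: B_def intro!: continuous_intros)
  obtain S where S: "derivative_tower S" "Lp_mass p (\<lambda>x. A x - v x - S 0 x) \<le> ennreal (\<epsilon> / 2)"
    "\<And>n. Lp_mass p (S (Suc n)) \<le> ennreal (\<epsilon> / 2 * m n)"
    using smooth_cheap_approximation[where m = m, OF p m h, of "\<epsilon> / 2"] \<epsilon> by auto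
  define W where "W n x = B n x - S n x" for n x
  have "Lp_mass p (\<lambda>x. W 0 x - u x) = Lp_mass p (\<lambda>x. (A x - v x - S 0 x) - (u x - v x))"
    by (simp add: W_def B_def algebra_simps)
  also have "\<dots> \<le> Lp_mass p (\<lambda>x. A x - v x - S 0 x) + Lp_mass p (\<lambda>x. u x - v x)"
  proof (rule Lp_mass_diff)
    show "(\<lambda>x. A x - v x - S 0 x) \<in> borel_measurable lebesgue"
      by (intro borel_measurable_diff[OF continuous_borel_measurable_lebesgue[OF h]]
          derivative_tower_measurable S)
    show "(\<lambda>x. u x - v x) \<in> borel_measurable lebesgue"
      by (intro borel_measurable_diff u continuous_borel_measurable_lebesgue v)
  qed (use p in auto)
  also have "\<dots> \<le> ennreal (\<epsilon> / 2) + ennreal (\<epsilon> / 2)" by (intro add_mono v S)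
  also have "\<dots> = ennreal \<epsilon>" using \<epsilon> by (subst ennreal_plus[symmetric]) auto
  finally have "Lp_mass p (\<lambda>x. W 0 x - u x) \<le> ennreal \<epsilon>" .
  moreover have "Lp_mass p (\<lambda>x. W (Suc n) x - G n x) \<le> ennreal (\<epsilon> * m n)" for n
  proof -
    have "Lp_mass p (\<lambda>x. W (Suc n) x - G n x) = Lp_mass p (S (Suc n))"
      by (intro Lp_mass_cong_norm) (simp add: W_def B_def)
    also have "\<dots> \<le> ennreal (\<epsilon> / 2 * m n)" by (rule S)
    also have "\<dots> \<le> ennreal (\<epsilon> * m n)" using \<epsilon> m[of n] by (intro ennreal_leI) simp
    finally show ?thesis .
  qed
  moreover have "derivative_tower W" unfolding W_def by (intro derivative_tower_diff B S)
  ultimately show ?thesis by blast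
qed

section \<open>Completeness of L^p, expressed by masses\<close>

lemma summable_of_summable_powr:
  fixes d :: "nat \<Rightarrow> 'a::banach"
  assumes p: "0 < p" "p \<le> 1" and s: "summable (\<lambda>n. norm (d n) powr p)"
  shows "summable d"
proof (rule summable_comparison_test_ev[OF _ s])
  have "\<forall>\<^sub>F n in sequentially. norm (d n) powr p < 1"
    using summable_LIMSEQ_zero[OF s] by (rule order_tendstoD) simp
  then show "\<forall>\<^sub>F n in sequentially. norm (d n) \<le> norm (d n) powr p"
  proof eventually_elim
    case (elim n)
    have "norm (d n) \<le> 1"
    proof (rule ccontr)
      assume "\<not> norm (d n) \<le> 1"
      then have "1 \<le> norm (d n) powr p" using p by (intro ge_one_powr_ge_zero) auto
      with elim show False by simp
    qed
    then have "norm (d n) powr 1 \<le> norm (d n) powr p" using p by (intro powr_mono') auto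
    then show ?case by simp
  qed
qed

text \<open>The Riesz-Fischer argument: along a fast subsequence the p-th powers of the increments
  are summable almost everywhere, hence, as \<open>p \<le> 1\<close>, so are the increments. Fatou's
  lemma carries the Cauchy estimate over to the limit.\<close>

lemma Lp_complete:
  fixes u :: "nat \<Rightarrow> real \<Rightarrow> 'a::euclidean_space"
  assumes p: "0 < p" "p \<le> 1" and [measurable]: "\<And>n. u n \<in> borel_measurable lebesgue"
    and cauchy: "\<And>e::real. 0 < e \<Longrightarrow> \<exists>N. \<forall>m\<ge>N. \<forall>n\<ge>N. Lp_mass p (\<lambda>x. u m x - u n x) \<le> ennreal e"
  shows "\<exists>v\<in>borel_measurable lebesgue. \<forall>e>0. \<exists>N. \<forall>n\<ge>N. Lp_mass p (\<lambda>x. u n x - v x) \<le> ennreal e"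
proof -
  have "\<forall>k. \<exists>N. \<forall>m\<ge>N. \<forall>n\<ge>N. Lp_mass p (\<lambda>x. u m x - u n x) \<le> ennreal ((1/2) ^ k)"
    using cauchy by auto
  from choice[OF this]
  obtain N where N: "\<And>k m n. m \<ge> N k \<Longrightarrow> n \<ge> N k \<Longrightarrow> Lp_mass p (\<lambda>x. u m x - u n x) \<le> ennreal ((1/2) ^ k)"
    by blast
  \<comment> \<open>Summing the thresholds gives indices that exceed \<open>N k\<close> from
    position \<open>k\<close> on, although \<open>N\<close> may fail to be monotone.\<close>
  define r where "r k = (\<Sum>j\<le>k. N j)" for k
  have r: "r j \<ge> N k" if "k \<le> j" for j k
    unfolding r_def using that by (intro member_le_sum) auto
  define d where "d k x = u (r (Suc k)) x - u (r k) x" for k x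
  have [measurable]: "d k \<in> borel_measurable lebesgue" for k unfolding d_def by measurable
  have "(\<integral>\<^sup>+x. (\<Sum>k. ennreal (norm (d k x) powr p)) \<partial>lebesgue) = (\<Sum>k. Lp_mass p (d k))"
    unfolding Lp_mass_def by (intro nn_integral_suminf) measurable
  also have "\<dots> \<le> (\<Sum>k. ennreal ((1/2) ^ k))"
    unfolding d_def using N r by (intro suminf_le) auto
  finally have fin: "(\<integral>\<^sup>+x. (\<Sum>k. ennreal (norm (d k x) powr p)) \<partial>lebesgue) \<le> (\<Sum>k. ennreal ((1/2) ^ k))" .
  have "(\<Sum>k. ennreal ((1/2) ^ k)) \<noteq> top"
    by (intro ennreal_suminf_neq_top summable_geometric) auto
  with fin have "AE x in lebesgue. (\<Sum>k. ennreal (norm (d k x) powr p)) \<noteq> \<infinity>"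
    by (intro nn_integral_noteq_infinite) (auto simp: top_unique)
  then have conv: "AE x in lebesgue. convergent (\<lambda>k. u (r k) x)"
  proof eventually_elim
    case (elim x)
    then have "summable (\<lambda>k. d k x)"
      by (intro summable_of_summable_powr[OF p, of "\<lambda>k. d k x", OF summable_suminf_not_top]) auto
    then have "(\<lambda>n. u (r 0) x + (\<Sum>k<n. d k x)) \<longlonglongrightarrow> u (r 0) x + (\<Sum>k. d k x)"
      by (intro tendsto_intros summable_LIMSEQ)
    moreover have "u (r 0) x + (\<Sum>k<n. d k x) = u (r n) x" for n
      using sum_lessThan_telescope[of "\<lambda>k. u (r k) x" n] by (simp add: d_def)
    ultimately show ?case by (auto simp: convergent_def)
  qed
  define v where "v x = lim (\<lambda>k. u (r k) x)" for x
  have v[measurable]: "v \<in> borel_measurable lebesgue" unfolding v_def by measurable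
  have "\<exists>n0. \<forall>n\<ge>n0. Lp_mass p (\<lambda>x. u n x - v x) \<le> ennreal e" if e: "e > 0" for e :: real
  proof -
    obtain k where k: "(1/2) ^ k < e" using real_arch_pow_inv[OF e, of "1/2"] by auto
    have "Lp_mass p (\<lambda>x. u n x - v x) \<le> ennreal e" if n: "n \<ge> N k" for n
    proof -
      have "AE x in lebesgue. ennreal (norm (u n x - v x) powr p)
          \<le> liminf (\<lambda>j. ennreal (norm (u n x - u (r j) x) powr p))"
        using conv
      proof eventually_elim
        case (elim x)
        then have "(\<lambda>j. u (r j) x) \<longlonglongrightarrow> v x" by (simp add: v_def convergent_LIMSEQ_iff)
        then have "(\<lambda>j. norm (u n x - u (r j) x)) \<longlonglongrightarrow> norm (u n x - v x)" by (intro tendsto_intros)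
        then have "(\<lambda>j. ennreal (norm (u n x - u (r j) x) powr p)) \<longlonglongrightarrow> ennreal (norm (u n x - v x) powr p)"
          using p by (intro tendsto_ennrealI tendsto_powr') auto
        from lim_imp_Liminf[OF _ this] show ?case by simp
      qed
      then have "Lp_mass p (\<lambda>x. u n x - v x) \<le>
          (\<integral>\<^sup>+x. liminf (\<lambda>j. ennreal (norm (u n x - u (r j) x) powr p)) \<partial>lebesgue)"
        unfolding Lp_mass_def by (rule nn_integral_mono_AE)
      also have "\<dots> \<le> liminf (\<lambda>j. Lp_mass p (\<lambda>x. u n x - u (r j) x))"
        unfolding Lp_mass_def by (intro nn_integral_liminf) measurable
      also have "\<dots> \<le> liminf (\<lambda>j. ennreal ((1/2) ^ k))"
        by (rule Liminf_mono[OF eventually_sequentiallyI[of k]]) (rule N[OF n r])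
      also have "\<dots> \<le> ennreal e" using k by (simp add: Liminf_const ennreal_leI)
      finally show ?thesis .
    qed
    then show ?thesis by blast
  qed
  then show ?thesis using v by blast
qed

section \<open>Completions and quotients of pseudo-normed spaces\<close>

text \<open>The axioms are those properties of the translation-invariant pseudo-metric that are needed;
  unlike the vector space laws, they pass to Cauchy sequences by taking limits.\<close>

locale pseudo_p_normed =
  fixes X :: "('k::real_normed_field, 'v) qnspace" and p :: real
  assumes p_pos: "0 < p"
    and add_closed: "x \<in> vecs X \<Longrightarrow> y \<in> vecs X \<Longrightarrow> vadd X x y \<in> vecs X"
    and scale_closed: "x \<in> vecs X \<Longrightarrow> vscale X c x \<in> vecs X"
    and qnorm_nonneg: "x \<in> vecs X \<Longrightarrow> 0 \<le> qnorm X x"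
    and qnorm_vdiff_self: "x \<in> vecs X \<Longrightarrow> qnorm X (vdiff X x x) = 0"
    and qnorm_vdiff_commute: "x \<in> vecs X \<Longrightarrow> y \<in> vecs X \<Longrightarrow> qnorm X (vdiff X x y) = qnorm X (vdiff X y x)"
    and qnorm_vdiff_triangle: "x \<in> vecs X \<Longrightarrow> y \<in> vecs X \<Longrightarrow> z \<in> vecs X \<Longrightarrow>
      qnorm X (vdiff X x z) powr p \<le> qnorm X (vdiff X x y) powr p + qnorm X (vdiff X y z) powr p"
    and qnorm_vdiff_add: "x \<in> vecs X \<Longrightarrow> x' \<in> vecs X \<Longrightarrow> y \<in> vecs X \<Longrightarrow> y' \<in> vecs X \<Longrightarrow>
      qnorm X (vdiff X (vadd X x y) (vadd X x' y')) powr p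
        \<le> qnorm X (vdiff X x x') powr p + qnorm X (vdiff X y y') powr p"
    and qnorm_vdiff_scale: "x \<in> vecs X \<Longrightarrow> y \<in> vecs X \<Longrightarrow>
      qnorm X (vdiff X (vscale X c x) (vscale X c y)) = norm c * qnorm X (vdiff X x y)"
    and qnorm_le_add_vdiff: "x \<in> vecs X \<Longrightarrow> y \<in> vecs X \<Longrightarrow>
      qnorm X x powr p \<le> qnorm X y powr p + qnorm X (vdiff X x y) powr p"
begin

text \<open>The p-th power of the quasi-norm distance: it satisfies the triangle inequality with
  constant 1 and is thus a pseudo-metric on the carrier.\<close>

definition pdist :: "'v \<Rightarrow> 'v \<Rightarrow> real" where
  "pdist x y = qnorm X (vdiff X x y) powr p"

lemma vdiff_closed: "x \<in> vecs X \<Longrightarrow> y \<in> vecs X \<Longrightarrow> vdiff X x y \<in> vecs X"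
  unfolding vdiff_def by (intro add_closed scale_closed)

lemma pdist_nonneg: "0 \<le> pdist x y"
  by (simp add: pdist_def)

lemma pdist_self: "x \<in> vecs X \<Longrightarrow> pdist x x = 0"
  by (simp add: pdist_def qnorm_vdiff_self)

lemma pdist_commute: "x \<in> vecs X \<Longrightarrow> y \<in> vecs X \<Longrightarrow> pdist x y = pdist y x"
  by (simp add: pdist_def qnorm_vdiff_commute[of x y])

lemma pdist_triangle:
  "x \<in> vecs X \<Longrightarrow> y \<in> vecs X \<Longrightarrow> z \<in> vecs X \<Longrightarrow> pdist x z \<le> pdist x y + pdist y z"
  unfolding pdist_def by (rule qnorm_vdiff_triangle)

lemma pdist_add:
  "x \<in> vecs X \<Longrightarrow> x' \<in> vecs X \<Longrightarrow> y \<in> vecs X \<Longrightarrow> y' \<in> vecs X \<Longrightarrow>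
    pdist (vadd X x y) (vadd X x' y') \<le> pdist x x' + pdist y y'"
  unfolding pdist_def by (rule qnorm_vdiff_add)

lemma pdist_scale:
  "x \<in> vecs X \<Longrightarrow> y \<in> vecs X \<Longrightarrow> pdist (vscale X c x) (vscale X c y) = norm c powr p * pdist x y"
  by (simp add: pdist_def qnorm_vdiff_scale powr_mult qnorm_nonneg vdiff_closed)

lemma pdist_eq_0_iff: "pdist x y = 0 \<longleftrightarrow> qnorm X (vdiff X x y) = 0"
  by (simp add: pdist_def)

lemma pdist_less_iff:
  "x \<in> vecs X \<Longrightarrow> y \<in> vecs X \<Longrightarrow> 0 < e \<Longrightarrow> pdist x y < e powr p \<longleftrightarrow> qnorm X (vdiff X x y) < e"
  using p_pos qnorm_nonneg[OF vdiff_closed, of x y] powr_less_mono2[of p "qnorm X (vdiff X x y)" e]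
    powr_mono2[of p e "qnorm X (vdiff X x y)"]
  unfolding pdist_def by (meson less_imp_le not_le)

text \<open>Balls of radius \<open>e\<close> for \<open>qnorm\<close> are balls of radius
  \<open>e powr p\<close> for \<open>pdist\<close>. The topology, defined through
  \<open>qnorm\<close>, can therefore be handled by the pseudo-metric.\<close>

lemma ex_radius_iff:
  assumes "x \<in> vecs X"
  shows "(\<exists>e>0. \<forall>y\<in>vecs X. qnorm X (vdiff X y x) < e \<longrightarrow> P y) \<longleftrightarrow>
    (\<exists>e>0. \<forall>y\<in>vecs X. pdist y x < e \<longrightarrow> P y)"
proof
  assume "\<exists>e>0. \<forall>y\<in>vecs X. qnorm X (vdiff X y x) < e \<longrightarrow> P y"
  then obtain e where "e > 0" "\<forall>y\<in>vecs X. qnorm X (vdiff X y x) < e \<longrightarrow> P y" by blast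
  then show "\<exists>e>0. \<forall>y\<in>vecs X. pdist y x < e \<longrightarrow> P y"
    using pdist_less_iff[OF _ assms \<open>e > 0\<close>] by (intro exI[of _ "e powr p"]) auto
next
  assume "\<exists>e>0. \<forall>y\<in>vecs X. pdist y x < e \<longrightarrow> P y"
  then obtain e where e: "e > 0" "\<forall>y\<in>vecs X. pdist y x < e \<longrightarrow> P y" by blast
  have "(e powr (1 / p)) powr p = e" using e(1) p_pos by (simp add: powr_powr)
  then show "\<exists>e>0. \<forall>y\<in>vecs X. qnorm X (vdiff X y x) < e \<longrightarrow> P y"
    using pdist_less_iff[OF _ assms, of _ "e powr (1 / p)"] e
    by (intro exI[of _ "e powr (1 / p)"]) auto
qed

text \<open>The common form of the two relations in question: \<open>ae_rel\<close> and
  \<open>null_diff_rel\<close> are both identified with it later, so that quotients are treated only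
  once.\<close>

definition null_rel :: "('v \<times> 'v) set" where
  "null_rel = {(x, y). x \<in> vecs X \<and> y \<in> vecs X \<and> qnorm X (vdiff X x y) = 0}"

definition cls :: "'v \<Rightarrow> 'v set" where
  "cls x = null_rel `` {x}"

abbreviation quot :: "('k, 'v set) qnspace" where
  "quot \<equiv> qn_quotient X null_rel"

lemma equiv_null_rel: "equiv (vecs X) null_rel"
proof (rule equivI)
  show "null_rel \<subseteq> vecs X \<times> vecs X" by (auto simp: null_rel_def)
  show "refl_on (vecs X) null_rel" by (auto simp: refl_on_def null_rel_def qnorm_vdiff_self)
  show "sym null_rel" by (auto simp: sym_def null_rel_def qnorm_vdiff_commute)
  show "trans null_rel"
  proof (rule transI)
    fix x y z assume "(x, y) \<in> null_rel" "(y, z) \<in> null_rel"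
    then have v: "x \<in> vecs X" "y \<in> vecs X" "z \<in> vecs X" and "pdist x y = 0" "pdist y z = 0"
      by (auto simp: null_rel_def pdist_eq_0_iff)
    then have "pdist x z = 0"
      using pdist_triangle[OF v] pdist_nonneg[of x z] by linarith
    then show "(x, z) \<in> null_rel" using v by (simp add: null_rel_def pdist_eq_0_iff)
  qed
qed

lemma cls_eq_iff: "x \<in> vecs X \<Longrightarrow> y \<in> vecs X \<Longrightarrow> cls x = cls y \<longleftrightarrow> pdist x y = 0"
  using eq_equiv_class_iff[OF equiv_null_rel, of x y]
  by (simp add: cls_def null_rel_def pdist_eq_0_iff)

lemma mem_cls_iff:
  assumes "x \<in> vecs X"
  shows "y \<in> cls x \<longleftrightarrow> y \<in> vecs X \<and> cls y = cls x"
proof -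
  have "y \<in> cls x \<longleftrightarrow> y \<in> vecs X \<and> pdist x y = 0"
    using assms by (auto simp: cls_def null_rel_def pdist_eq_0_iff)
  then show ?thesis using cls_eq_iff[OF assms] by metis
qed

lemma cls_self: "x \<in> vecs X \<Longrightarrow> x \<in> cls x"
  by (simp add: mem_cls_iff)

lemma vecs_quot: "vecs quot = cls ` vecs X"
  by (auto simp: qn_quotient_def quotient_def cls_def)

lemma vadd_quot:
  assumes "x \<in> vecs X" "y \<in> vecs X"
  shows "vadd quot (cls x) (cls y) = cls (vadd X x y)"
proof -
  have "cls (vadd X a b) = cls (vadd X x y)" if "a \<in> cls x" "b \<in> cls y" for a b
  proof -
    have ab: "a \<in> vecs X" "b \<in> vecs X" "pdist a x = 0" "pdist b y = 0"
      using that assms mem_cls_iff cls_eq_iff by auto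
    then have "pdist (vadd X a b) (vadd X x y) = 0"
      using pdist_add[of a x b y] assms pdist_nonneg[of "vadd X a b" "vadd X x y"] by simp
    then show ?thesis using ab assms by (simp add: cls_eq_iff add_closed)
  qed
  then have "(\<Union>a\<in>cls x. \<Union>b\<in>cls y. cls (vadd X a b)) = cls (vadd X x y)"
    using cls_self assms by blast
  then show ?thesis by (simp add: qn_quotient_def cls_def)
qed

lemma vscale_quot:
  assumes "x \<in> vecs X"
  shows "vscale quot c (cls x) = cls (vscale X c x)"
proof -
  have "cls (vscale X c a) = cls (vscale X c x)" if "a \<in> cls x" for a
  proof -
    have a: "a \<in> vecs X" "pdist a x = 0" using that assms mem_cls_iff cls_eq_iff by auto
    then show ?thesis using assms by (simp add: cls_eq_iff scale_closed pdist_scale)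
  qed
  then have "(\<Union>a\<in>cls x. cls (vscale X c a)) = cls (vscale X c x)"
    using cls_self assms by blast
  then show ?thesis by (simp add: qn_quotient_def cls_def)
qed

text \<open>Applying \<open>qnorm_le_add_vdiff\<close> in both directions shows that points at
  distance zero have equal quasi-norm, so the image under \<open>qnorm\<close> of a class is a
  singleton.\<close>

lemma qnorm_quot:
  assumes "x \<in> vecs X"
  shows "qnorm quot (cls x) = qnorm X x"
proof -
  have "qnorm X a = qnorm X x" if "a \<in> cls x" for a
  proof -
    have a: "a \<in> vecs X" "pdist a x = 0" "pdist x a = 0"
      using that assms mem_cls_iff cls_eq_iff pdist_commute by auto
    then have "qnorm X a powr p = qnorm X x powr p"
      using qnorm_le_add_vdiff[of a x] qnorm_le_add_vdiff[of x a] assms by (simp add: pdist_def)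
    then have "(qnorm X a powr p) powr (1 / p) = (qnorm X x powr p) powr (1 / p)" by simp
    then show ?thesis using p_pos a assms qnorm_nonneg by (simp add: powr_powr)
  qed
  then have "qnorm X ` cls x = {qnorm X x}" using cls_self[OF assms] by blast
  then show ?thesis by (simp add: qn_quotient_def)
qed

lemma qnorm_vdiff_quot:
  "x \<in> vecs X \<Longrightarrow> y \<in> vecs X \<Longrightarrow> qnorm quot (vdiff quot (cls x) (cls y)) = qnorm X (vdiff X x y)"
  by (simp add: vdiff_def vscale_quot vadd_quot qnorm_quot scale_closed add_closed)

lemma qn_open_quot_iff:
  "qn_open quot U \<longleftrightarrow> U \<subseteq> cls ` vecs X \<and>
    (\<forall>x\<in>vecs X. cls x \<in> U \<longrightarrow> (\<exists>e>0. \<forall>y\<in>vecs X. pdist y x < e \<longrightarrow> cls y \<in> U))"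
proof -
  define Q where "Q A \<longleftrightarrow> (\<exists>e>0. \<forall>B\<in>vecs quot. qnorm quot (vdiff quot B A) < e \<longrightarrow> B \<in> U)" for A
  have Q: "Q (cls x) \<longleftrightarrow> (\<exists>e>0. \<forall>y\<in>vecs X. pdist y x < e \<longrightarrow> cls y \<in> U)" if x: "x \<in> vecs X" for x
  proof -
    have "Q (cls x) \<longleftrightarrow> (\<exists>e>0. \<forall>y\<in>vecs X. qnorm X (vdiff X y x) < e \<longrightarrow> cls y \<in> U)"
      unfolding Q_def vecs_quot by (simp add: qnorm_vdiff_quot x)
    then show ?thesis by (simp only: ex_radius_iff[OF x])
  qed
  have "qn_open quot U \<longleftrightarrow> U \<subseteq> cls ` vecs X \<and> (\<forall>A\<in>U. Q A)"
    unfolding qn_open_def vecs_quot Q_def ..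
  also have "\<dots> \<longleftrightarrow> U \<subseteq> cls ` vecs X \<and> (\<forall>x\<in>vecs X. cls x \<in> U \<longrightarrow> Q (cls x))"
    by blast
  finally show ?thesis using Q by simp
qed

lemma qn_open_ball:
  assumes "x \<in> vecs X"
  shows "qn_open quot (cls ` {y \<in> vecs X. pdist y x < r})"
  unfolding qn_open_quot_iff
proof (intro conjI ballI impI)
  fix z assume z: "z \<in> vecs X" "cls z \<in> cls ` {y \<in> vecs X. pdist y x < r}"
  then obtain y where y: "y \<in> vecs X" "pdist y x < r" "pdist z y = 0"
    using cls_eq_iff by auto
  then have "pdist z x < r" using pdist_triangle[of z y x] z assms by simp
  then show "\<exists>e>0. \<forall>w\<in>vecs X. pdist w z < e \<longrightarrow> cls w \<in> cls ` {y \<in> vecs X. pdist y x < r}"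
  proof (intro exI conjI ballI impI)
    fix w assume w: "w \<in> vecs X" "pdist w z < r - pdist z x"
    then have "pdist w x < r" using pdist_triangle[OF w(1) z(1) assms] by linarith
    then show "cls w \<in> cls ` {y \<in> vecs X. pdist y x < r}" using w by blast
  qed simp
qed auto

end

section \<open>Cauchy sequences as a pseudo-normed space\<close>

context pseudo_p_normed
begin

lemma cauchy_seqs_iff:
  "s \<in> cauchy_seqs X \<longleftrightarrow> (\<forall>n. s n \<in> vecs X) \<and> (\<forall>e>0. \<exists>N. \<forall>m\<ge>N. \<forall>n\<ge>N. pdist (s m) (s n) < e)"
proof -
  have "(\<forall>e>0. \<exists>N. \<forall>m\<ge>N. \<forall>n\<ge>N. qnorm X (vdiff X (s m) (s n)) < e) \<longleftrightarrow>
      (\<forall>e>0. \<exists>N. \<forall>m\<ge>N. \<forall>n\<ge>N. pdist (s m) (s n) < e)" (is "?L \<longleftrightarrow> ?R") if s: "\<forall>n. s n \<in> vecs X"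
  proof (intro iffI allI impI)
    fix e :: real assume L: ?L and e: "e > 0"
    have "(e powr (1 / p)) powr p = e" using e p_pos by (simp add: powr_powr)
    moreover obtain N where "\<forall>m\<ge>N. \<forall>n\<ge>N. qnorm X (vdiff X (s m) (s n)) < e powr (1 / p)"
      using L e by (metis powr_gt_zero less_irrefl)
    ultimately show "\<exists>N. \<forall>m\<ge>N. \<forall>n\<ge>N. pdist (s m) (s n) < e"
      using pdist_less_iff[of "s m" "s n" "e powr (1 / p)" for m n] s e by (metis powr_gt_zero less_irrefl)
  next
    fix e :: real assume R: ?R and e: "e > 0"
    then have "e powr p > 0" by simp
    then obtain N where "\<forall>m\<ge>N. \<forall>n\<ge>N. pdist (s m) (s n) < e powr p" using R by blast
    then show "\<exists>N. \<forall>m\<ge>N. \<forall>n\<ge>N. qnorm X (vdiff X (s m) (s n)) < e"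
      using pdist_less_iff[OF _ _ e] s by metis
  qed
  then show ?thesis unfolding cauchy_seqs_def by blast
qed

lemma cauchy_seqs_D:
  "s \<in> cauchy_seqs X \<Longrightarrow> s n \<in> vecs X"
  "s \<in> cauchy_seqs X \<Longrightarrow> 0 < e \<Longrightarrow> \<exists>N. \<forall>m\<ge>N. \<forall>n\<ge>N. pdist (s m) (s n) < e"
  unfolding cauchy_seqs_iff by auto

lemma vdiff_cauchy_space: "vdiff (cauchy_space X) s t = (\<lambda>n. vdiff X (s n) (t n))"
  by (simp add: vdiff_def cauchy_space_def)

lemma cauchy_seqs_add:
  assumes s: "s \<in> cauchy_seqs X" and t: "t \<in> cauchy_seqs X"
  shows "(\<lambda>n. vadd X (s n) (t n)) \<in> cauchy_seqs X"
  unfolding cauchy_seqs_iff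
proof (intro conjI allI impI)
  show "vadd X (s n) (t n) \<in> vecs X" for n
    by (intro add_closed cauchy_seqs_D(1) s t)
  fix e :: real assume "e > 0"
  then have e: "e / 2 > 0" by simp
  obtain N1 where N1: "\<And>m n. m \<ge> N1 \<Longrightarrow> n \<ge> N1 \<Longrightarrow> pdist (s m) (s n) < e / 2"
    using cauchy_seqs_D(2)[OF s e] by blast
  obtain N2 where N2: "\<And>m n. m \<ge> N2 \<Longrightarrow> n \<ge> N2 \<Longrightarrow> pdist (t m) (t n) < e / 2"
    using cauchy_seqs_D(2)[OF t e] by blast
  show "\<exists>N. \<forall>m\<ge>N. \<forall>n\<ge>N. pdist (vadd X (s m) (t m)) (vadd X (s n) (t n)) < e"
  proof (intro exI allI impI)
    fix m n assume "max N1 N2 \<le> m" "max N1 N2 \<le> n"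
    then show "pdist (vadd X (s m) (t m)) (vadd X (s n) (t n)) < e"
      using N1[of m n] N2[of m n] pdist_add[of "s m" "s n" "t m" "t n"]
        cauchy_seqs_D(1)[OF s] cauchy_seqs_D(1)[OF t] by fastforce
  qed
qed

lemma cauchy_seqs_scale:
  assumes s: "s \<in> cauchy_seqs X"
  shows "(\<lambda>n. vscale X c (s n)) \<in> cauchy_seqs X"
  unfolding cauchy_seqs_iff
proof (intro conjI allI impI)
  show "vscale X c (s n) \<in> vecs X" for n
    by (intro scale_closed cauchy_seqs_D(1) s)
  fix e :: real assume e: "e > 0"
  define k where "k = norm c powr p + 1"
  have k: "k > 0" "norm c powr p \<le> k" by (auto simp: k_def intro: add_nonneg_pos)
  obtain N where N: "\<And>m n. m \<ge> N \<Longrightarrow> n \<ge> N \<Longrightarrow> pdist (s m) (s n) < e / k"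
    using cauchy_seqs_D(2)[OF s, of "e / k"] e k by auto
  show "\<exists>N. \<forall>m\<ge>N. \<forall>n\<ge>N. pdist (vscale X c (s m)) (vscale X c (s n)) < e"
  proof (intro exI allI impI)
    fix m n assume "N \<le> m" "N \<le> n"
    have "pdist (vscale X c (s m)) (vscale X c (s n)) = norm c powr p * pdist (s m) (s n)"
      by (intro pdist_scale cauchy_seqs_D(1) s)
    also have "\<dots> \<le> k * pdist (s m) (s n)"
      by (intro mult_right_mono k pdist_nonneg)
    also have "\<dots> < k * (e / k)"
      by (intro mult_strict_left_mono N k) fact+
    finally show "pdist (vscale X c (s m)) (vscale X c (s n)) < e" using k by simp
  qed
qed

lemma cauchy_seqs_vdiff:
  "s \<in> cauchy_seqs X \<Longrightarrow> t \<in> cauchy_seqs X \<Longrightarrow> (\<lambda>n. vdiff X (s n) (t n)) \<in> cauchy_seqs X"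
  unfolding vdiff_def by (intro cauchy_seqs_add cauchy_seqs_scale)

text \<open>The p-th powers of the quasi-norms differ by at most \<open>pdist\<close>, hence form a
  Cauchy sequence of reals; taking roots gives convergence. The \<open>lim\<close> in
  \<open>cauchy_space\<close> is thus a genuine limit.\<close>

lemma qnorm_cauchy_space:
  assumes s: "s \<in> cauchy_seqs X"
  shows "(\<lambda>n. qnorm X (s n)) \<longlonglongrightarrow> qnorm (cauchy_space X) s"
proof -
  note sv = cauchy_seqs_D(1)[OF s]
  have "Cauchy (\<lambda>n. qnorm X (s n) powr p)"
  proof (rule metric_CauchyI)
    fix e :: real assume "e > 0"
    then obtain N where N: "\<And>m n. m \<ge> N \<Longrightarrow> n \<ge> N \<Longrightarrow> pdist (s m) (s n) < e"
      using cauchy_seqs_D(2)[OF s] by blast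
    have "dist (qnorm X (s m) powr p) (qnorm X (s n) powr p) < e" if "m \<ge> N" "n \<ge> N" for m n
    proof -
      have "qnorm X (s m) powr p < qnorm X (s n) powr p + e"
        using qnorm_le_add_vdiff[OF sv sv, of m n] N[of m n] that by (simp add: pdist_def)
      moreover have "qnorm X (s n) powr p < qnorm X (s m) powr p + e"
        using qnorm_le_add_vdiff[OF sv sv, of n m] N[of n m] that by (simp add: pdist_def)
      ultimately show ?thesis by (simp add: dist_real_def)
    qed
    then show "\<exists>M. \<forall>m\<ge>M. \<forall>n\<ge>M. dist (qnorm X (s m) powr p) (qnorm X (s n) powr p) < e" by blast
  qed
  then obtain l where l: "(\<lambda>n. qnorm X (s n) powr p) \<longlonglongrightarrow> l"
    using real_Cauchy_convergent unfolding convergent_def by blast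
  have "(\<lambda>n. (qnorm X (s n) powr p) powr (1 / p)) \<longlonglongrightarrow> l powr (1 / p)"
    using p_pos by (intro tendsto_powr' l) auto
  then have "(\<lambda>n. qnorm X (s n)) \<longlonglongrightarrow> l powr (1 / p)"
    using p_pos qnorm_nonneg[OF sv] by (simp add: powr_powr)
  then show ?thesis by (simp add: cauchy_space_def limI)
qed

lemma pdist_tendsto:
  assumes "s \<in> cauchy_seqs X" "t \<in> cauchy_seqs X"
  shows "(\<lambda>n. pdist (s n) (t n)) \<longlonglongrightarrow>
    qnorm (cauchy_space X) (vdiff (cauchy_space X) s t) powr p"
  unfolding pdist_def vdiff_cauchy_space
  using qnorm_cauchy_space[OF cauchy_seqs_vdiff[OF assms]] p_pos
    qnorm_nonneg[OF vdiff_closed] cauchy_seqs_D(1) assms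
  by (intro tendsto_powr') auto

text \<open>Every axiom is a closure property or an equation or weak inequality between quasi-norms,
  and the latter persist under termwise limits. The theory of quotients thereby applies to Cauchy
  sequences as well.\<close>

lemma pseudo_p_normed_cauchy_space: "pseudo_p_normed (cauchy_space X) p"
proof
  let ?C = "cauchy_space X"
  have [simp]: "vecs ?C = cauchy_seqs X" "vadd ?C s t = (\<lambda>n. vadd X (s n) (t n))"
    "vscale ?C c s = (\<lambda>n. vscale X c (s n))" for s t c
    by (auto simp: cauchy_space_def)
  show "0 < p" by (rule p_pos)
  show "vadd ?C s t \<in> vecs ?C" if "s \<in> vecs ?C" "t \<in> vecs ?C" for s t
    using that cauchy_seqs_add by simp
  show "vscale ?C c s \<in> vecs ?C" if "s \<in> vecs ?C" for s c
    using that cauchy_seqs_scale by simp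
  show nn: "0 \<le> qnorm ?C s" if "s \<in> vecs ?C" for s
  proof (rule LIMSEQ_le_const[OF qnorm_cauchy_space])
    show "\<exists>N. \<forall>n\<ge>N. 0 \<le> qnorm X (s n)"
      using that qnorm_nonneg cauchy_seqs_D(1) by auto
  qed (use that in simp)
  have lim: "(\<lambda>n. qnorm X (vdiff X (s n) (t n))) \<longlonglongrightarrow> qnorm ?C (vdiff ?C s t)"
    if "s \<in> vecs ?C" "t \<in> vecs ?C" for s t
    using qnorm_cauchy_space[OF cauchy_seqs_vdiff] that by (simp add: vdiff_cauchy_space)
  have limp: "(\<lambda>n. pdist (s n) (t n)) \<longlonglongrightarrow> qnorm ?C (vdiff ?C s t) powr p"
    if "s \<in> vecs ?C" "t \<in> vecs ?C" for s t
    using pdist_tendsto that by simp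
  note V = cauchy_seqs_D(1)
  show "qnorm ?C (vdiff ?C s s) = 0" if "s \<in> vecs ?C" for s
  proof -
    have "(\<lambda>n. qnorm X (vdiff X (s n) (s n))) = (\<lambda>n. 0)"
      using that V qnorm_vdiff_self by auto
    then show ?thesis using lim[OF that that] by (simp add: LIMSEQ_const_iff)
  qed
  show "qnorm ?C (vdiff ?C s t) = qnorm ?C (vdiff ?C t s)" if st: "s \<in> vecs ?C" "t \<in> vecs ?C" for s t
  proof -
    have "(\<lambda>n. qnorm X (vdiff X (s n) (t n))) = (\<lambda>n. qnorm X (vdiff X (t n) (s n)))"
      using st V by (intro ext qnorm_vdiff_commute) auto
    then show ?thesis using lim[OF st] lim[OF st(2,1)] LIMSEQ_unique by metis
  qed
  show "qnorm ?C (vdiff ?C s u) powr p \<le> qnorm ?C (vdiff ?C s t) powr p + qnorm ?C (vdiff ?C t u) powr p"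
    if "s \<in> vecs ?C" "t \<in> vecs ?C" "u \<in> vecs ?C" for s t u
    using that V by (intro LIMSEQ_le[OF limp tendsto_add[OF limp limp]]) (auto intro: pdist_triangle)
  show "qnorm ?C (vdiff ?C (vadd ?C s t) (vadd ?C s' t')) powr p
      \<le> qnorm ?C (vdiff ?C s s') powr p + qnorm ?C (vdiff ?C t t') powr p"
    if st: "s \<in> vecs ?C" "s' \<in> vecs ?C" "t \<in> vecs ?C" "t' \<in> vecs ?C" for s s' t t'
  proof (rule LIMSEQ_le[OF limp tendsto_add[OF limp limp]])
    show "\<exists>N. \<forall>n\<ge>N. pdist (vadd ?C s t n) (vadd ?C s' t' n) \<le> pdist (s n) (s' n) + pdist (t n) (t' n)"
      using st V by (auto intro: pdist_add)
  qed (use st cauchy_seqs_add in auto)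
  show "qnorm ?C (vdiff ?C (vscale ?C c s) (vscale ?C c t)) = norm c * qnorm ?C (vdiff ?C s t)"
    if st: "s \<in> vecs ?C" "t \<in> vecs ?C" for s t c
  proof (rule LIMSEQ_unique)
    show "(\<lambda>n. qnorm X (vdiff X (vscale ?C c s n) (vscale ?C c t n))) \<longlonglongrightarrow>
        qnorm ?C (vdiff ?C (vscale ?C c s) (vscale ?C c t))"
      using st cauchy_seqs_scale by (intro lim) auto
    have "(\<lambda>n. norm c * qnorm X (vdiff X (s n) (t n))) \<longlonglongrightarrow> norm c * qnorm ?C (vdiff ?C s t)"
      by (intro tendsto_mult_left lim st)
    then show "(\<lambda>n. qnorm X (vdiff X (vscale ?C c s n) (vscale ?C c t n))) \<longlonglongrightarrow>
        norm c * qnorm ?C (vdiff ?C s t)"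
      using st V by (simp add: qnorm_vdiff_scale)
  qed
  show "qnorm ?C s powr p \<le> qnorm ?C t powr p + qnorm ?C (vdiff ?C s t) powr p"
    if st: "s \<in> vecs ?C" "t \<in> vecs ?C" for s t
  proof (rule LIMSEQ_le[OF _ tendsto_add[OF _ limp[OF st]]])
    have "(\<lambda>n. qnorm X (r n) powr p) \<longlonglongrightarrow> qnorm ?C r powr p" if r: "r \<in> vecs ?C" for r
      using r p_pos qnorm_nonneg V qnorm_cauchy_space by (intro tendsto_powr') auto
    with st show "(\<lambda>n. qnorm X (s n) powr p) \<longlonglongrightarrow> qnorm ?C s powr p"
      "(\<lambda>n. qnorm X (t n) powr p) \<longlonglongrightarrow> qnorm ?C t powr p" by auto
    show "\<exists>N. \<forall>n\<ge>N. qnorm X (s n) powr p \<le> qnorm X (t n) powr p + pdist (s n) (t n)"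
      using qnorm_le_add_vdiff st V by (auto simp: pdist_def)
  qed
qed

text \<open>Makes \<open>qn_completion X\<close> an instance of the quotient by
  \<open>null_rel\<close>, since the quasi-norm of a sequence of differences is its limit.\<close>

lemma null_diff_rel_eq: "null_diff_rel X = pseudo_p_normed.null_rel (cauchy_space X)"
proof -
  interpret C: pseudo_p_normed "cauchy_space X" p by (rule pseudo_p_normed_cauchy_space)
  have "(\<lambda>n. qnorm X (vdiff X (s n) (t n))) \<longlonglongrightarrow> 0 \<longleftrightarrow>
      qnorm (cauchy_space X) (vdiff (cauchy_space X) s t) = 0"
    if "s \<in> cauchy_seqs X" "t \<in> cauchy_seqs X" for s t
    using qnorm_cauchy_space[OF cauchy_seqs_vdiff[OF that]] LIMSEQ_unique
    by (auto simp: vdiff_cauchy_space)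
  then show ?thesis
    unfolding null_diff_rel_def C.null_rel_def by (auto simp: cauchy_space_def)
qed

end

section \<open>Maps between quotients given on representatives\<close>

lemma continuous_map_quotients:
  assumes "pseudo_p_normed Z p" "pseudo_p_normed A p"
    and f: "\<And>s. s \<in> vecs Z \<Longrightarrow> f s \<in> vecs A"
    and f_le: "\<And>s t. s \<in> vecs Z \<Longrightarrow> t \<in> vecs Z \<Longrightarrow>
      pseudo_p_normed.pdist A p (f s) (f t) \<le> C * pseudo_p_normed.pdist Z p s t"
    and C: "0 < C"
    and h: "\<And>s. s \<in> vecs Z \<Longrightarrow> h (pseudo_p_normed.cls Z s) = pseudo_p_normed.cls A (f s)"
  shows "continuous_map (qn_topology (qn_quotient Z (pseudo_p_normed.null_rel Z)))
    (qn_topology (qn_quotient A (pseudo_p_normed.null_rel A))) h"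
proof -
  interpret Z: pseudo_p_normed Z p by fact
  interpret A: pseudo_p_normed A p by fact
  show ?thesis
    unfolding continuous_map_def topspace_qn_topology Z.vecs_quot A.vecs_quot openin_qn_topology
  proof (intro conjI allI impI Pi_I)
    show "h P \<in> A.cls ` vecs A" if P: "P \<in> Z.cls ` vecs Z" for P
      using P h f by blast
    fix U assume U: "qn_open A.quot U"
    show "qn_open Z.quot {P \<in> Z.cls ` vecs Z. h P \<in> U}"
      unfolding Z.qn_open_quot_iff
    proof (intro conjI ballI impI)
      fix s assume s: "s \<in> vecs Z" "Z.cls s \<in> {P \<in> Z.cls ` vecs Z. h P \<in> U}"
      then have "A.cls (f s) \<in> U" using h[OF s(1)] by simp
      moreover have "\<forall>x\<in>vecs A. A.cls x \<in> U \<longrightarrow> (\<exists>e>0. \<forall>y\<in>vecs A. A.pdist y x < e \<longrightarrow> A.cls y \<in> U)"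
        using U unfolding A.qn_open_quot_iff by (rule conjunct2)
      ultimately obtain e where e: "e > 0" "\<And>y. y \<in> vecs A \<Longrightarrow> A.pdist y (f s) < e \<Longrightarrow> A.cls y \<in> U"
        using f[OF s(1)] by meson
      show "\<exists>e>0. \<forall>y\<in>vecs Z. Z.pdist y s < e \<longrightarrow> Z.cls y \<in> {P \<in> Z.cls ` vecs Z. h P \<in> U}"
      proof (intro exI[of _ "e / C"] conjI ballI impI)
        fix y assume y: "y \<in> vecs Z" "Z.pdist y s < e / C"
        have "A.pdist (f y) (f s) \<le> C * Z.pdist y s" by (rule f_le[OF y(1) s(1)])
        also have "\<dots> < C * (e / C)" by (rule mult_strict_left_mono[OF y(2) C])
        finally have "A.pdist (f y) (f s) < e" using C by simp
        then have "h (Z.cls y) \<in> U" unfolding h[OF y(1)] by (rule e(2)[OF f[OF y(1)]])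
        then show "Z.cls y \<in> {P \<in> Z.cls ` vecs Z. h P \<in> U}" using y(1) by blast
      qed (simp add: e(1) C)
    qed blast
  qed
qed

text \<open>If the pair \<open>(f, g)\<close> is bi-Lipschitz for \<open>pdist\<close>, and linear
  and onto up to distance zero, it descends to an isomorphism. Allowing distance zero instead of
  equality is essential, as \<open>f\<close> may involve a choice of limits.\<close>

lemma tvs_isomorphic_quotients:
  fixes Z :: "('k::real_normed_field, 'z) qnspace" and A :: "('k, 'a) qnspace" and B :: "('k, 'b) qnspace"
  assumes "pseudo_p_normed Z p" "pseudo_p_normed A p" "pseudo_p_normed B p"
  defines "dZ \<equiv> pseudo_p_normed.pdist Z p" and "dA \<equiv> pseudo_p_normed.pdist A p"
    and "dB \<equiv> pseudo_p_normed.pdist B p"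
  assumes f: "\<And>s. s \<in> vecs Z \<Longrightarrow> f s \<in> vecs A" and g: "\<And>s. s \<in> vecs Z \<Longrightarrow> g s \<in> vecs B"
    and f_le: "\<And>s t. s \<in> vecs Z \<Longrightarrow> t \<in> vecs Z \<Longrightarrow> dA (f s) (f t) \<le> C * dZ s t"
    and g_le: "\<And>s t. s \<in> vecs Z \<Longrightarrow> t \<in> vecs Z \<Longrightarrow> dB (g s) (g t) \<le> C * dZ s t"
    and le_fg: "\<And>s t. s \<in> vecs Z \<Longrightarrow> t \<in> vecs Z \<Longrightarrow> dZ s t \<le> C * (dA (f s) (f t) + dB (g s) (g t))"
    and C: "0 < C"
    and add: "\<And>s t. s \<in> vecs Z \<Longrightarrow> t \<in> vecs Z \<Longrightarrow>
      dA (f (vadd Z s t)) (vadd A (f s) (f t)) = 0 \<and> dB (g (vadd Z s t)) (vadd B (g s) (g t)) = 0"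
    and scale: "\<And>s c. s \<in> vecs Z \<Longrightarrow>
      dA (f (vscale Z c s)) (vscale A c (f s)) = 0 \<and> dB (g (vscale Z c s)) (vscale B c (g s)) = 0"
    and surj: "\<And>u t. u \<in> vecs A \<Longrightarrow> t \<in> vecs B \<Longrightarrow> \<exists>s\<in>vecs Z. dA (f s) u = 0 \<and> dB (g s) t = 0"
  shows "tvs_isomorphic (tvs_of (qn_quotient Z (pseudo_p_normed.null_rel Z)))
    (direct_sum (tvs_of (qn_quotient A (pseudo_p_normed.null_rel A)))
      (tvs_of (qn_quotient B (pseudo_p_normed.null_rel B))))"
proof -
  interpret Z: pseudo_p_normed Z p by fact
  interpret A: pseudo_p_normed A p by fact
  interpret B: pseudo_p_normed B p by fact
  \<comment> \<open>An arbitrary representative is picked; by \<open>f_le\<close> and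
    \<open>g_le\<close> another one would give images at distance zero, hence the same
    classes.\<close>
  define F where "F P = (A.cls (f (SOME s. s \<in> P)), B.cls (g (SOME s. s \<in> P)))" for P
  have F: "F (Z.cls s) = (A.cls (f s), B.cls (g s))" if s: "s \<in> vecs Z" for s
  proof -
    define t where "t = (SOME t. t \<in> Z.cls s)"
    have "t \<in> Z.cls s" unfolding t_def using Z.cls_self[OF s] by (rule someI)
    then have t: "t \<in> vecs Z" "dZ t s = 0"
      using Z.mem_cls_iff[OF s] Z.cls_eq_iff[OF _ s] by (auto simp: dZ_def)
    then have "dA (f t) (f s) = 0" "dB (g t) (g s) = 0"
      using f_le[OF t(1) s] g_le[OF t(1) s] A.pdist_nonneg[of "f t" "f s"] B.pdist_nonneg[of "g t" "g s"]
      by (auto simp: dA_def dB_def)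
    then show ?thesis
      using A.cls_eq_iff[of "f t" "f s"] B.cls_eq_iff[of "g t" "g s"] f g s t
      by (simp add: F_def t_def[symmetric] dA_def dB_def)
  qed
  have top: "topspace (qn_topology Z.quot) = Z.cls ` vecs Z"
    "topspace (qn_topology A.quot) = A.cls ` vecs A" "topspace (qn_topology B.quot) = B.cls ` vecs B"
    by (simp_all add: Z.vecs_quot A.vecs_quot B.vecs_quot)
  have F_image: "F ` topspace (qn_topology Z.quot) = topspace (prod_topology (qn_topology A.quot) (qn_topology B.quot))"
  proof -
    have "(A.cls u, B.cls t) \<in> F ` Z.cls ` vecs Z" if ut: "u \<in> vecs A" "t \<in> vecs B" for u t
    proof -
      obtain s where "s \<in> vecs Z" "dA (f s) u = 0" "dB (g s) t = 0" using surj[OF ut] by blast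
      then have "F (Z.cls s) = (A.cls u, B.cls t)"
        using F A.cls_eq_iff[of "f s" u] B.cls_eq_iff[of "g s" t] f g ut by (simp add: dA_def dB_def)
      then show ?thesis using \<open>s \<in> vecs Z\<close> by (metis imageI)
    qed
    then show ?thesis unfolding topspace_prod_topology top using F f g by auto
  qed
  have F_inj: "inj_on F (topspace (qn_topology Z.quot))"
    unfolding top
  proof (rule inj_onI, clarify)
    fix s t assume st: "s \<in> vecs Z" "t \<in> vecs Z" "F (Z.cls s) = F (Z.cls t)"
    from st(3) have "A.cls (f s) = A.cls (f t)" "B.cls (g s) = B.cls (g t)"
      unfolding F[OF st(1)] F[OF st(2)] by simp_all
    then have "dA (f s) (f t) = 0" "dB (g s) (g t) = 0"
      unfolding dA_def dB_def A.cls_eq_iff[OF f[OF st(1)] f[OF st(2)]]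
        B.cls_eq_iff[OF g[OF st(1)] g[OF st(2)]] .
    then have "dZ s t \<le> 0" using le_fg[OF st(1,2)] by simp
    then show "Z.cls s = Z.cls t"
      using Z.cls_eq_iff[OF st(1,2)] Z.pdist_nonneg[of s t] by (simp add: dZ_def)
  qed
  have contA: "continuous_map (qn_topology Z.quot) (qn_topology A.quot) (fst \<circ> F)"
    by (rule continuous_map_quotients[OF assms(1,2) f f_le[unfolded dZ_def dA_def] C]) (auto simp: F)
  have contB: "continuous_map (qn_topology Z.quot) (qn_topology B.quot) (snd \<circ> F)"
    by (rule continuous_map_quotients[OF assms(1,3) g g_le[unfolded dZ_def dB_def] C]) (auto simp: F)
  have F_open: "open_map (qn_topology Z.quot) (prod_topology (qn_topology A.quot) (qn_topology B.quot)) F"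
    unfolding open_map_def openin_prod_topology_alt openin_qn_topology
  proof (intro allI impI)
    fix U a b assume U: "qn_open Z.quot U" and ab: "(a, b) \<in> F ` U"
    have U_sub: "U \<subseteq> Z.cls ` vecs Z"
      and U_ball: "\<forall>x\<in>vecs Z. Z.cls x \<in> U \<longrightarrow> (\<exists>e>0. \<forall>y\<in>vecs Z. dZ y x < e \<longrightarrow> Z.cls y \<in> U)"
      using U unfolding Z.qn_open_quot_iff dZ_def by (rule conjunct1, rule conjunct2)
    obtain P where "P \<in> U" "F P = (a, b)" using ab by (metis imageE)
    then obtain s where s: "s \<in> vecs Z" "Z.cls s \<in> U" "F (Z.cls s) = (a, b)"
      using U_sub by blast
    obtain e where e: "e > 0" "\<And>y. y \<in> vecs Z \<Longrightarrow> dZ y s < e \<Longrightarrow> Z.cls y \<in> U"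
      using U_ball s(1,2) by meson
    \<comment> \<open>Two balls of radius \<open>r\<close>, one for each component, put the preimage
      supplied by \<open>surj\<close> within \<open>C * (r + r) = e\<close> of \<open>s\<close> by
      \<open>le_fg\<close>.\<close>
    define r where "r = e / (2 * C)"
    have r: "r > 0" "C * (r + r) = e" using e C by (auto simp: r_def)
    let ?U = "A.cls ` {y \<in> vecs A. dA y (f s) < r}" and ?V = "B.cls ` {y \<in> vecs B. dB y (g s) < r}"
    have "qn_open A.quot ?U" "qn_open B.quot ?V"
      unfolding dA_def dB_def by (intro A.qn_open_ball B.qn_open_ball f g s)+
    moreover have "a \<in> ?U" "b \<in> ?V"
      using s F[OF s(1)] f[OF s(1)] g[OF s(1)] r A.pdist_self B.pdist_self by (auto simp: dA_def dB_def)
    moreover have "?U \<times> ?V \<subseteq> F ` U"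
    proof clarify
      fix u t assume u: "u \<in> vecs A" "dA u (f s) < r" and t: "t \<in> vecs B" "dB t (g s) < r"
      obtain y where y: "y \<in> vecs Z" "dA (f y) u = 0" "dB (g y) t = 0" using surj[OF u(1) t(1)] by blast
      have "dA (f y) (f s) < r"
        using A.pdist_triangle[OF f[OF y(1)] u(1) f[OF s(1)]] y u by (simp add: dA_def)
      moreover have "dB (g y) (g s) < r"
        using B.pdist_triangle[OF g[OF y(1)] t(1) g[OF s(1)]] y t by (simp add: dB_def)
      ultimately have "C * (dA (f y) (f s) + dB (g y) (g s)) < C * (r + r)"
        using C by (intro mult_strict_left_mono) auto
      then have "Z.cls y \<in> U" using le_fg[OF y(1) s(1)] r e(2)[OF y(1)] by linarith
      moreover have "F (Z.cls y) = (A.cls u, B.cls t)"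
        using F[OF y(1)] A.cls_eq_iff[OF f[OF y(1)] u(1)] B.cls_eq_iff[OF g[OF y(1)] t(1)] y
        by (simp add: dA_def dB_def)
      ultimately show "(A.cls u, B.cls t) \<in> F ` U" by (metis imageI)
    qed
    ultimately show "\<exists>U' V. qn_open A.quot U' \<and> qn_open B.quot V \<and> a \<in> U' \<and> b \<in> V \<and> U' \<times> V \<subseteq> F ` U"
      by blast
  qed
  have hom: "homeomorphic_map (qn_topology Z.quot) (prod_topology (qn_topology A.quot) (qn_topology B.quot)) F"
    using contA contB F_open F_image F_inj
    by (intro bijective_open_imp_homeomorphic_map) (auto simp: continuous_map_pairwise)
  have "tvs_iso (tvs_of Z.quot) (direct_sum (tvs_of A.quot) (tvs_of B.quot)) F"
    unfolding tvs_iso_def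
  proof (intro conjI)
    show "homeomorphic_map (ttop (tvs_of Z.quot)) (ttop (direct_sum (tvs_of A.quot) (tvs_of B.quot))) F"
      using hom by (simp add: tvs_of_def direct_sum_def)
    have "F (vadd Z.quot (Z.cls s) (Z.cls t)) =
        (vadd A.quot (fst (F (Z.cls s))) (fst (F (Z.cls t))), vadd B.quot (snd (F (Z.cls s))) (snd (F (Z.cls t))))"
      if "s \<in> vecs Z" "t \<in> vecs Z" for s t
      using add[OF that] that f g A.add_closed B.add_closed
        A.cls_eq_iff[of "f (vadd Z s t)" "vadd A (f s) (f t)"]
        B.cls_eq_iff[of "g (vadd Z s t)" "vadd B (g s) (g t)"]
      by (simp add: Z.vadd_quot A.vadd_quot B.vadd_quot F Z.add_closed dA_def dB_def)
    then show "\<forall>x\<in>topspace (ttop (tvs_of Z.quot)). \<forall>y\<in>topspace (ttop (tvs_of Z.quot)).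
        F (tadd (tvs_of Z.quot) x y) = tadd (direct_sum (tvs_of A.quot) (tvs_of B.quot)) (F x) (F y)"
      by (auto simp: tvs_of_def direct_sum_def Z.vecs_quot case_prod_beta)
    have "F (vscale Z.quot c (Z.cls s)) =
        (vscale A.quot c (fst (F (Z.cls s))), vscale B.quot c (snd (F (Z.cls s))))"
      if "s \<in> vecs Z" for s c
      using scale[OF that, of c] that f g A.scale_closed B.scale_closed
        A.cls_eq_iff[of "f (vscale Z c s)" "vscale A c (f s)"]
        B.cls_eq_iff[of "g (vscale Z c s)" "vscale B c (g s)"]
      by (simp add: Z.vscale_quot A.vscale_quot B.vscale_quot F Z.scale_closed dA_def dB_def)
    then show "\<forall>c. \<forall>x\<in>topspace (ttop (tvs_of Z.quot)).
        F (tscale (tvs_of Z.quot) c x) = tscale (direct_sum (tvs_of A.quot) (tvs_of B.quot)) c (F x)"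
      by (auto simp: tvs_of_def direct_sum_def Z.vecs_quot case_prod_beta)
  qed
  then show ?thesis unfolding tvs_isomorphic_def by blast
qed

section \<open>The spaces \<open>L\<^sup>p\<close> and the test classes\<close>

text \<open>Here \<open>qnorm X u powr p\<close> is the least \<open>r\<close> with mass of
  \<open>T i u\<close> at most \<open>r * m i powr p\<close> for all \<open>i\<close>. One index
  with the identity gives L^p, while \<open>T = nth_derivative\<close> and \<open>m = M\<close> give
  the test class. \<open>V\<close> is the ambient linear space, including functions of infinite
  quasi-norm, on which the maps \<open>T i\<close> are linear.\<close>

locale Lp_gauge =
  fixes X :: "('k::{real_normed_field, euclidean_space}, real \<Rightarrow> 'k) qnspace" and p :: real
    and V :: "(real \<Rightarrow> 'k) set" and T :: "'i \<Rightarrow> (real \<Rightarrow> 'k) \<Rightarrow> real \<Rightarrow> 'k" and m :: "'i \<Rightarrow> real"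
  assumes p: "0 < p" "p \<le> 1"
    and vadd_eq: "vadd X = (\<lambda>u v x. u x + v x)"
    and vscale_eq: "vscale X = (\<lambda>c u x. c * u x)"
    and m_pos: "0 < m i"
    and V_add: "u \<in> V \<Longrightarrow> v \<in> V \<Longrightarrow> (\<lambda>x. u x + v x) \<in> V"
    and V_scale: "u \<in> V \<Longrightarrow> (\<lambda>x. c * u x) \<in> V"
    and T_meas: "u \<in> V \<Longrightarrow> T i u \<in> borel_measurable lebesgue"
    and T_add: "u \<in> V \<Longrightarrow> v \<in> V \<Longrightarrow> T i (\<lambda>x. u x + v x) = (\<lambda>x. T i u x + T i v x)"
    and T_scale: "u \<in> V \<Longrightarrow> T i (\<lambda>x. c * u x) = (\<lambda>x. c * T i u x)"
    and vecs_iff: "u \<in> vecs X \<longleftrightarrow> u \<in> V \<and> (\<exists>r\<ge>0. \<forall>i. Lp_mass p (T i u) \<le> ennreal (r * m i powr p))"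
    and qnorm_ge_0: "0 \<le> qnorm X u"
    and qnorm_powr_le_iff: "u \<in> vecs X \<Longrightarrow> 0 \<le> r \<Longrightarrow>
      qnorm X u powr p \<le> r \<longleftrightarrow> (\<forall>i. Lp_mass p (T i u) \<le> ennreal (r * m i powr p))"
begin

lemma vecs_V: "u \<in> vecs X \<Longrightarrow> u \<in> V"
  by (simp add: vecs_iff)

lemma mass_add_le:
  assumes "u \<in> V" "v \<in> V" "0 \<le> r" "0 \<le> s"
    and "Lp_mass p (T i u) \<le> ennreal (r * m i powr p)" "Lp_mass p (T i v) \<le> ennreal (s * m i powr p)"
  shows "Lp_mass p (T i (\<lambda>x. u x + v x)) \<le> ennreal ((r + s) * m i powr p)"
proof -
  have "Lp_mass p (T i (\<lambda>x. u x + v x)) \<le> Lp_mass p (T i u) + Lp_mass p (T i v)"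
    unfolding T_add[OF assms(1,2)] by (intro Lp_mass_add p T_meas assms)
  also have "\<dots> \<le> ennreal (r * m i powr p) + ennreal (s * m i powr p)"
    by (intro add_mono assms)
  also have "\<dots> = ennreal ((r + s) * m i powr p)"
    using assms by (subst ennreal_plus[symmetric]) (auto simp: algebra_simps)
  finally show ?thesis .
qed

lemma mass_scale_le:
  assumes "u \<in> V" "0 \<le> r" "Lp_mass p (T i u) \<le> ennreal (r * m i powr p)"
  shows "Lp_mass p (T i (\<lambda>x. c * u x)) \<le> ennreal ((norm c powr p * r) * m i powr p)"
proof -
  have "Lp_mass p (T i (\<lambda>x. c * u x)) = ennreal (norm c powr p) * Lp_mass p (T i u)"
    unfolding T_scale[OF assms(1)] by (intro Lp_mass_cmult T_meas assms) (auto simp: norm_mult)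
  also have "\<dots> \<le> ennreal (norm c powr p) * ennreal (r * m i powr p)"
    by (intro mult_left_mono assms) simp
  also have "\<dots> = ennreal ((norm c powr p * r) * m i powr p)"
    using assms by (simp add: ennreal_mult'[symmetric] mult.assoc)
  finally show ?thesis .
qed

lemma vecs_add: "u \<in> vecs X \<Longrightarrow> v \<in> vecs X \<Longrightarrow> (\<lambda>x. u x + v x) \<in> vecs X"
  unfolding vecs_iff using V_add mass_add_le by (meson add_nonneg_nonneg)

lemma vecs_scale:
  assumes "u \<in> vecs X" shows "(\<lambda>x. c * u x) \<in> vecs X"
proof -
  obtain r where "0 \<le> r" "\<And>i. Lp_mass p (T i u) \<le> ennreal (r * m i powr p)"
    using assms by (auto simp: vecs_iff)
  then show ?thesis
    unfolding vecs_iff using V_scale mass_scale_le vecs_V[OF assms]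
    by (intro conjI exI[of _ "norm c powr p * r"]) auto
qed

lemma mass_le_qnorm:
  "u \<in> vecs X \<Longrightarrow> Lp_mass p (T i u) \<le> ennreal (qnorm X u powr p * m i powr p)"
  using qnorm_powr_le_iff[of u "qnorm X u powr p"] by simp

lemma qnorm_add:
  assumes "u \<in> vecs X" "v \<in> vecs X"
  shows "qnorm X (\<lambda>x. u x + v x) powr p \<le> qnorm X u powr p + qnorm X v powr p"
  using assms by (subst qnorm_powr_le_iff) (auto intro!: mass_add_le vecs_add mass_le_qnorm vecs_V)

lemma qnorm_scale:
  assumes u: "u \<in> vecs X"
  shows "qnorm X (\<lambda>x. c * u x) = norm c * qnorm X u"
proof -
  have le: "qnorm X (\<lambda>x. c * u x) powr p \<le> norm c powr p * qnorm X u powr p"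
    if "u \<in> vecs X" for c u
    using that by (subst qnorm_powr_le_iff) (auto intro!: mass_scale_le vecs_scale mass_le_qnorm vecs_V)
  have "qnorm X (\<lambda>x. c * u x) powr p = norm c powr p * qnorm X u powr p"
  proof (cases "c = 0")
    case True
    then show ?thesis using le[OF u, of c] by (simp add: order_antisym)
  next
    \<comment> \<open>The inequality \<open>le\<close> is reversed by applying it to the scaled
      function and the factor \<open>inverse c\<close>.\<close>
    case False
    then have "qnorm X u powr p \<le> norm (inverse c) powr p * qnorm X (\<lambda>x. c * u x) powr p"
      using le[OF vecs_scale[OF u, of c], of "inverse c"] by (simp add: mult.assoc[symmetric])
    then have "norm c powr p * qnorm X u powr p \<le>
        norm c powr p * (norm (inverse c) powr p * qnorm X (\<lambda>x. c * u x) powr p)"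
      by (intro mult_left_mono) auto
    also have "norm c powr p * norm (inverse c) powr p = 1"
      using False by (simp add: powr_mult[symmetric] norm_inverse)
    then have "norm c powr p * (norm (inverse c) powr p * qnorm X (\<lambda>x. c * u x) powr p) =
        qnorm X (\<lambda>x. c * u x) powr p"
      by (simp add: mult.assoc[symmetric])
    finally show ?thesis using le[OF u, of c] by linarith
  qed
  then have "(qnorm X (\<lambda>x. c * u x) powr p) powr (1 / p) = ((norm c * qnorm X u) powr p) powr (1 / p)"
    using qnorm_ge_0 by (simp add: powr_mult)
  then show ?thesis using p qnorm_ge_0 by (simp add: powr_powr)
qed

lemma vdiff_eq: "vdiff X u v = (\<lambda>x. u x - v x)"
  by (simp add: vdiff_def vadd_eq vscale_eq)

lemma vecs_diff: "u \<in> vecs X \<Longrightarrow> v \<in> vecs X \<Longrightarrow> (\<lambda>x. u x - v x) \<in> vecs X"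
  using vecs_add[OF _ vecs_scale[of v "- 1"], of u] by simp

lemma T_diff: "u \<in> V \<Longrightarrow> v \<in> V \<Longrightarrow> T i (\<lambda>x. u x - v x) = (\<lambda>x. T i u x - T i v x)"
  using T_add[OF _ V_scale[of v "- 1"], of u i] T_scale[of v i "- 1"] by simp

lemma pseudo: "pseudo_p_normed X p"
proof
  show "0 < p" by (rule p)
  show "vadd X x y \<in> vecs X" if "x \<in> vecs X" "y \<in> vecs X" for x y
    using that vecs_add by (simp add: vadd_eq)
  show "vscale X c x \<in> vecs X" if "x \<in> vecs X" for x c
    using that vecs_scale by (simp add: vscale_eq)
  show "0 \<le> qnorm X x" for x by (rule qnorm_ge_0)
  show "qnorm X (vdiff X x x) = 0" if "x \<in> vecs X" for x
    using qnorm_scale[OF that, of 0] by (simp add: vdiff_eq)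
  show "qnorm X (vdiff X x y) = qnorm X (vdiff X y x)" if "x \<in> vecs X" "y \<in> vecs X" for x y
    using qnorm_scale[OF vecs_diff[OF that(2,1)], of "- 1"] by (simp add: vdiff_eq)
  show "qnorm X (vdiff X x z) powr p \<le> qnorm X (vdiff X x y) powr p + qnorm X (vdiff X y z) powr p"
    if "x \<in> vecs X" "y \<in> vecs X" "z \<in> vecs X" for x y z
    using qnorm_add[OF vecs_diff[OF that(1,2)] vecs_diff[OF that(2,3)]] by (simp add: vdiff_eq)
  show "qnorm X (vdiff X (vadd X x y) (vadd X x' y')) powr p
      \<le> qnorm X (vdiff X x x') powr p + qnorm X (vdiff X y y') powr p"
    if "x \<in> vecs X" "x' \<in> vecs X" "y \<in> vecs X" "y' \<in> vecs X" for x x' y y'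
    using qnorm_add[OF vecs_diff[OF that(1,2)] vecs_diff[OF that(3,4)]]
    by (simp add: vdiff_eq vadd_eq algebra_simps)
  show "qnorm X (vdiff X (vscale X c x) (vscale X c y)) = norm c * qnorm X (vdiff X x y)"
    if "x \<in> vecs X" "y \<in> vecs X" for x y c
    using qnorm_scale[OF vecs_diff[OF that], of c] by (simp add: vdiff_eq vscale_eq algebra_simps)
  show "qnorm X x powr p \<le> qnorm X y powr p + qnorm X (vdiff X x y) powr p"
    if "x \<in> vecs X" "y \<in> vecs X" for x y
    using qnorm_add[OF that(2) vecs_diff[OF that]] by (simp add: vdiff_eq)
qed

sublocale pseudo_p_normed X p
  by (rule pseudo)

lemma pdist_le_iff:
  assumes "u \<in> vecs X" "v \<in> vecs X" "0 \<le> r"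
  shows "pdist u v \<le> r \<longleftrightarrow> (\<forall>i. Lp_mass p (\<lambda>x. T i u x - T i v x) \<le> ennreal (r * m i powr p))"
  unfolding pdist_def vdiff_eq using qnorm_powr_le_iff[OF vecs_diff[OF assms(1,2)] assms(3)]
  by (simp add: T_diff vecs_V assms)

text \<open>A function at finite distance from a member is a member, being the sum of that member
  and the difference. Limits and approximants, first found only in \<open>V\<close>, are placed in
  the space this way.\<close>

lemma vecs_near:
  assumes v: "v \<in> V" and u: "u \<in> vecs X" and "0 \<le> r"
    and b: "\<And>i. Lp_mass p (\<lambda>x. T i v x - T i u x) \<le> ennreal (r * m i powr p)"
  shows "v \<in> vecs X"
proof -
  have d: "(\<lambda>x. v x - u x) \<in> V"
    using V_add[OF v V_scale[OF vecs_V[OF u], of "- 1"]] by simp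
  then have "(\<lambda>x. v x - u x) \<in> vecs X"
    unfolding vecs_iff using b \<open>0 \<le> r\<close> by (auto simp: T_diff v vecs_V u)
  from vecs_add[OF u this] show ?thesis by simp
qed

end

lemma Lp_enorm_le_iff:
  assumes "0 < p" "0 \<le> c"
  shows "Lp_enorm p u \<le> ennreal c \<longleftrightarrow> Lp_mass p u \<le> ennreal (c powr p)"
proof (cases "Lp_mass p u")
  case (real r)
  have "r powr (1 / p) \<le> c \<longleftrightarrow> r \<le> c powr p"
  proof
    assume "r powr (1 / p) \<le> c"
    then have "(r powr (1 / p)) powr p \<le> c powr p" using assms by (intro powr_mono2) auto
    then show "r \<le> c powr p" using assms real by (simp add: powr_powr)
  next
    assume "r \<le> c powr p"
    then have "r powr (1 / p) \<le> (c powr p) powr (1 / p)" using assms real by (intro powr_mono2) auto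
    then show "r powr (1 / p) \<le> c" using assms by (simp add: powr_powr)
  qed
  then show ?thesis using real assms by (simp add: Lp_enorm_def Lp_mass_def[symmetric])
next
  case top
  then show ?thesis by (simp add: Lp_enorm_def Lp_mass_def[symmetric] top_unique)
qed

lemma Lp_enorm_finite_iff: "Lp_enorm p u < \<infinity> \<longleftrightarrow> Lp_mass p u < \<infinity>"
  unfolding Lp_enorm_def Lp_mass_def[symmetric] Let_def by (cases "Lp_mass p u") auto

lemma enn2real_le_iff_finite: "a < \<infinity> \<Longrightarrow> 0 \<le> c \<Longrightarrow> enn2real a \<le> c \<longleftrightarrow> a \<le> ennreal c"
  by (cases a) auto

lemma powr_le_iff_le_powr_inverse:
  fixes x r p :: real
  assumes "0 \<le> x" "0 \<le> r" "0 < p"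
  shows "x powr p \<le> r \<longleftrightarrow> x \<le> r powr (1 / p)"
proof
  assume "x powr p \<le> r"
  then have "(x powr p) powr (1 / p) \<le> r powr (1 / p)" using assms by (intro powr_mono2) auto
  then show "x \<le> r powr (1 / p)" using assms by (simp add: powr_powr)
next
  assume "x \<le> r powr (1 / p)"
  then have "x powr p \<le> (r powr (1 / p)) powr p" using assms by (intro powr_mono2) auto
  then show "x powr p \<le> r" using assms by (simp add: powr_powr)
qed

text \<open>Bounding a supremum means bounding each quotient, and each such bound is one on a p-th
  power. This provides the form that \<open>Lp_gauge\<close> requires.\<close>

lemma carleman_enorm_le_iff:
  assumes "0 < p" "0 \<le> r" "\<And>n. 0 < M n"
  shows "carleman_enorm p M u \<le> ennreal (r powr (1 / p)) \<longleftrightarrow>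
    (\<forall>n. Lp_mass p (nth_derivative n u) \<le> ennreal (r * M n powr p))"
proof -
  have div: "a / ennreal d \<le> ennreal c \<longleftrightarrow> a \<le> ennreal (c * d)" if "0 < d" "0 \<le> c" for a c d
    using that by (cases a) (auto simp: divide_ennreal divide_le_eq ennreal_top_divide top_unique)
  have "Lp_enorm p (nth_derivative n u) / ennreal (M n) \<le> ennreal (r powr (1 / p)) \<longleftrightarrow>
      Lp_mass p (nth_derivative n u) \<le> ennreal (r * M n powr p)" for n
    using assms(1,2) assms(3)[of n] by (simp add: div Lp_enorm_le_iff powr_mult powr_powr)
  then show ?thesis unfolding carleman_enorm_def SUP_le_iff by simp
qed

lemma Lp_gauge_Lp_functions:
  assumes "0 < p" "p \<le> 1"
  shows "Lp_gauge (Lp_functions p :: ('k::{real_normed_field, euclidean_space}, real \<Rightarrow> 'k) qnspace) p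
    (borel_measurable lebesgue) (\<lambda>_::unit. \<lambda>u. u) (\<lambda>_. 1)"
proof
  fix u :: "real \<Rightarrow> 'k"
  show "u \<in> vecs (Lp_functions p) \<longleftrightarrow> u \<in> borel_measurable lebesgue \<and>
      (\<exists>r\<ge>0. \<forall>i::unit. Lp_mass p u \<le> ennreal (r * 1 powr p))"
  proof -
    have "Lp_mass p u < \<infinity> \<longleftrightarrow> (\<exists>r\<ge>0. Lp_mass p u \<le> ennreal r)"
      by (cases "Lp_mass p u") (auto simp: top_unique)
    then show ?thesis by (simp add: Lp_functions_def Lp_enorm_finite_iff[simplified])
  qed
  fix r :: real assume "u \<in> vecs (Lp_functions p)" and r: "0 \<le> r"
  then have "Lp_enorm p u < \<infinity>" by (simp add: Lp_functions_def)
  then show "qnorm (Lp_functions p) u powr p \<le> r \<longleftrightarrow> (\<forall>i::unit. Lp_mass p u \<le> ennreal (r * 1 powr p))"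
    using assms r by (simp add: Lp_functions_def powr_le_iff_le_powr_inverse enn2real_le_iff_finite
        Lp_enorm_le_iff powr_powr)
qed (use assms in \<open>auto simp: Lp_functions_def\<close>)

lemma derivative_tower_cmult:
  fixes F :: "nat \<Rightarrow> real \<Rightarrow> 'a::real_normed_algebra"
  shows "derivative_tower F \<Longrightarrow> derivative_tower (\<lambda>n x. c * F n x)"
  unfolding derivative_tower_def by (auto intro!: has_vector_derivative_mult_right)

lemma nth_derivative_0: "nth_derivative 0 u = u"
  by (simp add: nth_derivative_def)

lemma smooth_real_add: "smooth_real u \<Longrightarrow> smooth_real v \<Longrightarrow> smooth_real (\<lambda>x. u x + v x)"
  using smooth_real_tower[OF derivative_tower_add[OF smooth_real_imp_tower smooth_real_imp_tower]]
  by (simp add: nth_derivative_0)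

lemma smooth_real_cmult:
  fixes u :: "real \<Rightarrow> 'a::real_normed_field"
  shows "smooth_real u \<Longrightarrow> smooth_real (\<lambda>x. c * u x)"
  using smooth_real_tower[OF derivative_tower_cmult[OF smooth_real_imp_tower]]
  by (simp add: nth_derivative_0)

lemma nth_derivative_add:
  "smooth_real u \<Longrightarrow> smooth_real v \<Longrightarrow>
    nth_derivative n (\<lambda>x. u x + v x) = (\<lambda>x. nth_derivative n u x + nth_derivative n v x)"
  using nth_derivative_tower[OF derivative_tower_add[OF smooth_real_imp_tower smooth_real_imp_tower]]
  by (simp add: nth_derivative_0)

lemma nth_derivative_cmult:
  fixes u :: "real \<Rightarrow> 'a::real_normed_field"
  shows "smooth_real u \<Longrightarrow> nth_derivative n (\<lambda>x. c * u x) = (\<lambda>x. c * nth_derivative n u x)"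
  using nth_derivative_tower[OF derivative_tower_cmult[OF smooth_real_imp_tower]]
  by (simp add: nth_derivative_0)

lemma Lp_gauge_test_class:
  assumes p: "0 < p" "p \<le> 1" and M: "\<And>n. 0 < M n"
  shows "Lp_gauge (test_class p M :: ('k::{real_normed_field, euclidean_space}, real \<Rightarrow> 'k) qnspace) p
    (Collect smooth_real) nth_derivative M"
proof
  fix u :: "real \<Rightarrow> 'k"
  show "u \<in> vecs (test_class p M) \<longleftrightarrow> u \<in> Collect smooth_real \<and>
      (\<exists>r\<ge>0. \<forall>i. Lp_mass p (nth_derivative i u) \<le> ennreal (r * M i powr p))"
  proof -
    have "carleman_enorm p M u < \<infinity> \<longleftrightarrow> (\<exists>r\<ge>0. carleman_enorm p M u \<le> ennreal (r powr (1 / p)))"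
    proof (cases "carleman_enorm p M u")
      case (real c)
      then have "(c powr p) powr (1 / p) = c" using p by (simp add: powr_powr)
      then show ?thesis using real by (auto intro!: exI[of _ "c powr p"])
    next
      case top
      then show ?thesis by (auto simp: top_unique)
    qed
    then show ?thesis using p M by (auto simp: test_class_def carleman_enorm_le_iff)
  qed
  fix r :: real assume "u \<in> vecs (test_class p M)" and r: "0 \<le> r"
  then have "carleman_enorm p M u < \<infinity>" by (simp add: test_class_def)
  then show "qnorm (test_class p M) u powr p \<le> r \<longleftrightarrow>
      (\<forall>i. Lp_mass p (nth_derivative i u) \<le> ennreal (r * M i powr p))"
    using p M r by (simp add: test_class_def powr_le_iff_le_powr_inverse enn2real_le_iff_finite
        carleman_enorm_le_iff)
qed (use p M in \<open>auto simp: test_class_def smooth_real_add smooth_real_cmult nth_derivative_add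
    nth_derivative_cmult intro: derivative_tower_measurable smooth_real_imp_tower\<close>)

lemma (in pseudo_p_normed) pdist_tendsto_pdist:
  assumes V: "\<And>n. s n \<in> vecs X" "\<And>n. t n \<in> vecs X" "u \<in> vecs X" "v \<in> vecs X"
    and lim: "(\<lambda>n. pdist (s n) u) \<longlonglongrightarrow> 0" "(\<lambda>n. pdist (t n) v) \<longlonglongrightarrow> 0"
  shows "(\<lambda>n. pdist (s n) (t n)) \<longlonglongrightarrow> pdist u v"
proof -
  have "norm (pdist (s n) (t n) - pdist u v) \<le> pdist (s n) u + pdist (t n) v" for n
  proof -
    have "pdist (s n) (t n) \<le> pdist (s n) u + (pdist u v + pdist v (t n))"
      using pdist_triangle[OF V(1)[of n] V(3) V(2)[of n]] pdist_triangle[OF V(3,4) V(2)[of n]]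
      by linarith
    moreover have "pdist u v \<le> pdist u (s n) + (pdist (s n) (t n) + pdist (t n) v)"
      using pdist_triangle[OF V(3) V(1)[of n] V(4)] pdist_triangle[OF V(1)[of n] V(2)[of n] V(4)]
      by linarith
    ultimately show ?thesis
      using pdist_commute[OF V(4) V(2)[of n]] pdist_commute[OF V(3) V(1)[of n]]
      unfolding real_norm_def abs_le_iff by linarith
  qed
  moreover have "(\<lambda>n. pdist (s n) u + pdist (t n) v) \<longlonglongrightarrow> 0"
    using tendsto_add[OF lim] by simp
  ultimately have "(\<lambda>n. pdist (s n) (t n) - pdist u v) \<longlonglongrightarrow> 0"
    by (rule Lim_null_comparison[OF always_eventually, OF allI])
  then show ?thesis by (rule LIM_zero_cancel)
qed

section \<open>The isomorphism\<close>

abbreviation Lp_dist ::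
    "real \<Rightarrow> (real \<Rightarrow> 'k) \<Rightarrow> (real \<Rightarrow> 'k::{real_normed_field, euclidean_space}) \<Rightarrow> real" where
  "Lp_dist p \<equiv> pseudo_p_normed.pdist (Lp_functions p) p"

abbreviation test_dist ::
    "real \<Rightarrow> (nat \<Rightarrow> real) \<Rightarrow> (real \<Rightarrow> 'k) \<Rightarrow> (real \<Rightarrow> 'k::{real_normed_field, euclidean_space}) \<Rightarrow> real" where
  "test_dist p M \<equiv> pseudo_p_normed.pdist (test_class p M) p"

lemma nth_derivative_shift:
  assumes "smooth_real u"
  shows "nth_derivative n (nth_derivative 1 u) = nth_derivative (Suc n) u"
    and "smooth_real (nth_derivative 1 u)"
proof -
  have "derivative_tower (\<lambda>n. nth_derivative (Suc n) u)"
    using smooth_real_imp_tower[OF assms] by (simp add: derivative_tower_def)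
  from nth_derivative_tower[OF this, of n] smooth_real_tower[OF this]
  show "nth_derivative n (nth_derivative 1 u) = nth_derivative (Suc n) u"
    and "smooth_real (nth_derivative 1 u)" unfolding One_nat_def .
qed

lemma (in pseudo_p_normed) pdist_limit_unique:
  assumes "\<And>n. s n \<in> vecs X" "u \<in> vecs X" "v \<in> vecs X"
    and "(\<lambda>n. pdist (s n) u) \<longlonglongrightarrow> 0" "(\<lambda>n. pdist (s n) v) \<longlonglongrightarrow> 0"
  shows "pdist u v = 0"
proof -
  have "(\<lambda>n. pdist (s n) (s n)) \<longlonglongrightarrow> pdist u v"
    by (rule pdist_tendsto_pdist) fact+
  moreover have "(\<lambda>n. pdist (s n) (s n)) = (\<lambda>n. 0)"
    by (intro ext pdist_self assms)
  ultimately show ?thesis by (simp add: LIMSEQ_const_iff)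
qed

lemma cauchy_seqs_image:
  assumes "pseudo_p_normed X p" "pseudo_p_normed A p" and s: "s \<in> cauchy_seqs X" and C: "0 < C"
    and f: "\<And>u. u \<in> vecs X \<Longrightarrow> f u \<in> vecs A"
    and le: "\<And>u v. u \<in> vecs X \<Longrightarrow> v \<in> vecs X \<Longrightarrow>
      pseudo_p_normed.pdist A p (f u) (f v) \<le> C * pseudo_p_normed.pdist X p u v"
  shows "(\<lambda>n. f (s n)) \<in> cauchy_seqs A"
proof -
  interpret X: pseudo_p_normed X p by fact
  interpret A: pseudo_p_normed A p by fact
  note sv = X.cauchy_seqs_D(1)[OF s]
  show ?thesis
    unfolding A.cauchy_seqs_iff
  proof (intro conjI allI impI)
    show "f (s n) \<in> vecs A" for n by (rule f[OF sv])
    fix e :: real assume "e > 0"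
    then have "e / C > 0" using C by simp
    then obtain N where N: "\<And>m n. m \<ge> N \<Longrightarrow> n \<ge> N \<Longrightarrow> X.pdist (s m) (s n) < e / C"
      using X.cauchy_seqs_D(2)[OF s] by blast
    have "A.pdist (f (s m)) (f (s n)) < e" if mn: "m \<ge> N" "n \<ge> N" for m n
    proof -
      have "A.pdist (f (s m)) (f (s n)) \<le> C * X.pdist (s m) (s n)" by (rule le[OF sv sv])
      also have "\<dots> < C * (e / C)" by (rule mult_strict_left_mono[OF N[OF mn] C])
      finally show ?thesis using C by simp
    qed
    then show "\<exists>N. \<forall>m\<ge>N. \<forall>n\<ge>N. A.pdist (f (s m)) (f (s n)) < e" by blast
  qed
qed

lemma ae_rel_eq:
  assumes "0 < p" "p \<le> 1"
  shows "(ae_rel p :: ((real \<Rightarrow> 'k::{real_normed_field, euclidean_space}) \<times> _) set) =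
    pseudo_p_normed.null_rel (Lp_functions p)"
proof -
  interpret Lp_gauge "Lp_functions p :: ('k, real \<Rightarrow> 'k) qnspace" p
    "borel_measurable lebesgue" "\<lambda>_::unit. \<lambda>u. u" "\<lambda>_. 1"
    by (rule Lp_gauge_Lp_functions[OF assms])
  have "(AE x in lebesgue. u x = v x) \<longleftrightarrow> qnorm (Lp_functions p) (vdiff (Lp_functions p) u v) = 0"
    if uv: "u \<in> vecs (Lp_functions p)" "v \<in> vecs (Lp_functions p)" for u v :: "real \<Rightarrow> 'k"
  proof -
    have [measurable]: "u \<in> borel_measurable lebesgue" "v \<in> borel_measurable lebesgue"
      using uv vecs_V by auto
    have "qnorm (Lp_functions p) (vdiff (Lp_functions p) u v) = 0 \<longleftrightarrow> pdist u v \<le> 0"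
      using pdist_nonneg[of u v] pdist_eq_0_iff[of u v] by auto
    also have "\<dots> \<longleftrightarrow> Lp_mass p (\<lambda>x. u x - v x) = 0"
      using pdist_le_iff[OF uv, of 0] by simp
    also have "\<dots> \<longleftrightarrow> (AE x in lebesgue. ennreal (norm (u x - v x) powr p) = 0)"
      unfolding Lp_mass_def by (intro nn_integral_0_iff_AE) measurable
    also have "\<dots> \<longleftrightarrow> (AE x in lebesgue. u x = v x)" by simp
    finally show ?thesis by blast
  qed
  then show ?thesis unfolding ae_rel_def null_rel_def by blast
qed

lemma Lp_functions_complete:
  fixes s :: "nat \<Rightarrow> real \<Rightarrow> 'k::{real_normed_field, euclidean_space}"
  assumes p: "0 < p" "p \<le> 1" and s: "s \<in> cauchy_seqs (Lp_functions p)"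
  shows "\<exists>u\<in>vecs (Lp_functions p). (\<lambda>n. Lp_dist p (s n) u) \<longlonglongrightarrow> 0"
proof -
  interpret Lp_gauge "Lp_functions p :: ('k, real \<Rightarrow> 'k) qnspace" p
    "borel_measurable lebesgue" "\<lambda>_::unit. \<lambda>u. u" "\<lambda>_. 1"
    by (rule Lp_gauge_Lp_functions[OF p])
  note sv = cauchy_seqs_D(1)[OF s]
  have "\<exists>N. \<forall>m\<ge>N. \<forall>n\<ge>N. Lp_mass p (\<lambda>x. s m x - s n x) \<le> ennreal e" if e: "0 < e" for e :: real
  proof -
    obtain N where N: "\<And>m n. m \<ge> N \<Longrightarrow> n \<ge> N \<Longrightarrow> pdist (s m) (s n) < e"
      using cauchy_seqs_D(2)[OF s e] by blast
    have "Lp_mass p (\<lambda>x. s m x - s n x) \<le> ennreal e" if "m \<ge> N" "n \<ge> N" for m n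
      using pdist_le_iff[OF sv[of m] sv[of n], of e] N[OF that] e by simp
    then show ?thesis by blast
  qed
  from Lp_complete[OF p vecs_V[OF sv] this]
  obtain u where u: "u \<in> borel_measurable lebesgue"
    and lim: "\<And>e. 0 < e \<Longrightarrow> \<exists>N. \<forall>n\<ge>N. Lp_mass p (\<lambda>x. s n x - u x) \<le> ennreal e"
    by blast
  \<comment> \<open>Distance at most 1 from a single term is enough for the limit to have finite
    quasi-norm, by \<open>vecs_near\<close>.\<close>
  obtain N where "Lp_mass p (\<lambda>x. s N x - u x) \<le> ennreal 1"
    using lim[of 1] by auto
  then have "Lp_mass p (\<lambda>x. u x - s N x) \<le> ennreal (1 * 1 powr p)"
    using Lp_mass_cong_norm[of "\<lambda>x. u x - s N x" "\<lambda>x. s N x - u x" p]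
    by (simp add: norm_minus_commute)
  then have uv: "u \<in> vecs (Lp_functions p)"
    by (rule vecs_near[OF u sv[of N], rotated]) simp
  have "(\<lambda>n. pdist (s n) u) \<longlonglongrightarrow> 0"
  proof (rule LIMSEQ_I)
    fix e :: real assume "e > 0"
    then have e: "e / 2 > 0" by simp
    then obtain N where N: "\<And>n. n \<ge> N \<Longrightarrow> Lp_mass p (\<lambda>x. s n x - u x) \<le> ennreal (e / 2)"
      using lim[OF e] by blast
    have "norm (pdist (s n) u - 0) < e" if "n \<ge> N" for n
      using pdist_le_iff[OF sv[of n] uv, of "e / 2"] N[OF that] e pdist_nonneg[of "s n" u] by simp
    then show "\<exists>N. \<forall>n\<ge>N. norm (pdist (s n) u - 0) < e" by blast
  qed
  then show ?thesis using uv by blast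
qed

section \<open>The derivative map on the test class, and its extension to completions\<close>

context
  fixes p :: real and M :: "nat \<Rightarrow> real" and ty :: "'k::{real_normed_field, euclidean_space} itself"
  assumes p: "0 < p" "p < 1" and M: "\<And>n. 0 < M n"
begin

interpretation X: Lp_gauge "test_class p M :: ('k, real \<Rightarrow> 'k) qnspace" p
  "Collect smooth_real" nth_derivative M
  by (rule Lp_gauge_test_class[OF p(1) less_imp_le[OF p(2)] M])

interpretation Y: Lp_gauge "test_class p (\<lambda>n. M (Suc n)) :: ('k, real \<Rightarrow> 'k) qnspace" p
  "Collect smooth_real" nth_derivative "\<lambda>n. M (Suc n)"
  by (rule Lp_gauge_test_class[OF p(1) less_imp_le[OF p(2)] M])

interpretation A: Lp_gauge "Lp_functions p :: ('k, real \<Rightarrow> 'k) qnspace" p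
  "borel_measurable lebesgue" "\<lambda>_::unit. \<lambda>u. u" "\<lambda>_. 1"
  by (rule Lp_gauge_Lp_functions[OF p(1) less_imp_le[OF p(2)]])

lemma smooth_measurable: "smooth_real u \<Longrightarrow> u \<in> borel_measurable lebesgue"
  using derivative_tower_measurable[OF smooth_real_imp_tower, of u 0] by (simp add: nth_derivative_0)

lemma test_class_iff:
  fixes u :: "real \<Rightarrow> 'k"
  shows "u \<in> vecs (test_class p M) \<longleftrightarrow> smooth_real u \<and> u \<in> vecs (Lp_functions p) \<and>
    nth_derivative 1 u \<in> vecs (test_class p (\<lambda>n. M (Suc n)))"
proof (cases "smooth_real u")
  case u: True
  have "(\<exists>r\<ge>0. \<forall>i. Lp_mass p (nth_derivative i u) \<le> ennreal (r * M i powr p)) \<longleftrightarrow>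
      (\<exists>r\<ge>0. Lp_mass p u \<le> ennreal r) \<and>
      (\<exists>r\<ge>0. \<forall>i. Lp_mass p (nth_derivative (Suc i) u) \<le> ennreal (r * M (Suc i) powr p))"
    (is "?L \<longleftrightarrow> ?A \<and> ?B")
  proof
    assume ?L
    then obtain r where r: "0 \<le> r" "\<And>i. Lp_mass p (nth_derivative i u) \<le> ennreal (r * M i powr p)"
      by blast
    then have "0 \<le> r * M 0 powr p" "Lp_mass p u \<le> ennreal (r * M 0 powr p)"
      using r(2)[of 0] by (auto simp: nth_derivative_0)
    with r show "?A \<and> ?B" by blast
  next
    assume "?A \<and> ?B"
    then obtain r s where r: "0 \<le> r" "Lp_mass p u \<le> ennreal r" and s: "0 \<le> s"
      "\<And>i. Lp_mass p (nth_derivative (Suc i) u) \<le> ennreal (s * M (Suc i) powr p)" by blast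
    \<comment> \<open>The first summand of the constant takes care of order 0, the second of all
      higher orders.\<close>
    have "Lp_mass p (nth_derivative i u) \<le> ennreal ((r / M 0 powr p + s) * M i powr p)" for i
    proof (cases i)
      case 0
      have "r \<le> (r / M 0 powr p + s) * M 0 powr p" using s(1) M[of 0] by (simp add: distrib_right)
      then show ?thesis using r(2) 0 by (auto simp: nth_derivative_0 intro: order_trans ennreal_leI)
    next
      case (Suc j)
      have "s * M i powr p \<le> (r / M 0 powr p + s) * M i powr p"
        using r(1) by (simp add: distrib_right)
      then show ?thesis using s(2)[of j] Suc by (auto intro: order_trans ennreal_leI)
    qed
    then show ?L using r(1) s(1) by (intro exI[of _ "r / M 0 powr p + s"]) auto
  qed
  then show ?thesis
    unfolding X.vecs_iff Y.vecs_iff A.vecs_iff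
    using u smooth_measurable[OF u] nth_derivative_shift[OF u] by simp
qed (simp add: X.vecs_iff)

lemma test_classD:
  fixes u :: "real \<Rightarrow> 'k"
  assumes "u \<in> vecs (test_class p M)"
  shows "smooth_real u" "u \<in> vecs (Lp_functions p)"
    "nth_derivative 1 u \<in> vecs (test_class p (\<lambda>n. M (Suc n)))"
  using assms test_class_iff by auto

text \<open>The supremum over all orders splits into order 0 and the rest, so the distance is the
  maximum of \<open>Lp_dist p u v / M 0 powr p\<close> and the distance of the derivatives.\<close>

lemma test_dist_le_iff:
  fixes u v :: "real \<Rightarrow> 'k"
  assumes uv: "u \<in> vecs (test_class p M)" "v \<in> vecs (test_class p M)" and "0 \<le> r"
  shows "test_dist p M u v \<le> r \<longleftrightarrow> Lp_dist p u v \<le> r * M 0 powr p \<and>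
    test_dist p (\<lambda>n. M (Suc n)) (nth_derivative 1 u) (nth_derivative 1 v) \<le> r"
proof -
  have all: "(\<forall>i. P i) \<longleftrightarrow> P 0 \<and> (\<forall>i. P (Suc i))" for P :: "nat \<Rightarrow> bool"
    by (metis nat.exhaust)
  have "0 \<le> r * M 0 powr p" using assms by simp
  then show ?thesis
    using X.pdist_le_iff[OF assms]
      A.pdist_le_iff[OF test_classD(2)[OF uv(1)] test_classD(2)[OF uv(2)], of "r * M 0 powr p"]
      Y.pdist_le_iff[OF test_classD(3)[OF uv(1)] test_classD(3)[OF uv(2)] \<open>0 \<le> r\<close>]
    by (subst (asm) all)
       (simp add: nth_derivative_0 nth_derivative_shift[OF test_classD(1)[OF uv(1)], simplified]
         nth_derivative_shift[OF test_classD(1)[OF uv(2)], simplified])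
qed

text \<open>\<open>derivative_pair_dense\<close> is used with the weights
  \<open>M (Suc n) powr p\<close>. The function obtained is at first only smooth; it belongs to the
  test class because it and its derivative are at finite distance from \<open>u\<close> and
  \<open>t\<close>.\<close>

lemma test_class_dense:
  fixes u t :: "real \<Rightarrow> 'k"
  assumes u: "u \<in> vecs (Lp_functions p)" and t: "t \<in> vecs (test_class p (\<lambda>n. M (Suc n)))" and e: "0 < e"
  shows "\<exists>w\<in>vecs (test_class p M). Lp_dist p w u \<le> e \<and>
    test_dist p (\<lambda>n. M (Suc n)) (nth_derivative 1 w) t \<le> e"
proof -
  have "smooth_real t" using Y.vecs_V[OF t] by simp
  note G = smooth_real_imp_tower[OF this]
  have "Lp_mass p u < \<infinity>" using A.mass_le_qnorm[OF u] by (auto intro: le_less_trans)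
  then obtain W where W: "derivative_tower W" "Lp_mass p (\<lambda>x. W 0 x - u x) \<le> ennreal e"
    "\<And>n. Lp_mass p (\<lambda>x. W (Suc n) x - nth_derivative n t x) \<le> ennreal (e * M (Suc n) powr p)"
    using derivative_pair_dense[OF p, of "\<lambda>n. M (Suc n) powr p" u "\<lambda>n. nth_derivative n t" e]
      A.vecs_V[OF u] G e M by (auto simp: less_imp_neq[symmetric])
  have sm: "smooth_real (W 0)" by (rule smooth_real_tower[OF W(1)])
  have D: "nth_derivative n (nth_derivative 1 (W 0)) = W (Suc n)" for n
    using nth_derivative_shift[OF sm] nth_derivative_tower[OF W(1)] by simp
  have A: "W 0 \<in> vecs (Lp_functions p)"
    by (rule A.vecs_near[OF smooth_measurable[OF sm] u, of e]) (use W e in auto)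
  have Y: "nth_derivative 1 (W 0) \<in> vecs (test_class p (\<lambda>n. M (Suc n)))"
    by (rule Y.vecs_near[OF _ t, of _ e]) (use W e nth_derivative_shift(2)[OF sm] D in auto)
  have "W 0 \<in> vecs (test_class p M)" using sm A Y test_class_iff by blast
  moreover have "Lp_dist p (W 0) u \<le> e" using A.pdist_le_iff[OF A u, of e] W e by simp
  moreover have "test_dist p (\<lambda>n. M (Suc n)) (nth_derivative 1 (W 0)) t \<le> e"
    using Y.pdist_le_iff[OF Y t, of e] W e D by simp
  ultimately show ?thesis by blast
qed

lemma Lp_dist_le_test_dist:
  fixes u v :: "real \<Rightarrow> 'k"
  assumes "u \<in> vecs (test_class p M)" "v \<in> vecs (test_class p M)"
  shows "Lp_dist p u v \<le> M 0 powr p * test_dist p M u v"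
    and "test_dist p (\<lambda>n. M (Suc n)) (nth_derivative 1 u) (nth_derivative 1 v) \<le> test_dist p M u v"
  using test_dist_le_iff[OF assms X.pdist_nonneg[of u v]] by (simp_all add: mult.commute)

lemma test_dist_le_add:
  fixes u v :: "real \<Rightarrow> 'k"
  assumes "u \<in> vecs (test_class p M)" "v \<in> vecs (test_class p M)"
  shows "test_dist p M u v \<le> Lp_dist p u v / M 0 powr p +
    test_dist p (\<lambda>n. M (Suc n)) (nth_derivative 1 u) (nth_derivative 1 v)" (is "_ \<le> ?a / _ + ?b")
proof -
  have ab: "0 \<le> ?a" "0 \<le> ?b" by (rule A.pdist_nonneg, rule Y.pdist_nonneg)
  have pos: "0 < M 0 powr p" using M[of 0] by simp
  have "?a \<le> (?a / M 0 powr p + ?b) * M 0 powr p"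
    using ab pos by (simp add: distrib_right)
  moreover have "?b \<le> ?a / M 0 powr p + ?b" using ab pos by simp
  moreover have "0 \<le> ?a / M 0 powr p + ?b" using ab pos by simp
  ultimately show ?thesis using test_dist_le_iff[OF assms] by blast
qed

text \<open>One constant for the three Lipschitz estimates, which need \<open>M 0 powr p\<close>,
  \<open>1\<close> and \<open>1 / M 0 powr p\<close> respectively; a sum dominates all of
  them.\<close>

definition dist_const :: real where
  "dist_const = M 0 powr p + 1 + 1 / M 0 powr p"

lemma dist_const_bounds:
  "0 < dist_const" "M 0 powr p \<le> dist_const" "1 \<le> dist_const" "1 / M 0 powr p \<le> dist_const"
proof -
  have "0 < M 0 powr p" "0 \<le> 1 / M 0 powr p" using M[of 0] by simp_all
  then show "0 < dist_const" "M 0 powr p \<le> dist_const" "1 \<le> dist_const" "1 / M 0 powr p \<le> dist_const"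
    unfolding dist_const_def by linarith+
qed

lemma dist_const_le:
  fixes u v :: "real \<Rightarrow> 'k"
  assumes uv: "u \<in> vecs (test_class p M)" "v \<in> vecs (test_class p M)"
  shows "Lp_dist p u v \<le> dist_const * test_dist p M u v"
    and "test_dist p (\<lambda>n. M (Suc n)) (nth_derivative 1 u) (nth_derivative 1 v) \<le> dist_const * test_dist p M u v"
    and "test_dist p M u v \<le> dist_const * (Lp_dist p u v +
      test_dist p (\<lambda>n. M (Suc n)) (nth_derivative 1 u) (nth_derivative 1 v))"
proof -
  note nn = X.pdist_nonneg[of u v] A.pdist_nonneg[of u v]
    Y.pdist_nonneg[of "nth_derivative 1 u" "nth_derivative 1 v"]
  note le = Lp_dist_le_test_dist[OF uv] test_dist_le_add[OF uv]
  show "Lp_dist p u v \<le> dist_const * test_dist p M u v"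
    using le(1) mult_right_mono[OF dist_const_bounds(2) nn(1)] by linarith
  show "test_dist p (\<lambda>n. M (Suc n)) (nth_derivative 1 u) (nth_derivative 1 v) \<le> dist_const * test_dist p M u v"
    using le(2) mult_right_mono[OF dist_const_bounds(3) nn(1)] by linarith
  show "test_dist p M u v \<le> dist_const * (Lp_dist p u v +
      test_dist p (\<lambda>n. M (Suc n)) (nth_derivative 1 u) (nth_derivative 1 v))"
    using le(3) mult_right_mono[OF dist_const_bounds(4) nn(2)] mult_right_mono[OF dist_const_bounds(3) nn(3)]
    unfolding distrib_left by simp
qed

text \<open>A Cauchy sequence \<open>s\<close> is sent to its limit \<open>f s\<close> in L^p, a
  function, and to the Cauchy sequence \<open>g s\<close> of its derivatives. The estimates for the
  test class pass to these by taking limits along the sequences.\<close>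

lemma W_space_isomorphic:
  "tvs_isomorphic (tvs_of (W_space p M :: ('k, (nat \<Rightarrow> real \<Rightarrow> 'k) set) qnspace))
    (direct_sum (tvs_of (Lp_space p :: ('k, (real \<Rightarrow> 'k) set) qnspace))
      (tvs_of (W_space p (\<lambda>n. M (Suc n)) :: ('k, (nat \<Rightarrow> real \<Rightarrow> 'k) set) qnspace)))"
proof -
  let ?X = "test_class p M :: ('k, real \<Rightarrow> 'k) qnspace"
  let ?Y = "test_class p (\<lambda>n. M (Suc n)) :: ('k, real \<Rightarrow> 'k) qnspace"
  let ?A = "Lp_functions p :: ('k, real \<Rightarrow> 'k) qnspace"
  interpret CX: pseudo_p_normed "cauchy_space ?X" p by (rule X.pseudo_p_normed_cauchy_space)
  interpret CY: pseudo_p_normed "cauchy_space ?Y" p by (rule Y.pseudo_p_normed_cauchy_space)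
  have vecs_C: "vecs (cauchy_space ?X) = cauchy_seqs ?X" "vecs (cauchy_space ?Y) = cauchy_seqs ?Y"
    by (simp_all add: cauchy_space_def)
  define D where "D = (nth_derivative 1 :: (real \<Rightarrow> 'k) \<Rightarrow> real \<Rightarrow> 'k)"
  define g where "g s n = D (s n)" for s :: "nat \<Rightarrow> real \<Rightarrow> 'k" and n :: nat
  define f where "f s = (SOME u. u \<in> vecs ?A \<and> (\<lambda>n. A.pdist (s n) u) \<longlonglongrightarrow> 0)" for s
  have XD: "u \<in> vecs ?A" "D u \<in> vecs ?Y" "smooth_real u" if "u \<in> vecs ?X" for u
    using test_classD[OF that] by (auto simp: D_def)
  have A_cauchy: "s \<in> cauchy_seqs ?A" if "s \<in> cauchy_seqs ?X" for s
    using cauchy_seqs_image[OF X.pseudo A.pseudo that dist_const_bounds(1) XD(1) dist_const_le(1)] .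
  have g_cauchy: "g s \<in> cauchy_seqs ?Y" if "s \<in> cauchy_seqs ?X" for s
    using cauchy_seqs_image[OF X.pseudo Y.pseudo that dist_const_bounds(1) XD(2) dist_const_le(2)[folded D_def]]
    by (simp add: g_def[abs_def])
  have f: "f s \<in> vecs ?A" "(\<lambda>n. A.pdist (s n) (f s)) \<longlonglongrightarrow> 0" if "s \<in> cauchy_seqs ?X" for s
  proof -
    have "\<exists>u. u \<in> vecs ?A \<and> (\<lambda>n. A.pdist (s n) u) \<longlonglongrightarrow> 0"
      using Lp_functions_complete[OF p(1) less_imp_le[OF p(2)] A_cauchy[OF that]] by blast
    from someI_ex[OF this] show "f s \<in> vecs ?A" "(\<lambda>n. A.pdist (s n) (f s)) \<longlonglongrightarrow> 0"
      unfolding f_def by blast+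
  qed
  have limX: "(\<lambda>n. X.pdist (s n) (t n)) \<longlonglongrightarrow> CX.pdist s t"
    if "s \<in> cauchy_seqs ?X" "t \<in> cauchy_seqs ?X" for s t
    unfolding CX.pdist_def by (rule X.pdist_tendsto[OF that])
  have limY: "(\<lambda>n. Y.pdist (s n) (t n)) \<longlonglongrightarrow> CY.pdist s t"
    if "s \<in> cauchy_seqs ?Y" "t \<in> cauchy_seqs ?Y" for s t
    unfolding CY.pdist_def by (rule Y.pdist_tendsto[OF that])
  have limA: "(\<lambda>n. A.pdist (s n) (t n)) \<longlonglongrightarrow> A.pdist (f s) (f t)"
    if s: "s \<in> cauchy_seqs ?X" and t: "t \<in> cauchy_seqs ?X" for s t
    by (rule A.pdist_tendsto_pdist[OF XD(1)[OF X.cauchy_seqs_D(1)[OF s]] XD(1)[OF X.cauchy_seqs_D(1)[OF t]]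
        f(1)[OF s] f(1)[OF t] f(2)[OF s] f(2)[OF t]])
  have limG: "(\<lambda>n. Y.pdist (D (s n)) (D (t n))) \<longlonglongrightarrow> CY.pdist (g s) (g t)"
    if s: "s \<in> cauchy_seqs ?X" and t: "t \<in> cauchy_seqs ?X" for s t
    using limY[OF g_cauchy[OF s] g_cauchy[OF t]] by (simp add: g_def)
  note sX = X.cauchy_seqs_D(1)
  have "tvs_isomorphic (tvs_of CX.quot) (direct_sum (tvs_of A.quot) (tvs_of CY.quot))"
  proof (rule tvs_isomorphic_quotients[where f = f and g = g and C = dist_const,
        OF CX.pseudo_p_normed_axioms A.pseudo CY.pseudo_p_normed_axioms, unfolded vecs_C])
    fix s t assume st: "s \<in> cauchy_seqs ?X" "t \<in> cauchy_seqs ?X"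
    show "A.pdist (f s) (f t) \<le> dist_const * CX.pdist s t"
      by (rule LIMSEQ_le[OF limA[OF st] tendsto_mult_left[OF limX[OF st]]])
         (use dist_const_le(1)[OF sX[OF st(1)] sX[OF st(2)]] in blast)
    show "CY.pdist (g s) (g t) \<le> dist_const * CX.pdist s t"
      by (rule LIMSEQ_le[OF limG[OF st] tendsto_mult_left[OF limX[OF st]]])
         (use dist_const_le(2)[OF sX[OF st(1)] sX[OF st(2)]] in \<open>unfold D_def, blast\<close>)
    show "CX.pdist s t \<le> dist_const * (A.pdist (f s) (f t) + CY.pdist (g s) (g t))"
      by (rule LIMSEQ_le[OF limX[OF st] tendsto_mult_left[OF tendsto_add[OF limA[OF st] limG[OF st]]]])
         (use dist_const_le(3)[OF sX[OF st(1)] sX[OF st(2)]] in \<open>unfold D_def, blast\<close>)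
    have add_C: "vadd (cauchy_space ?X) s t = (\<lambda>n. vadd ?X (s n) (t n))" by (simp add: cauchy_space_def)
    have sum: "(\<lambda>n. vadd ?X (s n) (t n)) \<in> cauchy_seqs ?X" by (rule X.cauchy_seqs_add[OF st])
    \<comment> \<open>As \<open>f\<close> chooses a limit, additivity is claimed up to distance zero
      only: both functions are limits of the sequence of sums.\<close>
    have "A.pdist (f (\<lambda>n. vadd ?X (s n) (t n))) (vadd ?A (f s) (f t)) = 0"
    proof (rule A.pdist_limit_unique)
      show "vadd ?X (s n) (t n) \<in> vecs ?A" for n by (rule XD(1)[OF sX[OF sum]])
      show "(\<lambda>n. A.pdist (vadd ?X (s n) (t n)) (vadd ?A (f s) (f t))) \<longlonglongrightarrow> 0"
      proof (rule tendsto_sandwich[OF _ _ tendsto_const])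
        show "(\<lambda>n. A.pdist (s n) (f s) + A.pdist (t n) (f t)) \<longlonglongrightarrow> 0"
          using tendsto_add[OF f(2)[OF st(1)] f(2)[OF st(2)]] by simp
        show "\<forall>\<^sub>F n in sequentially. A.pdist (vadd ?X (s n) (t n)) (vadd ?A (f s) (f t))
            \<le> A.pdist (s n) (f s) + A.pdist (t n) (f t)"
          unfolding X.vadd_eq A.vadd_eq[symmetric]
          by (intro always_eventually allI A.pdist_add XD(1) sX f st)
        show "\<forall>\<^sub>F n in sequentially. 0 \<le> A.pdist (vadd ?X (s n) (t n)) (vadd ?A (f s) (f t))"
          by (intro always_eventually allI A.pdist_nonneg)
      qed
    qed (intro f A.add_closed sum st)+
    moreover have "g (\<lambda>n. vadd ?X (s n) (t n)) = vadd (cauchy_space ?Y) (g s) (g t)"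
      unfolding g_def[abs_def] D_def cauchy_space_def X.vadd_eq Y.vadd_eq
      using nth_derivative_add[OF XD(3)[OF sX[OF st(1)]] XD(3)[OF sX[OF st(2)]]] by simp
    moreover have "CY.pdist (g (\<lambda>n. vadd ?X (s n) (t n))) (g (\<lambda>n. vadd ?X (s n) (t n))) = 0"
      by (rule CY.pdist_self) (simp only: vecs_C g_cauchy[OF sum])
    ultimately show "A.pdist (f (vadd (cauchy_space ?X) s t)) (vadd ?A (f s) (f t)) = 0 \<and>
        CY.pdist (g (vadd (cauchy_space ?X) s t)) (vadd (cauchy_space ?Y) (g s) (g t)) = 0"
      unfolding add_C by simp
  next
    fix s and c :: 'k assume s: "s \<in> cauchy_seqs ?X"
    have scale_C: "vscale (cauchy_space ?X) c s = (\<lambda>n. vscale ?X c (s n))" by (simp add: cauchy_space_def)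
    have cs: "(\<lambda>n. vscale ?X c (s n)) \<in> cauchy_seqs ?X" by (rule X.cauchy_seqs_scale[OF s])
    have "A.pdist (f (\<lambda>n. vscale ?X c (s n))) (vscale ?A c (f s)) = 0"
    proof (rule A.pdist_limit_unique)
      show "vscale ?X c (s n) \<in> vecs ?A" for n by (rule XD(1)[OF sX[OF cs]])
      have "A.pdist (vscale ?X c (s n)) (vscale ?A c (f s)) = norm c powr p * A.pdist (s n) (f s)" for n
        unfolding X.vscale_eq A.vscale_eq[symmetric] by (intro A.pdist_scale XD(1) sX f s)
      then show "(\<lambda>n. A.pdist (vscale ?X c (s n)) (vscale ?A c (f s))) \<longlonglongrightarrow> 0"
        using tendsto_mult_left[OF f(2)[OF s], of "norm c powr p"] by simp
    qed (intro f A.scale_closed cs s)+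
    moreover have "g (\<lambda>n. vscale ?X c (s n)) = vscale (cauchy_space ?Y) c (g s)"
      unfolding g_def[abs_def] D_def cauchy_space_def X.vscale_eq Y.vscale_eq
      using nth_derivative_cmult[OF XD(3)[OF sX[OF s]]] by simp
    moreover have "CY.pdist (g (\<lambda>n. vscale ?X c (s n))) (g (\<lambda>n. vscale ?X c (s n))) = 0"
      by (rule CY.pdist_self) (simp only: vecs_C g_cauchy[OF cs])
    ultimately show "A.pdist (f (vscale (cauchy_space ?X) c s)) (vscale ?A c (f s)) = 0 \<and>
        CY.pdist (g (vscale (cauchy_space ?X) c s)) (vscale (cauchy_space ?Y) c (g s)) = 0"
      unfolding scale_C by simp
  next
    fix u t assume u: "u \<in> vecs ?A" and t: "t \<in> cauchy_seqs ?Y"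
    note tY = Y.cauchy_seqs_D(1)[OF t]
    define e where "e n = inverse (real (Suc n))" for n
    have e: "e n > 0" for n by (simp add: e_def)
    have e0: "e \<longlonglongrightarrow> 0" unfolding e_def[abs_def] by (rule LIMSEQ_inverse_real_of_nat)
    \<comment> \<open>Surjectivity by a diagonal choice: the n-th approximant has its derivative
      close to \<open>t n\<close>, a term of the given Cauchy sequence, and is itself close to the
      fixed \<open>u\<close>.\<close>
    have "\<exists>w. w \<in> vecs ?X \<and> A.pdist w u \<le> e n \<and> Y.pdist (D w) (t n) \<le> e n" for n
      using test_class_dense[OF u tY[of n] e[of n]] unfolding D_def by blast
    then have "\<forall>n. \<exists>w. w \<in> vecs ?X \<and> A.pdist w u \<le> e n \<and> Y.pdist (D w) (t n) \<le> e n" by blast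
    from choice[OF this] obtain s where s: "\<And>n. s n \<in> vecs ?X" "\<And>n. A.pdist (s n) u \<le> e n"
      "\<And>n. Y.pdist (D (s n)) (t n) \<le> e n" by blast
    have s_cauchy: "s \<in> cauchy_seqs ?X"
      unfolding X.cauchy_seqs_iff
    proof (intro conjI allI impI)
      show "s n \<in> vecs ?X" for n by (rule s)
      fix r :: real assume "r > 0"
      \<comment> \<open>Five distances enter: two between the approximants and \<open>u\<close>, two
        between their derivatives and \<open>t m\<close>, \<open>t n\<close>, and the one between
        \<open>t m\<close> and \<open>t n\<close>.\<close>
      then have r: "r / (5 * dist_const) > 0" using dist_const_bounds(1) by simp
      obtain N1 where N1: "\<And>n. n \<ge> N1 \<Longrightarrow> e n < r / (5 * dist_const)"
        using order_tendstoD(2)[OF e0 r] unfolding eventually_sequentially by blast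
      obtain N2 where N2: "\<And>m n. m \<ge> N2 \<Longrightarrow> n \<ge> N2 \<Longrightarrow> Y.pdist (t m) (t n) < r / (5 * dist_const)"
        using Y.cauchy_seqs_D(2)[OF t r] by blast
      have "X.pdist (s m) (s n) < r" if mn: "m \<ge> max N1 N2" "n \<ge> max N1 N2" for m n
      proof -
        have en: "e m < r / (5 * dist_const)" "e n < r / (5 * dist_const)"
          "Y.pdist (t m) (t n) < r / (5 * dist_const)"
          using N1[of m] N1[of n] N2[of m n] mn by auto
        have "A.pdist (s m) (s n) \<le> A.pdist (s m) u + A.pdist (s n) u"
          using A.pdist_triangle[OF XD(1)[OF s(1)[of m]] u XD(1)[OF s(1)[of n]]]
            A.pdist_commute[OF u XD(1)[OF s(1)[of n]]] by linarith
        moreover have "Y.pdist (D (s m)) (D (s n)) \<le>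
            Y.pdist (D (s m)) (t m) + (Y.pdist (t m) (t n) + Y.pdist (D (s n)) (t n))"
          using Y.pdist_triangle[OF XD(2)[OF s(1)[of m]] tY[of m] XD(2)[OF s(1)[of n]]]
            Y.pdist_triangle[OF tY[of m] tY[of n] XD(2)[OF s(1)[of n]]]
            Y.pdist_commute[OF tY[of n] XD(2)[OF s(1)[of n]]] by linarith
        ultimately have "A.pdist (s m) (s n) + Y.pdist (D (s m)) (D (s n)) < 5 * (r / (5 * dist_const))"
          using s(2)[of m] s(2)[of n] s(3)[of m] s(3)[of n] en by linarith
        then have "dist_const * (A.pdist (s m) (s n) + Y.pdist (D (s m)) (D (s n)))
            < dist_const * (5 * (r / (5 * dist_const)))"
          by (rule mult_strict_left_mono[OF _ dist_const_bounds(1)])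
        also have "\<dots> = r" using dist_const_bounds(1) by simp
        finally show ?thesis
          using dist_const_le(3)[OF s(1)[of m] s(1)[of n]] unfolding D_def by linarith
      qed
      then show "\<exists>N. \<forall>m\<ge>N. \<forall>n\<ge>N. X.pdist (s m) (s n) < r" by blast
    qed
    have "(\<lambda>n. A.pdist (s n) u) \<longlonglongrightarrow> 0"
      by (rule tendsto_sandwich[OF _ _ tendsto_const e0])
         (intro always_eventually allI A.pdist_nonneg s(2))+
    from A.pdist_limit_unique[OF XD(1)[OF s(1)] f(1)[OF s_cauchy] u f(2)[OF s_cauchy] this]
    have "A.pdist (f s) u = 0" .
    moreover have "CY.pdist (g s) t = 0"
    proof (rule LIMSEQ_unique[OF limY[OF g_cauchy[OF s_cauchy] t]])
      show "(\<lambda>n. Y.pdist (g s n) (t n)) \<longlonglongrightarrow> 0"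
        unfolding g_def
        by (rule tendsto_sandwich[OF _ _ tendsto_const e0])
           (intro always_eventually allI Y.pdist_nonneg s(3))+
    qed
    ultimately show "\<exists>s\<in>cauchy_seqs ?X. A.pdist (f s) u = 0 \<and> CY.pdist (g s) t = 0"
      using s_cauchy by blast
  qed (intro f g_cauchy dist_const_bounds; assumption)+
  then show ?thesis
    unfolding W_space_def qn_completion_def Lp_space_def X.null_diff_rel_eq Y.null_diff_rel_eq
      ae_rel_eq[OF p(1) less_imp_le[OF p(2)]] .
qed

end

theorem theorem3:
  fixes p :: real and M :: "nat \<Rightarrow> real"
  assumes "0 < p" and "p < 1"
    and "\<And>n. 0 < M n"
  shows "tvs_isomorphic
    (tvs_of (W_space p M
      :: ('k::{real_normed_field, euclidean_space}, (nat \<Rightarrow> real \<Rightarrow> 'k) set) qnspace))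
    (direct_sum
      (tvs_of (Lp_space p :: ('k, (real \<Rightarrow> 'k) set) qnspace))
      (tvs_of (W_space p (\<lambda>n. M (Suc n)) :: ('k, (nat \<Rightarrow> real \<Rightarrow> 'k) set) qnspace)))"
  using assms by (rule W_space_isomorphic)

end
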